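(* Suppose that, in the asymptotic regime described in the context, the following hypotheses hold: (1) the restricted processes $X_{\mathcal R}$, $X_{\mathcal R\setminus\mathcal S}$, $X_{\mathcal S}$ and $X_{\mathcal S\setminus\mathcal R}$ are all irreducible; (2) $\phi^*_{\mathcal R\setminus\mathcal S}\ll\gamma_{\mathcal R}$ and $\phi^*_{\mathcal S\setminus\mathcal R}\ll\gamma_{\mathcal S}$; (3) $\mu(\mathcal S)\ge\mu(\mathcal R)$ and $\phi^*_{\mathcal R\setminus\mathcal S}\ll\gamma_{\mathcal S}$. Choose $\kappa,\lambda>0$ (depending on the parameters of the regime) such that $$\phi^*_{\mathcal R\setminus\mathcal S}\ll\kappa\ll\gamma_{\mathcal R}\qquad\text{and}\qquad \max\bigl(\phi^*_{\mathcal R\setminus\mathcal S},\phi^*_{\mathcal S\setminus\mathcal R}\bigr)\ll\lambda\ll\gamma_{\mathcal S}.$$ Then $$\frac1\gamma\sim\frac{\mu(\mathcal R)\mu(\mathcal S)}{C_\kappa^\lambda(\mathcal R,\mathcal S)}\qquad\text{and}\qquad \mathbb E_{\mu_{\mathcal R}}\bigl[T_{\lambda_{\mathcal S}}\bigr]\sim\frac{\mu(\mathcal R)}{C_\kappa^\lambda(\mathcal R,\mathcal S)}.$$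
   Context: Dynamics. $X=(X(t))_{t\ge0}$ is an irreducible continuous-time Markov process on a finite set $\mathcal X=\mathcal R\cup\mathcal S$ ($\mathcal R$ and $\mathcal S$ may overlap), with generator $(\mathcal Lf)(x)=\sum_{y\ne x}w(x,y)[f(y)-f(x)]$, reversible with respect to a probability measure $\mu$. Its Dirichlet form is $\mathcal D(f)=\frac12\sum_{x,y\in\mathcal X}\mu(x)w(x,y)[f(x)-f(y)]^2$ and its spectral gap is $\gamma=\min\{\mathcal D(f)/\mathrm{Var}_\mu(f):\mathrm{Var}_\mu(f)\ne0\}$. $\mathbb P_\nu,\mathbb E_\nu$ denote probability and expectation for $X$ started from the law $\nu$ ($\mathbb P_x$ when started from $x$). Restricted dynamics. For $\mathcal Y\subset\mathcal X$, $\mu_{\mathcal Y}=\mu(\cdot\mid\mathcal Y)$, and $X_{\mathcal Y}$ is the process on $\mathcal Y$ with generator $(\mathcal L_{\mathcal Y}f)(x)=\sum_{y\in\mathcal Y\setminus\{x\}}w(x,y)[f(y)-f(x)]$, $x\in\mathcal Y$, which is reversible with respect to $\mu_{\mathcal Y}$. When it is irreducible, its spectral gap is $\gamma_{\mathcal Y}=\min\{\mathcal D_{\mathcal Y}(f)/\mathrm{Var}_{\mu_{\mathcal Y}}(f): f:\mathcal Y\to\mathbb R,\ \mathrm{Var}_{\mu_{\mathcal Y}}(f)\neq0\}$ with $\mathcal D_{\mathcal Y}(f)=\frac12\sum_{x,y\in\mathcal Y}\mu_{\mathcal Y}(x)w(x,y)[f(x)-f(y)]^2$ (read as $+\infty$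 if $\mathcal Y$ is a singleton). The exit rate is $\phi^*_{\mathcal Y}=\min\{\mathcal D(f)/\mu(f^2): f:\mathcal X\to\mathbb R,\ f\ne0,\ f|_{\mathcal X\setminus\mathcal Y}=0\}$. Killing times. For $\mathcal A\subset\mathcal X$, $\ell_{\mathcal A}(t)=\int_0^t\mathbf 1_{\{X(s)\in\mathcal A\}}ds$. Let $\sigma_\kappa,\sigma_\lambda$ be exponential random variables of rates $\kappa,\lambda$, independent of each other and of $X$. Set $T_{\lambda_{\mathcal S}}=\min\{t\ge0:\ell_{\mathcal S}(t)\ge\sigma_\lambda\}$ and $T_{\kappa_{\mathcal R}}=\min\{t\ge0:\ell_{\mathcal R}(t)\ge\sigma_\kappa\}$. Soft capacity. With $V_\kappa^\lambda(x)=\mathbb P_x(T_{\kappa_{\mathcal R}}<T_{\lambda_{\mathcal S}})$, $$C_\kappa^\lambda(\mathcal R,\mathcal S)=\mathcal D(V_\kappa^\lambda)+\kappa\,\mu(\mathcal R)\,E_{\mu_{\mathcal R}}\bigl[(V_\kappa^\lambda-1)^2\bigr]+\lambda\,\mu(\mathcal S)\,E_{\mu_{\mathcal S}}\bigl[(V_\kappa^\lambda)^2\bigr].$$ Asymptotic regime. The dynamics (hence $\mathcal X,\mathcal R,\mathcal S,w,\mu$ and all derived quantities) depends on some parameters going to given finite or infinite limits. For nonnegative quantities $f,g$ depending on the parameters, $f\ll g$ means that $f/g\to0$, and $f\sim g$ means that $f/g\to1$. *)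

theory Defs
  imports "HOL-Probability.Probability"
begin

section \<open>Reversible dynamics on a finite set\<close>

text \<open>
  Jump rates are given by \<open>w x y\<close> for \<open>x \<noteq> y\<close>; the values \<open>w x x\<close> play no role.
  The process restricted to \<open>Y\<close> has the same rates, so each notion below takes the
  set \<open>Y\<close> as an argument and is used for the full state space and for its subsets.
\<close>

definition generator :: "'a set \<Rightarrow> ('a \<Rightarrow> 'a \<Rightarrow> real) \<Rightarrow> ('a \<Rightarrow> real) \<Rightarrow> 'a \<Rightarrow> real" where
  "generator Y w f x = (\<Sum>y\<in>Y - {x}. w x y * (f y - f x))"

text \<open>A process on the empty set does not make sense, so irreducibility includes \<open>Y \<noteq> {}\<close>.\<close>

definition irreducible_on :: "'a set \<Rightarrow> ('a \<Rightarrow> 'a \<Rightarrow> real) \<Rightarrow> bool" where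
  "irreducible_on Y w \<longleftrightarrow> Y \<noteq> {} \<and>
     (\<forall>x\<in>Y. \<forall>y\<in>Y. (x, y) \<in> {(u, v). u \<in> Y \<and> v \<in> Y \<and> u \<noteq> v \<and> w u v > 0}\<^sup>*)"

definition reversible_dynamics :: "'a set \<Rightarrow> ('a \<Rightarrow> 'a \<Rightarrow> real) \<Rightarrow> 'a pmf \<Rightarrow> bool" where
  "reversible_dynamics E w \<mu> \<longleftrightarrow>
     finite E \<and> set_pmf \<mu> \<subseteq> E \<and>
     (\<forall>x\<in>E. \<forall>y\<in>E. x \<noteq> y \<longrightarrow> w x y \<ge> 0) \<and>
     irreducible_on E w \<and>
     (\<forall>x\<in>E. \<forall>y\<in>E. pmf \<mu> x * w x y = pmf \<mu> y * w y x)"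

definition dirichlet_form :: "'a set \<Rightarrow> ('a \<Rightarrow> 'a \<Rightarrow> real) \<Rightarrow> 'a pmf \<Rightarrow> ('a \<Rightarrow> real) \<Rightarrow> real" where
  "dirichlet_form Y w \<nu> f = 1 / 2 * (\<Sum>x\<in>Y. \<Sum>y\<in>Y. pmf \<nu> x * w x y * (f x - f y)\<^sup>2)"

text \<open>
  Minima are written as infima in \<^typ>\<open>ennreal\<close>. Over the empty set this gives \<open>\<infinity>\<close>, which is
  the convention for the gap of a process on a singleton. Values of \<open>f\<close> outside the
  relevant set affect neither numerator nor denominator.
\<close>

definition spectral_gap :: "'a set \<Rightarrow> ('a \<Rightarrow> 'a \<Rightarrow> real) \<Rightarrow> 'a pmf \<Rightarrow> ennreal" where
  "spectral_gap Y w \<nu> =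
     (INF f\<in>{f. measure_pmf.variance \<nu> f \<noteq> 0}.
        ennreal (dirichlet_form Y w \<nu> f / measure_pmf.variance \<nu> f))"

definition restricted_gap :: "('a \<Rightarrow> 'a \<Rightarrow> real) \<Rightarrow> 'a pmf \<Rightarrow> 'a set \<Rightarrow> ennreal" where
  "restricted_gap w \<mu> Y = spectral_gap Y w (cond_pmf \<mu> Y)"

definition exit_rate :: "'a set \<Rightarrow> ('a \<Rightarrow> 'a \<Rightarrow> real) \<Rightarrow> 'a pmf \<Rightarrow> 'a set \<Rightarrow> ennreal" where
  "exit_rate E w \<mu> Y =
     (INF f\<in>{f. (\<exists>x\<in>E. f x \<noteq> 0) \<and> (\<forall>x\<in>E - Y. f x = 0)}.
        ennreal (dirichlet_form E w \<mu> f / measure_pmf.expectation \<mu> (\<lambda>x. (f x)\<^sup>2)))"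


section \<open>The Markov process\<close>

text \<open>The semigroup \<open>exp (t L)\<close>, as a power series in the generator \<open>L\<close>.\<close>

definition transition :: "'a set \<Rightarrow> ('a \<Rightarrow> 'a \<Rightarrow> real) \<Rightarrow> real \<Rightarrow> 'a \<Rightarrow> 'a \<Rightarrow> real" where
  "transition E w t x y = (\<Sum>k. t ^ k / fact k * ((generator E w ^^ k) (indicator {y})) x)"

text \<open>
  \<open>X\<close> is a Markov process on \<open>E\<close> with jump rates \<open>w\<close>, started from \<open>x\<close> under \<open>P x\<close>: its paths are
  right-continuous for the discrete topology, and it has the Markov property with respect
  to its natural filtration, with semigroup \<open>exp (t L)\<close>.
\<close>

definition markov_process ::
  "'a set \<Rightarrow> ('a \<Rightarrow> 'a \<Rightarrow> real) \<Rightarrow> ('a \<Rightarrow> 'b measure) \<Rightarrow> (real \<Rightarrow> 'b \<Rightarrow> 'a) \<Rightarrow> bool" where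
  "markov_process E w P X \<longleftrightarrow> (\<forall>x\<in>E.
     prob_space (P x) \<and>
     (\<forall>t\<ge>0. X t \<in> measurable (P x) (count_space E)) \<and>
     (\<forall>\<omega>\<in>space (P x). \<forall>t\<ge>0. eventually (\<lambda>s. X s \<omega> = X t \<omega>) (at_right t)) \<and>
     (AE \<omega> in P x. X 0 \<omega> = x) \<and>
     (\<forall>t\<ge>0. \<forall>s\<ge>0. \<forall>y\<in>E. \<forall>z\<in>E.
        \<forall>A\<in>sigma_sets (space (P x)) {X u -` {v} \<inter> space (P x) | u v. 0 \<le> u \<and> u \<le> t}.
          measure (P x) {\<omega>\<in>A. X t \<omega> = y \<and> X (t + s) \<omega> = z} =
          measure (P x) {\<omega>\<in>A. X t \<omega> = y} * transition E w s y z))"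


section \<open>Killing times and soft capacity\<close>

definition local_time :: "(real \<Rightarrow> 'b \<Rightarrow> 'a) \<Rightarrow> 'a set \<Rightarrow> real \<Rightarrow> 'b \<Rightarrow> real" where
  "local_time X A t \<omega> = (LBINT s:{0..t}. indicator A (X s \<omega>))"

text \<open>The killing time in terms of the path \<open>\<omega>\<close> and of the value \<open>a\<close> of the exponential variable;
  it is \<open>\<infinity>\<close> if the local time never reaches \<open>a\<close>.\<close>

definition killing_time :: "(real \<Rightarrow> 'b \<Rightarrow> 'a) \<Rightarrow> 'a set \<Rightarrow> 'b \<Rightarrow> real \<Rightarrow> ennreal" where
  "killing_time X A \<omega> a = (INF t\<in>{t. 0 \<le> t \<and> a \<le> local_time X A t \<omega>}. ennreal t)"

definition exponential :: "real \<Rightarrow> real measure" where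
  "exponential l = density lborel (exponential_density l)"

text \<open>
  Independence of the two exponential variables from each other and from the process is
  expressed by the product measure.
\<close>

definition hitting_prob ::
  "('a \<Rightarrow> 'b measure) \<Rightarrow> (real \<Rightarrow> 'b \<Rightarrow> 'a) \<Rightarrow> real \<Rightarrow> real \<Rightarrow> 'a set \<Rightarrow> 'a set \<Rightarrow> 'a \<Rightarrow> real" where
  "hitting_prob P X \<kappa> l R S x =
     measure (P x \<Otimes>\<^sub>M (exponential \<kappa> \<Otimes>\<^sub>M exponential l))
       {(\<omega>, a, b). \<omega> \<in> space (P x) \<and> killing_time X R \<omega> a < killing_time X S \<omega> b}"

definition soft_capacity ::
  "'a set \<Rightarrow> ('a \<Rightarrow> 'a \<Rightarrow> real) \<Rightarrow> 'a pmf \<Rightarrow> ('a \<Rightarrow> 'b measure) \<Rightarrow> (real \<Rightarrow> 'b \<Rightarrow> 'a) \<Rightarrow>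
     real \<Rightarrow> real \<Rightarrow> 'a set \<Rightarrow> 'a set \<Rightarrow> real" where
  "soft_capacity E w \<mu> P X \<kappa> l R S =
     (let V = hitting_prob P X \<kappa> l R S in
        dirichlet_form E w \<mu> V
        + \<kappa> * measure \<mu> R * measure_pmf.expectation (cond_pmf \<mu> R) (\<lambda>x. (V x - 1)\<^sup>2)
        + l * measure \<mu> S * measure_pmf.expectation (cond_pmf \<mu> S) (\<lambda>x. (V x)\<^sup>2))"

definition mean_killing_time ::
  "('a \<Rightarrow> 'b measure) \<Rightarrow> (real \<Rightarrow> 'b \<Rightarrow> 'a) \<Rightarrow> 'a pmf \<Rightarrow> real \<Rightarrow> 'a set \<Rightarrow> ennreal" where
  "mean_killing_time P X \<nu> l S =
     (\<integral>\<^sup>+x. (\<integral>\<^sup>+(\<omega>, b). killing_time X S \<omega> b \<partial>(P x \<Otimes>\<^sub>M exponential l)) \<partial>measure_pmf \<nu>)"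


section \<open>Asymptotics along a filter of parameters\<close>

text \<open>
  Gaps and mean times take values in \<open>[0, \<infinity>]\<close>, so the Landau symbols of the library, which
  need a normed field, do not apply. In \<^typ>\<open>ennreal\<close>, \<open>x / \<infinity> = 0\<close>.
\<close>

definition asymp_negligible :: "('p \<Rightarrow> ennreal) \<Rightarrow> 'p filter \<Rightarrow> ('p \<Rightarrow> ennreal) \<Rightarrow> bool"
    ("(_ \<lless>[_] _)" [51, 10, 51] 50) where
  "f \<lless>[F] g \<longleftrightarrow> ((\<lambda>p. f p / g p) \<longlongrightarrow> 0) F"

definition asymp_equal :: "('p \<Rightarrow> ennreal) \<Rightarrow> 'p filter \<Rightarrow> ('p \<Rightarrow> ennreal) \<Rightarrow> bool"
    ("(_ \<simeq>[_] _)" [51, 10, 51] 50) where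
  "f \<simeq>[F] g \<longleftrightarrow> ((\<lambda>p. f p / g p) \<longlongrightarrow> 1) F"

end

theory Submission
  imports Defs
begin

text \<open>
  The probabilistic objects satisfy linear equations. Let \<open>L\<close> be the generator. For a killing rate \<open>c\<close>
  on the state space, the expectation \<open>\<phi> g t\<close> of \<open>exp (- \<integral>\<^sub>0\<^sup>t c (X s) ds) * g (X t)\<close> satisfies
  Kolmogorov's forward equation \<open>(\<phi> g)' = \<phi> ((L - c) g)\<close> (\<open>\<phi>_increment\<close>, \<open>\<phi>_derivative\<close>). Hence
  \<open>(L - c) g = - h\<close> implies that the integral of \<open>\<phi> h\<close> over all times is the value of \<open>g\<close> at the starting point
  (\<open>\<phi>_total_integral\<close>). With Tonelli's theorem this identifies the hitting probability \<open>V\<close>, for the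
  rate \<open>\<kappa>\<close> on \<open>R\<close> plus \<open>l\<close> on \<open>S\<close>, and the mean killing time \<open>T\<close>, for the rate \<open>l\<close> on \<open>S\<close>, as the solutions of
  \<open>L V = \<kappa> 1_R (V - 1) + l 1_S V\<close> and \<open>L T = l 1_S T - 1\<close>
  (\<open>hitting_prob_solution\<close>, \<open>mean_killing_time_solution\<close>). Solutions exist by finite linear algebra.

  The rest is analysis of the Dirichlet form \<open>D\<close>. Let \<open>C\<close> be the soft capacity, \<open>a\<close> the exit rate of
  \<open>R - S\<close>, and \<open>r\<close> and \<open>s\<close> the inverse gaps of \<open>R\<close> and \<open>S\<close>. The function \<open>V\<close> minimizes the energy functional
  with minimum \<open>C\<close>, and \<open>C\<close> equals both \<open>\<kappa> \<mu>(1_R (1 - V))\<close> and \<open>l \<mu>(1_S V)\<close>. Four estimates carry the theorem.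

  \<^item> Test functions supported in \<open>R - S\<close> give that \<open>C / \<mu>(R)\<close> is at most of order \<open>a\<close>
    (\<open>capacity_le_exit_rate\<close>). Since \<open>a \<lless> \<kappa>\<close> and \<open>a \<lless> l\<close>, the two expressions for \<open>C\<close> then show that \<open>V\<close> is
    close to the indicator function of \<open>R\<close>, with an error that is small relative to \<open>\<mu>(R)\<close>.

  \<^item> Hence \<open>V\<close> has a variance of at least about \<open>\<mu>(R) \<mu>(S)\<close> and a Dirichlet form of at most \<open>C\<close>, which bounds the
    spectral gap from above (\<open>variance_V_ge\<close>).

  \<^item> Conversely, for any \<open>f\<close> with different means \<open>b\<close> and \<open>b'\<close> over \<open>S\<close> and \<open>R\<close>, the function \<open>(f - b) / (b' - b)\<close> is a test function
    for \<open>C\<close> whose killing terms are small by the Poincare inequalities in \<open>R\<close> and \<open>S\<close>. This gives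
    \<open>Var f \<le> (r + s + (1 + \<kappa> r + l s) \<mu>(R) \<mu>(S) / C) D f\<close> (\<open>variance_le_capacity\<close>), and \<open>r + s\<close> is negligible
    because \<open>C / (\<mu>(R) \<mu>(S))\<close> is at most of order \<open>a\<close>, and \<open>a r\<close> and \<open>a s\<close> tend to \<open>0\<close>.

  \<^item> Pairing the two equations gives \<open>\<kappa> \<mu>(1_R (1 - V) T) = \<mu>(V)\<close>, which is about \<open>\<mu>(R)\<close>. Since the covariance of \<open>V\<close>
    and \<open>T\<close> in \<open>R\<close> is small by the Poincare inequality, the left-hand side is close to the mean of \<open>T\<close> over \<open>R\<close> times
    \<open>C\<close> (\<open>mean_time_bound\<close>).
\<close>

section \<open>Solvability of finite linear systems\<close>

text \<open>
  A homogeneous system with more unknowns than equations has a nontrivial solution: Gaussian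
  elimination, by induction on the set of equations.
\<close>

lemma exists_nontrivial_kernel:
  fixes a :: "'e \<Rightarrow> 'u \<Rightarrow> real"
  assumes "finite A" and "finite B" and "card A < card B"
  shows "\<exists>u. (\<exists>y\<in>B. u y \<noteq> 0) \<and> (\<forall>x\<in>A. (\<Sum>y\<in>B. a x y * u y) = 0)"
  using assms
proof (induction A arbitrary: B a rule: finite_induct)
  case empty
  then obtain y where "y \<in> B" by (metis card.empty less_irrefl ex_in_conv)
  then show ?case by (intro exI[of _ "\<lambda>_. 1"]) auto
next
  case (insert x0 A)
  show ?case
  proof (cases "\<forall>y\<in>B. a x0 y = 0")
    case True
    have "card A < card B" using insert by auto
    from insert.IH[OF insert.prems(1) this, of a] True show ?thesis by auto
  next
    case False
    then obtain y0 where y0: "y0 \<in> B" "a x0 y0 \<noteq> 0" by auto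
    have "card A < card (B - {y0})" using insert y0 by auto
    \<comment> \<open>The remaining equations after elimination of the unknown \<open>y0\<close> by means of the equation \<open>x0\<close>.\<close>
    from insert.IH[OF _ this, of "\<lambda>x y. a x y - a x y0 * a x0 y / a x0 y0"] insert.prems
    obtain u where u: "\<exists>y\<in>B - {y0}. u y \<noteq> 0"
      "\<And>x. x \<in> A \<Longrightarrow> (\<Sum>y\<in>B - {y0}. (a x y - a x y0 * a x0 y / a x0 y0) * u y) = 0"
      by auto
    \<comment> \<open>The pivot unknown \<open>y0\<close> is recovered from the equation \<open>x0\<close>.\<close>
    define r where "r = (\<Sum>y\<in>B - {y0}. a x0 y * u y)"
    define v where "v = u(y0 := - r / a x0 y0)"
    have split: "(\<Sum>y\<in>B. a x y * v y) = (\<Sum>y\<in>B - {y0}. a x y * u y) - a x y0 * r / a x0 y0" for x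
    proof -
      have "(\<Sum>y\<in>B. a x y * v y) = a x y0 * v y0 + (\<Sum>y\<in>B - {y0}. a x y * v y)"
        using y0 insert.prems by (simp add: sum.remove)
      also have "(\<Sum>y\<in>B - {y0}. a x y * v y) = (\<Sum>y\<in>B - {y0}. a x y * u y)"
        by (intro sum.cong) (auto simp: v_def)
      finally show ?thesis by (simp add: v_def)
    qed
    have "(\<Sum>y\<in>B. a x y * v y) = 0" if "x \<in> insert x0 A" for x
    proof (cases "x = x0")
      case True
      then show ?thesis using y0 by (simp add: split r_def)
    next
      case False
      then have "x \<in> A" using that by auto
      have "(\<Sum>y\<in>B - {y0}. (a x y - a x y0 * a x0 y / a x0 y0) * u y)
          = (\<Sum>y\<in>B - {y0}. a x y * u y) - a x y0 / a x0 y0 * r"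
        by (simp add: r_def sum_distrib_left sum_subtractf left_diff_distrib algebra_simps)
      then show ?thesis using u(2)[OF \<open>x \<in> A\<close>] by (simp add: split)
    qed
    moreover have "\<exists>y\<in>B. v y \<noteq> 0" using u(1) by (auto simp: v_def)
    ultimately show ?thesis by blast
  qed
qed

text \<open>
  The right-hand side is moved to the left with one additional unknown, indexed by \<open>None\<close>; by
  injectivity this unknown does not vanish in a nontrivial solution, so it can be divided out.
\<close>

lemma injective_system_solvable:
  fixes a :: "'a \<Rightarrow> 'a \<Rightarrow> real"
  assumes "finite A"
    and inj: "\<And>u. (\<And>x. x \<in> A \<Longrightarrow> (\<Sum>y\<in>A. a x y * u y) = 0) \<Longrightarrow> (\<forall>x\<in>A. u x = 0)"
  shows "\<exists>u. \<forall>x\<in>A. (\<Sum>y\<in>A. a x y * u y) = h x"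
proof -
  define b where "b x z = (case z of None \<Rightarrow> - h x | Some y \<Rightarrow> a x y)" for x z
  let ?B = "insert None (Some ` A)"
  have cardB: "card ?B = Suc (card A)" using assms(1) by (subst card_insert_disjoint) (auto simp: card_image)
  obtain u where u: "\<exists>y\<in>?B. u y \<noteq> 0" "\<And>x. x \<in> A \<Longrightarrow> (\<Sum>y\<in>?B. b x y * u y) = 0"
    using exists_nontrivial_kernel[of A ?B b] assms(1) cardB by auto
  have eq: "(\<Sum>y\<in>A. a x y * u (Some y)) = h x * u None" if "x \<in> A" for x
    using u(2)[OF that] assms(1) by (simp add: b_def sum.reindex)
  have "u None \<noteq> 0"
  proof
    assume 0: "u None = 0"
    then have "\<forall>x\<in>A. u (Some x) = 0" using inj[of "\<lambda>y. u (Some y)"] eq by simp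
    then show False using u(1) 0 by auto
  qed
  then have "\<forall>x\<in>A. (\<Sum>y\<in>A. a x y * (u (Some y) / u None)) = h x"
    using eq by (simp add: sum_divide_distrib[symmetric])
  then show ?thesis by (intro exI[of _ "\<lambda>y. u (Some y) / u None"])
qed

section \<open>Accumulated rates along a path\<close>

text \<open>
  Control of the forward increments alone determines the derivative from both sides, because the
  error is uniform in \<open>t\<close> and \<open>\<psi>\<close> is Lipschitz. This is what makes processes and functionals that
  are only right-continuous amenable to calculus.
\<close>

lemma has_derivative_of_quadratic_increments:
  fixes \<phi> \<psi> :: "real \<Rightarrow> real"
  assumes \<phi>: "\<And>t s. 0 \<le> t \<Longrightarrow> 0 \<le> s \<Longrightarrow> s \<le> 1 \<Longrightarrow> \<bar>\<phi> (t + s) - \<phi> t - s * \<psi> t\<bar> \<le> K * s\<^sup>2"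
    and \<psi>: "\<And>t s. 0 \<le> t \<Longrightarrow> 0 \<le> s \<Longrightarrow> s \<le> 1 \<Longrightarrow> \<bar>\<psi> (t + s) - \<psi> t\<bar> \<le> K' * s"
    and "0 \<le> t"
  shows "(\<phi> has_real_derivative \<psi> t) (at t within {0..})"
proof -
  have K: "K \<ge> 0" using \<phi>[of 0 1] by auto
  have K': "K' \<ge> 0" using \<psi>[of 0 1] by auto
  have main: "\<bar>\<phi> y - \<phi> t - (y - t) * \<psi> t\<bar> \<le> (K + K') * (y - t)\<^sup>2" if "0 \<le> y" "\<bar>y - t\<bar> \<le> 1" for y
  proof (cases "t \<le> y")
    case True
    have "\<bar>\<phi> y - \<phi> t - (y - t) * \<psi> t\<bar> \<le> K * (y - t)\<^sup>2"
      using \<phi>[of t "y - t"] that True \<open>0 \<le> t\<close> by auto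
    also have "\<dots> \<le> (K + K') * (y - t)\<^sup>2" using K' by (intro mult_right_mono) auto
    finally show ?thesis .
  next
    case False
    have 1: "\<bar>\<phi> t - \<phi> y - (t - y) * \<psi> y\<bar> \<le> K * (t - y)\<^sup>2"
      using \<phi>[of y "t - y"] that False by auto
    have "\<bar>\<psi> t - \<psi> y\<bar> \<le> K' * (t - y)"
      using \<psi>[of y "t - y"] that False by auto
    then have "(t - y) * \<bar>\<psi> t - \<psi> y\<bar> \<le> (t - y) * (K' * (t - y))"
      using False by (intro mult_left_mono) auto
    then have 2: "\<bar>(t - y) * (\<psi> t - \<psi> y)\<bar> \<le> K' * (t - y)\<^sup>2"
      using False by (simp add: abs_mult power2_eq_square mult.left_commute)
    have "\<phi> y - \<phi> t - (y - t) * \<psi> t = (t - y) * (\<psi> t - \<psi> y) - (\<phi> t - \<phi> y - (t - y) * \<psi> y)"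
      by (simp add: algebra_simps)
    then have "\<bar>\<phi> y - \<phi> t - (y - t) * \<psi> t\<bar> \<le> K' * (t - y)\<^sup>2 + K * (t - y)\<^sup>2"
      using 1 2 by linarith
    then show ?thesis by (simp add: power2_commute distrib_right)
  qed
  have "((\<lambda>y. (\<phi> y - \<phi> t) / (y - t) - \<psi> t) \<longlongrightarrow> 0) (at t within {0..})"
  proof (rule Lim_null_comparison)
    show "((\<lambda>y. (K + K') * \<bar>y - t\<bar>) \<longlongrightarrow> 0) (at t within {0..})"
      by (auto intro!: tendsto_eq_intros)
    have "eventually (\<lambda>y. dist y t < 1) (at t within {0..})"
      by (auto simp: eventually_at intro: exI[of _ 1])
    moreover have "eventually (\<lambda>y. y \<noteq> t \<and> y \<in> {0..}) (at t within {0..})"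
      by (auto simp: eventually_at_filter)
    ultimately show "eventually (\<lambda>y. norm ((\<phi> y - \<phi> t) / (y - t) - \<psi> t) \<le> (K + K') * \<bar>y - t\<bar>) (at t within {0..})"
    proof eventually_elim
      case (elim y)
      then have "\<bar>\<phi> y - \<phi> t - (y - t) * \<psi> t\<bar> \<le> (K + K') * (y - t)\<^sup>2"
        by (intro main) (auto simp: dist_real_def)
      moreover have "(\<phi> y - \<phi> t) / (y - t) - \<psi> t = (\<phi> y - \<phi> t - (y - t) * \<psi> t) / (y - t)"
        using elim by (simp add: field_simps)
      moreover have "(y - t)\<^sup>2 = \<bar>y - t\<bar> * \<bar>y - t\<bar>" by (simp add: power2_eq_square)
      ultimately show ?case using elim
        by (simp add: abs_divide pos_divide_le_eq mult.assoc)
    qed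
  qed
  then show ?thesis unfolding has_field_derivative_iff by (rule LIM_zero_cancel)
qed

lemma constant_of_quadratic_increments:
  fixes \<phi> :: "real \<Rightarrow> real"
  assumes "\<And>t s. 0 \<le> t \<Longrightarrow> 0 \<le> s \<Longrightarrow> s \<le> 1 \<Longrightarrow> \<bar>\<phi> (t + s) - \<phi> t\<bar> \<le> K * s\<^sup>2" and "0 \<le> t"
  shows "\<phi> t = \<phi> 0"
proof -
  have "\<And>x. x \<in> {0..} \<Longrightarrow> (\<phi> has_real_derivative 0) (at x within {0..})"
    using has_derivative_of_quadratic_increments[of \<phi> "\<lambda>_. 0" K 0] assms by auto
  then obtain c where "\<And>x. x \<in> {0..} \<Longrightarrow> \<phi> x = c"
    using has_field_derivative_zero_constant[of "{0..}" \<phi>] by (auto simp: convex_real_interval)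
  then show ?thesis using assms(2) by simp
qed

lemma set_integrable_bounded_Icc:
  fixes q :: "real \<Rightarrow> real"
  assumes "q \<in> borel_measurable borel" "\<And>s. \<bar>q s\<bar> \<le> B" "A \<in> sets borel" "A \<subseteq> {a..b}"
  shows "set_integrable lborel A q"
proof -
  have "set_integrable lborel {a..b} q"
    unfolding set_integrable_def
    by (rule integrableI_bounded_set_indicator[where B = B]) (use assms in \<open>auto simp: emeasure_lborel_Icc_eq\<close>)
  then show ?thesis by (rule set_integrable_subset) (use assms in auto)
qed

lemma set_integral_Icc_trivial: "(LBINT s:{a..a}. f s) = (0::real)" for a :: real
proof -
  have "AE s in lborel. indicator {a..a} s *\<^sub>R f s = 0"
    using AE_lborel_singleton[of a] by eventually_elim auto
  then show ?thesis unfolding set_lebesgue_integral_def by (rule integral_eq_zero_AE)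
qed

lemma exp_minus_bounds: "1 - exp (- x) \<le> x" "exp (- x) * x \<le> 1 - exp (- x)" for x :: real
proof -
  show "1 - exp (- x) \<le> x" using exp_ge_add_one_self[of "- x"] by simp
  have "exp (- x) * (1 + x) \<le> exp (- x) * exp x" by (intro mult_left_mono exp_ge_add_one_self) auto
  then show "exp (- x) * x \<le> 1 - exp (- x)" by (simp add: exp_minus algebra_simps)
qed

text \<open>
  A path enters only through a measurable bounded nonnegative rate \<open>q\<close> as a function of time. In the
  applications \<open>q\<close> vanishes for negative times, where the process is not defined.
\<close>

locale bounded_rate =
  fixes q :: "real \<Rightarrow> real" and B :: real
  assumes q_measurable [measurable]: "q \<in> borel_measurable borel"
    and q_nonneg: "0 \<le> q s" and q_le: "q s \<le> B"
begin

text \<open>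
  The rate accumulated up to time \<open>t\<close>; it is \<open>0\<close> for \<open>t < 0\<close>, since then \<open>{0..t}\<close> is empty.
\<close>

definition accum :: "real \<Rightarrow> real" where "accum t = (LBINT s:{0..t}. q s)"

lemma B_nonneg: "0 \<le> B" using q_nonneg[of 0] q_le[of 0] by simp

lemma accum_0: "accum 0 = 0"
  unfolding accum_def by (rule set_integral_Icc_trivial)

lemma accum_add:
  assumes "0 \<le> t" "0 \<le> s"
  shows "accum (t + s) = accum t + (LBINT u:{t<..t + s}. q u)"
proof -
  have "{0..t + s} = {0..t} \<union> {t<..t + s}" using assms by auto
  then show ?thesis unfolding accum_def
    by (simp only:) (intro set_integral_Un set_integrable_bounded_Icc[where a = 0 and b = "t + s" and B = B],
      use assms q_nonneg q_le in \<open>auto simp: abs_of_nonneg\<close>)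
qed

lemma increment_bounds:
  assumes "0 \<le> t" "0 \<le> s"
  shows "0 \<le> (LBINT u:{t<..t + s}. q u)" "(LBINT u:{t<..t + s}. q u) \<le> B * s"
proof -
  show "0 \<le> (LBINT u:{t<..t + s}. q u)"
    unfolding set_lebesgue_integral_def by (intro integral_nonneg_AE) (auto simp: q_nonneg)
  have "(LBINT u:{t<..t + s}. q u) \<le> (LBINT u:{t<..t + s}. B)"
    by (intro set_integral_mono set_integrable_bounded_Icc[where a = t and b = "t + s" and B = B])
       (use assms q_nonneg q_le B_nonneg in \<open>auto simp: abs_of_nonneg\<close>)
  also have "\<dots> = B * s" using assms by (simp add: set_lebesgue_integral_def)
  finally show "(LBINT u:{t<..t + s}. q u) \<le> B * s" .
qed

lemma accum_mono: "0 \<le> t \<Longrightarrow> t \<le> t' \<Longrightarrow> accum t \<le> accum t'"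
  using accum_add[of t "t' - t"] increment_bounds(1)[of t "t' - t"] by simp

lemma accum_lipschitz: "0 \<le> t \<Longrightarrow> t \<le> t' \<Longrightarrow> accum t' \<le> accum t + B * (t' - t)"
  using accum_add[of t "t' - t"] increment_bounds(2)[of t "t' - t"] by simp

lemma accum_nonneg: "0 \<le> t \<Longrightarrow> 0 \<le> accum t" using accum_mono[of 0 t] accum_0 by simp

lemma accum_neg: "t < 0 \<Longrightarrow> accum t = 0"
  by (simp add: accum_def set_lebesgue_integral_def)

lemma accum_measurable [measurable]: "accum \<in> borel_measurable borel"
proof (rule borel_measurable_mono)
  show "mono accum"
    by (intro monoI) (metis accum_0 accum_neg accum_mono linorder_not_less accum_nonneg order_refl)
qed

lemma set_integrable_rate:
  assumes "A \<in> sets borel" "A \<subseteq> {a..b}"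
  shows "set_integrable lborel A q" and "set_integrable lborel A (\<lambda>s. q s * exp (- accum s))"
proof -
  show "set_integrable lborel A q"
    by (rule set_integrable_bounded_Icc[OF _ _ assms, where B = B]) (auto simp: q_nonneg q_le)
  have "0 \<le> accum u" for u by (cases "u < 0") (auto simp: accum_neg accum_nonneg)
  then have "\<bar>q s * exp (- accum s)\<bar> \<le> B" for s
    using mult_mono[OF q_le[of s], of "exp (- accum s)" 1] q_nonneg[of s] B_nonneg by (simp add: abs_mult)
  then show "set_integrable lborel A (\<lambda>s. q s * exp (- accum s))"
    by (intro set_integrable_bounded_Icc[OF _ _ assms]) measurable
qed

text \<open>
  The fundamental theorem of calculus for \<open>exp (- accum t)\<close>, where \<open>q\<close> is merely measurable and \<open>accum\<close> need
  not be differentiable. On \<open>{t<..t + s}\<close> both sides grow by an amount between \<open>e' * I\<close> and \<open>e * I\<close>,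
  where \<open>e\<close> and \<open>e'\<close> are the values of \<open>exp (- accum)\<close> at the two ends and \<open>I\<close> is the increment of
  \<open>accum\<close>, so their difference has increments of second order and is constant.
\<close>

lemma exp_accum:
  assumes "0 \<le> t"
  shows "1 - exp (- accum t) = (LBINT s:{0..t}. q s * exp (- accum s))"
proof -
  let ?g = "\<lambda>s. q s * exp (- accum s)"
  note q_int = set_integrable_rate(1) and g_int = set_integrable_rate(2)
  \<comment> \<open>The difference of the two sides.\<close>
  define G where "G t = 1 - exp (- accum t) - (LBINT s:{0..t}. ?g s)" for t
  have "\<bar>G (t + s) - G t\<bar> \<le> B\<^sup>2 * s\<^sup>2" if "0 \<le> t" "0 \<le> s" for t s
  proof -
    define I where "I = (LBINT u:{t<..t + s}. q u)"
    define J where "J = (LBINT u:{t<..t + s}. ?g u)"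
    define e where "e = exp (- accum t)"
    define e' where "e' = exp (- accum (t + s))"
    have I: "0 \<le> I" "I \<le> B * s" "accum (t + s) = accum t + I"
      using increment_bounds[OF that] accum_add[OF that] by (auto simp: I_def)
    have e'_eq: "e' = e * exp (- I)" by (simp add: e'_def e_def I(3) exp_add[symmetric])
    have "{0..t + s} = {0..t} \<union> {t<..t + s}" using that by auto
    then have "(LBINT u:{0..t + s}. ?g u) = (LBINT u:{0..t}. ?g u) + J"
      unfolding J_def by (simp only:) (intro set_integral_Un g_int[of _ 0 "t + s"]; use that in auto)
    then have G: "G (t + s) - G t = (e - e') - J" by (simp add: G_def e_def e'_def)
    have J1: "J \<le> e * I"
    proof -
      have "J \<le> (LBINT u:{t<..t + s}. e * q u)" unfolding J_def
      proof (intro set_integral_mono g_int[of _ t "t + s"] set_integrable_mult_right q_int[of _ t "t + s"])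
        fix u assume "u \<in> {t<..t + s}"
        then have "exp (- accum u) \<le> e" using accum_mono[of t u] that by (simp add: e_def)
        then show "?g u \<le> e * q u" using q_nonneg[of u] by (simp add: mult.commute[of _ "q u"] mult_left_mono)
      qed auto
      then show ?thesis by (simp add: I_def)
    qed
    have J2: "e' * I \<le> J"
    proof -
      have "(LBINT u:{t<..t + s}. e' * q u) \<le> J" unfolding J_def
      proof (intro set_integral_mono g_int[of _ t "t + s"] set_integrable_mult_right q_int[of _ t "t + s"])
        fix u assume "u \<in> {t<..t + s}"
        then have "exp (- accum u) \<ge> e'" using accum_mono[of u "t + s"] that by (simp add: e'_def)
        then show "e' * q u \<le> ?g u" using q_nonneg[of u] by (simp add: mult.commute[of _ "q u"] mult_left_mono)
      qed auto
      then show ?thesis by (simp add: I_def)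
    qed
    have e1: "0 < e" "e \<le> 1" using accum_nonneg[OF that(1)] by (auto simp: e_def)
    note x = exp_minus_bounds[of I]
    have d1: "e - e' \<le> e * I" using e1 mult_left_mono[OF x(1), of e] by (simp add: e'_eq algebra_simps)
    have d2: "e' * I \<le> e - e'" using e1 mult_left_mono[OF x(2), of e] by (simp add: e'_eq algebra_simps)
    have "\<bar>(e - e') - J\<bar> \<le> (e - e') * I" using J1 J2 d1 d2 by (simp add: algebra_simps abs_le_iff)
    also have "\<dots> \<le> I * I" using d1 e1 I mult_right_mono[of e 1 I] by (intro mult_right_mono) auto
    also have "\<dots> \<le> (B * s) * (B * s)" using I by (intro mult_mono) auto
    finally show ?thesis unfolding G by (simp add: power2_eq_square mult_ac)
  qed
  then have "G t = G 0" by (intro constant_of_quadratic_increments[of _ "B\<^sup>2"]) (use assms in auto)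
  moreover have "G 0 = 0"
    by (simp add: G_def accum_0 set_integral_Icc_trivial del: atLeastAtMost_singleton)
  ultimately show ?thesis by (simp add: G_def)
qed

end

section \<open>The transition operator for short times\<close>

text \<open>
  A crude bound on the generator in the supremum norm is enough, so all rates are added up,
  including the irrelevant \<open>w x x\<close>.
\<close>

definition total_rate :: "'a set \<Rightarrow> ('a \<Rightarrow> 'a \<Rightarrow> real) \<Rightarrow> real" where
  "total_rate E w = (\<Sum>x\<in>E. \<Sum>y\<in>E. \<bar>w x y\<bar>)"

lemma generator_bound:
  assumes "finite E" "y \<in> E" and f: "\<And>v. v \<in> E \<Longrightarrow> \<bar>f v\<bar> \<le> c"
  shows "\<bar>generator E w f y\<bar> \<le> 2 * total_rate E w * c"
proof -
  have c: "0 \<le> c" using f[OF assms(2)] by simp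
  have "\<bar>generator E w f y\<bar> \<le> (\<Sum>v\<in>E - {y}. \<bar>w y v\<bar> * (2 * c))"
    unfolding generator_def
  proof (intro sum_abs[THEN order_trans] sum_mono)
    fix v assume "v \<in> E - {y}"
    then have "\<bar>f v - f y\<bar> \<le> 2 * c" using f[of v] f[of y] assms(2) by auto
    then show "\<bar>w y v * (f v - f y)\<bar> \<le> \<bar>w y v\<bar> * (2 * c)" by (simp add: abs_mult mult_left_mono)
  qed
  also have "\<dots> \<le> (\<Sum>v\<in>E. \<bar>w y v\<bar> * (2 * c))"
    using assms c by (intro sum_mono2) auto
  also have "\<dots> = (\<Sum>v\<in>E. \<bar>w y v\<bar>) * (2 * c)" by (simp add: sum_distrib_right)
  also have "\<dots> \<le> total_rate E w * (2 * c)"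
    unfolding total_rate_def using assms c
    by (intro mult_right_mono member_le_sum[where f = "\<lambda>x. \<Sum>y\<in>E. \<bar>w x y\<bar>"] sum_nonneg) auto
  finally show ?thesis by (simp add: mult_ac)
qed

lemma total_rate_nonneg: "0 \<le> total_rate E w"
  unfolding total_rate_def by (intro sum_nonneg) auto

lemma generator_power_bound:
  assumes "finite E" "y \<in> E" and f: "\<And>v. v \<in> E \<Longrightarrow> \<bar>f v\<bar> \<le> c"
  shows "\<bar>(generator E w ^^ k) f y\<bar> \<le> (2 * total_rate E w) ^ k * c"
  using assms(2)
proof (induction k arbitrary: y)
  case 0
  then show ?case using f by simp
next
  case (Suc k)
  have "\<bar>generator E w ((generator E w ^^ k) f) y\<bar> \<le> 2 * total_rate E w * ((2 * total_rate E w) ^ k * c)"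
    by (rule generator_bound[OF assms(1) Suc.prems Suc.IH])
  then show ?case by (simp add: mult_ac)
qed

text \<open>
  The constant in the quadratic remainder of the exponential series, for times in \<open>[0, 1]\<close>.
\<close>

definition transition_const :: "'a set \<Rightarrow> ('a \<Rightarrow> 'a \<Rightarrow> real) \<Rightarrow> real" where
  "transition_const E w = (2 * total_rate E w)\<^sup>2 * exp (2 * total_rate E w)"

lemma transition_expansion:
  assumes "finite E" "y \<in> E" "0 \<le> s" "s \<le> 1"
  shows "\<bar>transition E w s y z - indicator {z} y - s * generator E w (indicator {z}) y\<bar>
           \<le> transition_const E w * s\<^sup>2"
proof -
  define B where "B = 2 * total_rate E w"
  have B: "0 \<le> B" by (simp add: B_def total_rate_nonneg)
  define a where "a k = (generator E w ^^ k) (indicator {z}) y" for k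
  have a: "\<bar>a k\<bar> \<le> B ^ k" for k
    using generator_power_bound[OF assms(1,2), where f = "indicator {z}" and c = 1 and w = w and k = k]
    by (simp add: a_def B_def indicator_def)
  define f where "f k = s ^ k / fact k * a k" for k
  define g where "g k = s\<^sup>2 * B\<^sup>2 * (inverse (fact k) * B ^ k)" for k
  have g: "summable g" unfolding g_def by (intro summable_mult summable_exp)
  have gsum: "suminf g = s\<^sup>2 * B\<^sup>2 * exp B"
    unfolding g_def by (subst suminf_mult) (auto intro: summable_exp simp: exp_def)
  have fg: "\<bar>f (k + 2)\<bar> \<le> g k" for k
  proof -
    have "\<bar>f (k + 2)\<bar> = s ^ (k + 2) / fact (k + 2) * \<bar>a (k + 2)\<bar>"
      using assms(3) by (simp add: f_def abs_mult)
    also have "\<dots> \<le> s\<^sup>2 / fact k * B ^ (k + 2)"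
    proof (intro mult_mono frac_le a)
      show "s ^ (k + 2) \<le> s\<^sup>2" using assms by (intro power_decreasing) auto
      show "fact k \<le> (fact (k + 2) :: real)" by (intro fact_mono) auto
    qed (use assms in auto)
    also have "\<dots> = g k" by (simp add: g_def power_add field_simps power2_eq_square)
    finally show ?thesis .
  qed
  have s2: "summable (\<lambda>k. f (k + 2))"
    by (rule summable_comparison_test'[OF g]) (use fg in auto)
  then have sf: "summable f" by (simp only: summable_iff_shift)
  have "transition E w s y z = suminf f"
    unfolding transition_def f_def a_def ..
  also have "\<dots> = (\<Sum>k. f (k + 2)) + (\<Sum>i<2. f i)"
    by (rule suminf_split_initial_segment[OF sf])
  also have "(\<Sum>i<2. f i) = indicator {z} y + s * generator E w (indicator {z}) y"
    by (simp add: f_def a_def numeral_2_eq_2)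
  finally have "\<bar>transition E w s y z - indicator {z} y - s * generator E w (indicator {z}) y\<bar>
      = \<bar>\<Sum>k. f (k + 2)\<bar>" by simp
  also have "\<dots> \<le> suminf g"
    using norm_suminf_le[OF _ g, of "\<lambda>k. f (k + 2)"] fg by auto
  also have "\<dots> = transition_const E w * s\<^sup>2" by (simp add: gsum transition_const_def B_def)
  finally show ?thesis .
qed

text \<open>
  A bound on the rate at which the process leaves its position, for times in \<open>[0, 1]\<close>.
\<close>

definition jump_const :: "'a set \<Rightarrow> ('a \<Rightarrow> 'a \<Rightarrow> real) \<Rightarrow> real" where
  "jump_const E w = 2 * total_rate E w + transition_const E w"

lemma jump_const_nonneg: "0 \<le> jump_const E w"
  using total_rate_nonneg[of E w] by (simp add: jump_const_def transition_const_def)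

text \<open>
  The semigroup acting on functions: \<open>transition_op E w s g y\<close> is the expectation of \<open>g\<close> at time \<open>s\<close> for
  the process started from \<open>y\<close>.
\<close>

definition transition_op :: "'a set \<Rightarrow> ('a \<Rightarrow> 'a \<Rightarrow> real) \<Rightarrow> real \<Rightarrow> ('a \<Rightarrow> real) \<Rightarrow> 'a \<Rightarrow> real" where
  "transition_op E w s g y = (\<Sum>z\<in>E. transition E w s y z * g z)"

lemma transition_op_expansion:
  assumes "finite E" "y \<in> E" "0 \<le> s" "s \<le> 1"
  shows "\<bar>transition_op E w s g y - g y - s * generator E w g y\<bar>
           \<le> transition_const E w * (\<Sum>z\<in>E. \<bar>g z\<bar>) * s\<^sup>2"
proof -
  have g: "g v = (\<Sum>z\<in>E. indicator {z} v * g z)" if "v \<in> E" for v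
    using that assms(1) by (simp add: indicator_def)
  have "generator E w g y = (\<Sum>v\<in>E - {y}. w y v * (\<Sum>z\<in>E. (indicator {z} v - indicator {z} y) * g z))"
    unfolding generator_def
    by (intro sum.cong refl) (use g assms(2) in \<open>simp add: left_diff_distrib sum_subtractf\<close>)
  also have "\<dots> = (\<Sum>z\<in>E. generator E w (indicator {z}) y * g z)"
    unfolding generator_def sum_distrib_left sum_distrib_right
    by (subst sum.swap) (simp add: mult_ac)
  finally have "transition_op E w s g y - g y - s * generator E w g y
      = (\<Sum>z\<in>E. (transition E w s y z - indicator {z} y - s * generator E w (indicator {z}) y) * g z)"
    using g[OF assms(2)]
    by (simp add: transition_op_def left_diff_distrib sum_subtractf sum_distrib_left mult.assoc)
  also have "\<bar>\<dots>\<bar> \<le> (\<Sum>z\<in>E. transition_const E w * s\<^sup>2 * \<bar>g z\<bar>)"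
    by (intro sum_abs[THEN order_trans] sum_mono)
       (use transition_expansion[OF assms] in \<open>simp add: abs_mult mult_right_mono\<close>)
  finally show ?thesis by (simp add: sum_distrib_left mult_ac)
qed

section \<open>Filtration and conditioning\<close>

text \<open>
  The process under the law \<open>M\<close> for which it starts from \<open>x0\<close>.
\<close>

locale jump_process = prob_space M for M :: "'b measure" +
  fixes E :: "'a set" and w :: "'a \<Rightarrow> 'a \<Rightarrow> real" and X :: "real \<Rightarrow> 'b \<Rightarrow> 'a" and x0 :: 'a
  assumes finite_E: "finite E" and x0: "x0 \<in> E"
    and X_measurable: "\<And>t. 0 \<le> t \<Longrightarrow> X t \<in> measurable M (count_space E)"
    and right_continuous: "\<And>\<omega> t. \<omega> \<in> space M \<Longrightarrow> 0 \<le> t \<Longrightarrow> eventually (\<lambda>s. X s \<omega> = X t \<omega>) (at_right t)"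
    and X_0: "AE \<omega> in M. X 0 \<omega> = x0"
    and markov: "\<And>t s y z A. 0 \<le> t \<Longrightarrow> 0 \<le> s \<Longrightarrow> y \<in> E \<Longrightarrow> z \<in> E \<Longrightarrow>
        A \<in> sigma_sets (space M) {X u -` {v} \<inter> space M | u v. 0 \<le> u \<and> u \<le> t} \<Longrightarrow>
          measure M {\<omega>\<in>A. X t \<omega> = y \<and> X (t + s) \<omega> = z} =
          measure M {\<omega>\<in>A. X t \<omega> = y} * transition E w s y z"

lemma jump_process_of_markov_process:
  assumes "markov_process E w P X" "finite E" "x \<in> E"
  shows "jump_process (P x) E w X x"
  using assms unfolding markov_process_def jump_process_def jump_process_axioms_def by blast

context jump_process
begin

lemma X_in: "\<omega> \<in> space M \<Longrightarrow> 0 \<le> t \<Longrightarrow> X t \<omega> \<in> E"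
  using measurable_space[OF X_measurable] by simp

lemma sum_at_position:
  assumes "\<omega> \<in> space M" "0 \<le> t"
  shows "(\<Sum>y\<in>E. indicator {y} (X t \<omega>) * (h y :: real)) = h (X t \<omega>)"
proof -
  have "(\<Sum>y\<in>E. indicator {y} (X t \<omega>) * h y) = (\<Sum>y\<in>E. if y = X t \<omega> then h y else 0)"
    by (intro sum.cong) (auto simp: indicator_def)
  then show ?thesis using X_in[OF assms] finite_E by simp
qed

lemma abs_le_sum:
  assumes "\<omega> \<in> space M" "0 \<le> t"
  shows "\<bar>g (X t \<omega>) :: real\<bar> \<le> (\<Sum>v\<in>E. \<bar>g v\<bar>)"
  using X_in[OF assms] finite_E by (auto intro!: member_le_sum[where f = "\<lambda>v. \<bar>g v\<bar>"])

text \<open>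
  The \<open>\<sigma>\<close>-algebra generated by the process up to time \<open>t\<close>, as a measure space with null measure.
\<close>

definition past :: "real \<Rightarrow> 'b measure" where
  "past t = sigma (space M) {X u -` {v} \<inter> space M | u v. 0 \<le> u \<and> u \<le> t}"

lemma space_past: "space (past t) = space M"
  unfolding past_def by (subst space_measure_of) auto

lemma sets_past: "sets (past t) = sigma_sets (space M) {X u -` {v} \<inter> space M | u v. 0 \<le> u \<and> u \<le> t}"
  unfolding past_def by (subst sets_measure_of) auto

lemma X_measurable_past:
  assumes "0 \<le> u" "u \<le> t"
  shows "X u \<in> measurable (past t) (count_space E)"
proof (subst measurable_count_space_eq2[OF finite_E], intro conjI ballI)
  show "X u \<in> space (past t) \<rightarrow> E" using X_in assms by (auto simp: space_past)
  show "X u -` {v} \<inter> space (past t) \<in> sets (past t)" for v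
    unfolding space_past sets_past by (rule sigma_sets.Basic) (use assms in auto)
qed

lemma subalgebra_past: "0 \<le> t \<Longrightarrow> subalgebra M (past t)"
proof -
  have "X u -` {v} \<inter> space M \<in> sets M" if "0 \<le> u" for u v
  proof (cases "v \<in> E")
    case True
    then show ?thesis using measurable_sets[OF X_measurable[OF that], of "{v}"] by simp
  next
    case False
    then have "X u -` {v} \<inter> space M = {}" using X_in that by auto
    then show ?thesis by simp
  qed
  then show ?thesis
    unfolding subalgebra_def space_past sets_past
    by (auto intro!: sets.sigma_sets_subset)
qed

text \<open>
  Joint measurability in the outcome and in time, by right-continuity: time is rounded up to the
  grid of mesh \<open>1 / Suc n\<close> and truncated at \<open>T\<close>. The truncation makes the lemma applicable to
  \<open>past T\<close>, for which only the positions up to time \<open>T\<close> are measurable.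
\<close>

lemma path_measurable_Icc:
  fixes f :: "'a \<Rightarrow> real"
  assumes "0 \<le> T" and N: "space N = space M"
    and XN: "\<And>u. 0 \<le> u \<Longrightarrow> u \<le> T \<Longrightarrow> X u \<in> measurable N (count_space E)"
  shows "(\<lambda>(\<omega>, s). indicator {0..T} s * f (X s \<omega>)) \<in> borel_measurable (N \<Otimes>\<^sub>M lborel)"
proof -
  define e where "e n k = max 0 (min T ((of_int k + 1) / real (Suc n)))" for n :: nat and k :: int
  define d where "d n s = e n \<lfloor>real (Suc n) * s\<rfloor>" for n s
  define g where "g n = (\<lambda>(\<omega>, s). indicator {0..T} s * f (X (d n s) \<omega>))" for n :: nat
  have gm: "g n \<in> borel_measurable (N \<Otimes>\<^sub>M lborel)" for n
  proof -
    have [measurable]: "X (e n k) \<in> measurable N (count_space E)" for k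
      using assms(1) by (intro XN) (auto simp: e_def)
    have [measurable]: "f \<in> borel_measurable (count_space E)" by simp
    have "(\<lambda>p. (\<lambda>k p. f (X (e n k) (fst p))) \<lfloor>real (Suc n) * snd p\<rfloor> p) \<in> borel_measurable (N \<Otimes>\<^sub>M lborel)"
      by (rule measurable_compose_countable) measurable
    then have "(\<lambda>p. indicator {0..T} (snd p) * f (X (d n (snd p)) (fst p))) \<in> borel_measurable (N \<Otimes>\<^sub>M lborel)"
      unfolding d_def by measurable
    then show ?thesis by (simp add: g_def case_prod_beta)
  qed
  have lim: "(\<lambda>n. g n (\<omega>, s)) \<longlonglongrightarrow> indicator {0..T} s * f (X s \<omega>)" if \<omega>: "\<omega> \<in> space M" for \<omega> s
  proof (cases "s \<in> {0..T}")
    case False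
    then show ?thesis by (simp add: g_def)
  next
    case True
    have ev: "eventually (\<lambda>n. X (d n s) \<omega> = X s \<omega>) sequentially"
    proof (cases "s = T")
      case True
      have "d n s = s" for n
      proof -
        have "real (Suc n) * s < of_int \<lfloor>real (Suc n) * s\<rfloor> + 1" by linarith
        then have "s < (of_int \<lfloor>real (Suc n) * s\<rfloor> + 1) / real (Suc n)"
          by (simp add: pos_less_divide_eq mult.commute)
        then show ?thesis using True assms(1) by (simp add: d_def e_def)
      qed
      then show ?thesis by simp
    next
      case False
      then have s: "0 \<le> s" "s < T" using \<open>s \<in> {0..T}\<close> by auto
      obtain b where b: "b > s" "\<And>y. s < y \<Longrightarrow> y < b \<Longrightarrow> X y \<omega> = X s \<omega>"
        using right_continuous[OF \<omega> s(1)] by (auto simp: eventually_at_right_field)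
      have d: "s < d n s \<and> d n s \<le> s + 1 / real (Suc n)" for n
      proof -
        have "real (Suc n) * s < of_int \<lfloor>real (Suc n) * s\<rfloor> + 1" by linarith
        then have 1: "s < (of_int \<lfloor>real (Suc n) * s\<rfloor> + 1) / real (Suc n)"
          by (simp add: pos_less_divide_eq mult.commute)
        have "of_int \<lfloor>real (Suc n) * s\<rfloor> \<le> real (Suc n) * s" by linarith
        then have "(of_int \<lfloor>real (Suc n) * s\<rfloor> + 1) / real (Suc n) \<le> (real (Suc n) * s + 1) / real (Suc n)"
          by (intro divide_right_mono) auto
        also have "\<dots> = s + 1 / real (Suc n)" by (simp add: field_simps)
        finally show ?thesis using 1 s by (auto simp: d_def e_def)
      qed
      have "(\<lambda>n. 1 / real (Suc n)) \<longlonglongrightarrow> 0" by (rule LIMSEQ_Suc[OF lim_1_over_n])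
      then have "eventually (\<lambda>n. 1 / real (Suc n) < b - s) sequentially"
        using b(1) by (intro order_tendstoD(2)[where y = 0]) auto
      then show ?thesis by eventually_elim (use d b(2) in \<open>smt (verit)\<close>)
    qed
    then have "eventually (\<lambda>n. g n (\<omega>, s) = indicator {0..T} s * f (X s \<omega>)) sequentially"
      by eventually_elim (simp add: g_def)
    then show ?thesis by (rule tendsto_eventually)
  qed
  show ?thesis
  proof (rule borel_measurable_LIMSEQ_real[OF _ gm])
    fix p assume "p \<in> space (N \<Otimes>\<^sub>M (lborel :: real measure))"
    then show "(\<lambda>n. g n p) \<longlonglongrightarrow> (case p of (\<omega>, s) \<Rightarrow> indicator {0..T} s * f (X s \<omega>))"
      using lim by (auto simp: space_pair_measure N)
  qed
qed

lemma path_measurable: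
  fixes f :: "'a \<Rightarrow> real"
  shows "(\<lambda>(\<omega>, s). indicator {0..} s * f (X s \<omega>)) \<in> borel_measurable (M \<Otimes>\<^sub>M lborel)"
proof (rule borel_measurable_LIMSEQ_real)
  show "(\<lambda>(\<omega>, s). indicator {0..real n} s * f (X s \<omega>)) \<in> borel_measurable (M \<Otimes>\<^sub>M lborel)" for n
    by (rule path_measurable_Icc) (auto intro: X_measurable)
  fix p :: "'b \<times> real"
  obtain \<omega> s where p: "p = (\<omega>, s)" by (cases p)
  have "eventually (\<lambda>n. real n \<ge> s) sequentially"
    by (rule filterlim_at_top[THEN iffD1, OF filterlim_real_sequentially, rule_format])
  then have "eventually (\<lambda>n. indicat_real {0..real n} s = indicator {0..} s) sequentially"
    by eventually_elim (auto simp: indicator_def)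
  then show "(\<lambda>n. case p of (\<omega>, s) \<Rightarrow> indicator {0..real n} s * f (X s \<omega>))
      \<longlonglongrightarrow> (case p of (\<omega>, s) \<Rightarrow> indicator {0..} s * f (X s \<omega>))"
    by (intro tendsto_eventually) (auto simp: p elim!: eventually_mono)
qed

lemma path_measurable_fixed:
  assumes "\<omega> \<in> space M"
  shows "(\<lambda>s. indicator {0..} s * (f (X s \<omega>) :: real)) \<in> borel_measurable borel"
  using measurable_Pair2[OF path_measurable assms, of f] by simp

text \<open>
  The Markov property, extended from events of the past to bounded random variables \<open>Z\<close> that are
  measurable with respect to the past.
\<close>

lemma conditioning:
  assumes t: "0 \<le> t" and s: "0 \<le> s"
    and Z: "Z \<in> borel_measurable (past t)" and Zb: "\<And>\<omega>. \<omega> \<in> space M \<Longrightarrow> \<bar>Z \<omega>\<bar> \<le> B"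
  shows "expectation (\<lambda>\<omega>. Z \<omega> * g (X (t + s) \<omega>)) = expectation (\<lambda>\<omega>. Z \<omega> * transition_op E w s g (X t \<omega>))"
proof -
  have sub: "subalgebra M (past t)" by (rule subalgebra_past[OF t])
  have sets_sub: "A \<in> sets (past t) \<Longrightarrow> A \<in> sets M" for A using sub by (auto simp: subalgebra_def)
  interpret sigma_finite_subalgebra M "past t"
    by (rule finite_measure_subalgebra_is_sigma_finite) (simp add: finite_measure_subalgebra_def finite_measure_axioms finite_measure_subalgebra_axioms_def sub)
  have ZM [measurable]: "Z \<in> borel_measurable M" by (rule measurable_from_subalg[OF sub Z])
  have XM [measurable]: "X u \<in> measurable M (count_space E)" if "0 \<le> u" for u using X_measurable that .
  have XtM [measurable]: "X t \<in> measurable M (count_space E)" "X (t + s) \<in> measurable M (count_space E)"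
    using t s by (auto intro: X_measurable)
  have fm [measurable]: "f \<in> borel_measurable (count_space E)" for f :: "'a \<Rightarrow> real" by simp
  have int_fX: "integrable M (\<lambda>\<omega>. f (X u \<omega>))" if "0 \<le> u" for u and f :: "'a \<Rightarrow> real"
  proof (rule integrable_const_bound[where B = "\<Sum>v\<in>E. \<bar>f v\<bar>"])
    show "AE \<omega> in M. norm (f (X u \<omega>)) \<le> (\<Sum>v\<in>E. \<bar>f v\<bar>)"
      using abs_le_sum[OF _ that] by (auto intro!: AE_I2)
    have "X u \<in> measurable M (count_space E)" using X_measurable that .
    then show "(\<lambda>\<omega>. f (X u \<omega>)) \<in> borel_measurable M" by measurable
  qed
  have int_Z: "integrable M (\<lambda>\<omega>. Z \<omega> * f \<omega>)" if "integrable M f" for f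
  proof (rule Bochner_Integration.integrable_bound)
    show "integrable M (\<lambda>\<omega>. B * f \<omega>)" using that by simp
    show "(\<lambda>\<omega>. Z \<omega> * f \<omega>) \<in> borel_measurable M"
      using borel_measurable_integrable[OF that] by measurable
    show "AE \<omega> in M. norm (Z \<omega> * f \<omega>) \<le> norm (B * f \<omega>)"
      by (intro AE_I2) (auto simp: abs_mult intro!: mult_right_mono order_trans[OF Zb])
  qed
  have key: "expectation (\<lambda>\<omega>. Z \<omega> * indicator {z} (X (t + s) \<omega>)) = expectation (\<lambda>\<omega>. Z \<omega> * transition E w s (X t \<omega>) z)"
    if z: "z \<in> E" for z
  proof -
    \<comment> \<open>The Markov property identifies the conditional expectation of the indicator of \<open>z\<close>.\<close>
    let ?f = "\<lambda>\<omega>. indicat_real {z} (X (t + s) \<omega>)"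
    let ?h = "\<lambda>\<omega>. transition E w s (X t \<omega>) z"
    have hm: "?h \<in> borel_measurable (past t)"
      using X_measurable_past[of t t] t by measurable
    have "AE \<omega> in M. real_cond_exp M (past t) ?f \<omega> = ?h \<omega>"
    proof (rule real_cond_exp_charact)
      show "integrable M ?f" using int_fX[of "t + s"] t s by simp
      show "integrable M ?h" using int_fX[of t "\<lambda>y. transition E w s y z"] t by simp
      show "?h \<in> borel_measurable (past t)" by (rule hm)
      fix A assume A: "A \<in> sets (past t)"
      have AM [measurable]: "A \<in> sets M" using sets_sub A .
      then have AS: "A \<subseteq> space M" by (rule sets.sets_into_space)
      have m1 [measurable]: "{\<omega>\<in>A. X t \<omega> = y} \<in> sets M" for y
      proof -
        have "{\<omega>\<in>A. X t \<omega> = y} = A \<inter> (X t -` ({y} \<inter> E) \<inter> space M)" using AS X_in t by auto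
        then show ?thesis using measurable_sets[OF XtM(1), of "{y} \<inter> E"] AM by auto
      qed
      have m2 [measurable]: "{\<omega>\<in>A. X t \<omega> = y \<and> X (t + s) \<omega> = z} \<in> sets M" for y
      proof -
        have "{\<omega>\<in>A. X t \<omega> = y \<and> X (t + s) \<omega> = z} = {\<omega>\<in>A. X t \<omega> = y} \<inter> (X (t + s) -` {z} \<inter> space M)"
          using AS by auto
        then show ?thesis using measurable_sets[OF XtM(2), of "{z}"] z m1 by auto
      qed
      have "(LINT \<omega>:A|M. ?f \<omega>) = (LINT \<omega>|M. (\<Sum>y\<in>E. indicator {\<omega>\<in>A. X t \<omega> = y \<and> X (t + s) \<omega> = z} \<omega>))"
        unfolding set_lebesgue_integral_def
      proof (rule Bochner_Integration.integral_cong[OF refl])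
        fix \<omega> assume \<omega>: "\<omega> \<in> space M"
        have "(\<Sum>y\<in>E. indicat_real {\<omega>\<in>A. X t \<omega> = y \<and> X (t + s) \<omega> = z} \<omega>)
            = (\<Sum>y\<in>E. indicator {y} (X t \<omega>) * (indicator A \<omega> * ?f \<omega>))"
          by (intro sum.cong) (auto simp: indicator_def)
        also have "\<dots> = indicator A \<omega> * ?f \<omega>" by (rule sum_at_position[OF \<omega> t])
        finally show "indicat_real A \<omega> *\<^sub>R ?f \<omega> = (\<Sum>y\<in>E. indicator {\<omega>\<in>A. X t \<omega> = y \<and> X (t + s) \<omega> = z} \<omega>)" by simp
      qed
      also have "\<dots> = (\<Sum>y\<in>E. measure M {\<omega>\<in>A. X t \<omega> = y \<and> X (t + s) \<omega> = z})"
        by (subst Bochner_Integration.integral_sum) (auto simp: less_top[symmetric] intro!: integrable_real_indicator)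
      also have "\<dots> = (\<Sum>y\<in>E. measure M {\<omega>\<in>A. X t \<omega> = y} * transition E w s y z)"
        by (intro sum.cong refl markov[OF t s _ z]) (use A sets_past in auto)
      also have "\<dots> = (LINT \<omega>|M. (\<Sum>y\<in>E. indicator {\<omega>\<in>A. X t \<omega> = y} \<omega> * transition E w s y z))"
        by (subst Bochner_Integration.integral_sum) (auto simp: less_top[symmetric] intro!: integrable_real_indicator integrable_mult_left)
      also have "\<dots> = (LINT \<omega>:A|M. ?h \<omega>)"
        unfolding set_lebesgue_integral_def
      proof (rule Bochner_Integration.integral_cong[OF refl])
        fix \<omega> assume \<omega>: "\<omega> \<in> space M"
        have "(\<Sum>y\<in>E. indicator {\<omega>\<in>A. X t \<omega> = y} \<omega> * transition E w s y z)
            = (\<Sum>y\<in>E. indicator {y} (X t \<omega>) * (indicator A \<omega> * transition E w s y z))"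
          by (intro sum.cong) (auto simp: indicator_def)
        also have "\<dots> = indicator A \<omega> * ?h \<omega>" by (rule sum_at_position[OF \<omega> t])
        finally show "(\<Sum>y\<in>E. indicator {\<omega>\<in>A. X t \<omega> = y} \<omega> * transition E w s y z) = indicat_real A \<omega> *\<^sub>R ?h \<omega>" by simp
      qed
      finally show "(LINT \<omega>:A|M. ?f \<omega>) = (LINT \<omega>:A|M. ?h \<omega>)" .
    qed
    moreover have "expectation (\<lambda>\<omega>. Z \<omega> * real_cond_exp M (past t) ?f \<omega>) = expectation (\<lambda>\<omega>. Z \<omega> * ?f \<omega>)"
      by (rule real_cond_exp_intg(2)) (use Z int_Z[OF int_fX[of "t + s" "indicator {z}"]] t s in auto)
    moreover have "expectation (\<lambda>\<omega>. Z \<omega> * real_cond_exp M (past t) ?f \<omega>) = expectation (\<lambda>\<omega>. Z \<omega> * ?h \<omega>)"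
    proof (rule integral_cong_AE)
      have "?h \<in> borel_measurable M" by (rule measurable_from_subalg[OF sub hm])
      then show "(\<lambda>\<omega>. Z \<omega> * ?h \<omega>) \<in> borel_measurable M" by measurable
    qed (use calculation(1) in auto)
    ultimately show ?thesis by simp
  qed
  have "expectation (\<lambda>\<omega>. Z \<omega> * g (X (t + s) \<omega>)) = expectation (\<lambda>\<omega>. \<Sum>z\<in>E. g z * (Z \<omega> * indicator {z} (X (t + s) \<omega>)))"
  proof (rule Bochner_Integration.integral_cong[OF refl])
    fix \<omega> assume "\<omega> \<in> space M"
    then show "Z \<omega> * g (X (t + s) \<omega>) = (\<Sum>z\<in>E. g z * (Z \<omega> * indicator {z} (X (t + s) \<omega>)))"
      using sum_at_position[of \<omega> "t + s" "\<lambda>z. Z \<omega> * g z"] t s by (simp add: mult_ac)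
  qed
  also have "\<dots> = (\<Sum>z\<in>E. g z * expectation (\<lambda>\<omega>. Z \<omega> * indicator {z} (X (t + s) \<omega>)))"
    using t s by (subst Bochner_Integration.integral_sum) (auto intro!: integrable_mult_right int_Z int_fX)
  also have "\<dots> = (\<Sum>z\<in>E. g z * expectation (\<lambda>\<omega>. Z \<omega> * transition E w s (X t \<omega>) z))"
    by (simp add: key)
  also have "\<dots> = expectation (\<lambda>\<omega>. \<Sum>z\<in>E. g z * (Z \<omega> * transition E w s (X t \<omega>) z))"
    using t s by (subst Bochner_Integration.integral_sum)
      (auto intro!: integrable_mult_right int_Z int_fX[of _ "\<lambda>y. transition E w s y _"])
  also have "\<dots> = expectation (\<lambda>\<omega>. Z \<omega> * transition_op E w s g (X t \<omega>))"
    by (simp add: transition_op_def sum_distrib_left mult_ac)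
  finally show ?thesis .
qed

lemma integrable_bounded_times:
  assumes Z: "Z \<in> borel_measurable M" and Zb: "\<And>\<omega>. \<omega> \<in> space M \<Longrightarrow> \<bar>Z \<omega>\<bar> \<le> B" and u: "0 \<le> u"
  shows "integrable M (\<lambda>\<omega>. Z \<omega> * (g (X u \<omega>) :: real))"
proof (rule integrable_const_bound[where B = "B * (\<Sum>v\<in>E. \<bar>g v\<bar>)"])
  have [measurable]: "X u \<in> measurable M (count_space E)" using X_measurable[OF u] .
  have [measurable]: "g \<in> borel_measurable (count_space E)" by simp
  show "(\<lambda>\<omega>. Z \<omega> * g (X u \<omega>)) \<in> borel_measurable M" using Z by measurable
  show "AE \<omega> in M. norm (Z \<omega> * g (X u \<omega>)) \<le> B * (\<Sum>v\<in>E. \<bar>g v\<bar>)"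
  proof (rule AE_I2)
    fix \<omega> assume \<omega>: "\<omega> \<in> space M"
    note abs_le_sum[OF \<omega> u, of g]
    moreover have "0 \<le> B" using Zb[OF \<omega>] by linarith
    ultimately show "norm (Z \<omega> * g (X u \<omega>)) \<le> B * (\<Sum>v\<in>E. \<bar>g v\<bar>)"
      using Zb[OF \<omega>] by (auto simp: abs_mult intro!: mult_mono)
  qed
qed

section \<open>Expectations of the process killed at a rate\<close>

text \<open>
  The integrand is the indicator that the positions at times \<open>t\<close> and \<open>t + r\<close> differ.
\<close>

lemma jump_probability:
  assumes t: "0 \<le> t" and r: "0 \<le> r" "r \<le> 1"
  shows "integrable M (\<lambda>\<omega>. if X (t + r) \<omega> = X t \<omega> then 0 else 1 :: real)"
    and "expectation (\<lambda>\<omega>. if X (t + r) \<omega> = X t \<omega> then 0 else 1) \<le> jump_const E w * r"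
proof -
  define K where "K = jump_const E w"
  have K0: "0 \<le> K" by (simp add: K_def jump_const_nonneg)
  have X_past [measurable]: "X t \<in> measurable (past t) (count_space E)" by (rule X_measurable_past) (use t in auto)
  have [measurable]: "f \<in> borel_measurable (count_space E)" for f :: "'a \<Rightarrow> real" by simp
  have Zp: "(\<lambda>\<omega>. indicat_real {y} (X t \<omega>)) \<in> borel_measurable (past t)" for y by measurable
  have ZM: "(\<lambda>\<omega>. indicat_real {y} (X t \<omega>)) \<in> borel_measurable M" for y
    by (rule measurable_from_subalg[OF subalgebra_past[OF t] Zp])
  have Zb: "\<bar>indicat_real {y} (X t \<omega>)\<bar> \<le> 1" for y \<omega> by (simp add: indicator_def)
  have eq: "(if X (t + r) \<omega> = X t \<omega> then 0 else 1) = (\<Sum>y\<in>E. indicat_real {y} (X t \<omega>) * (1 - indicator {y} (X (t + r) \<omega>)))"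
    if "\<omega> \<in> space M" for \<omega>
    using sum_at_position[OF that t, of "\<lambda>y. 1 - indicator {y} (X (t + r) \<omega>)"] by simp
  have int: "integrable M (\<lambda>\<omega>. indicat_real {y} (X t \<omega>) * (1 - indicator {y} (X (t + r) \<omega>)))" for y
    by (rule integrable_bounded_times[where g = "\<lambda>x. 1 - indicator {y} x", OF ZM Zb]) (use t r in auto)
  show "integrable M (\<lambda>\<omega>. if X (t + r) \<omega> = X t \<omega> then 0 else 1 :: real)"
    by (subst Bochner_Integration.integrable_cong[OF refl eq]) (auto intro: int)
  have "expectation (\<lambda>\<omega>. if X (t + r) \<omega> = X t \<omega> then 0 else 1)
      = expectation (\<lambda>\<omega>. \<Sum>y\<in>E. indicat_real {y} (X t \<omega>) * (1 - indicator {y} (X (t + r) \<omega>)))"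
    by (rule Bochner_Integration.integral_cong[OF refl eq])
  also have "\<dots> = (\<Sum>y\<in>E. expectation (\<lambda>\<omega>. indicat_real {y} (X t \<omega>) * (1 - indicator {y} (X (t + r) \<omega>))))"
    by (rule Bochner_Integration.integral_sum) (rule int)
  also have "\<dots> \<le> (\<Sum>y\<in>E. expectation (\<lambda>\<omega>. indicat_real {y} (X t \<omega>) * (K * r)))"
  proof (rule sum_mono)
    fix y assume y: "y \<in> E"
    let ?g = "indicat_real {y}"
    have i1: "integrable M (\<lambda>\<omega>. ?g (X t \<omega>))"
      using integrable_bounded_times[OF ZM Zb t, of y "\<lambda>_. 1"] by simp
    have i2: "integrable M (\<lambda>\<omega>. ?g (X t \<omega>) * ?g (X (t + r) \<omega>))"
      by (rule integrable_bounded_times[OF ZM Zb]) (use t r in auto)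
    have i3: "integrable M (\<lambda>\<omega>. ?g (X t \<omega>) * transition_op E w r ?g (X t \<omega>))"
      by (rule integrable_bounded_times[OF ZM Zb t])
    have sg: "1 - transition_op E w r ?g y \<le> K * r"
    proof -
      have "\<bar>transition_op E w r ?g y - ?g y - r * generator E w ?g y\<bar> \<le> transition_const E w * (\<Sum>z\<in>E. \<bar>?g z\<bar>) * r\<^sup>2"
        by (rule transition_op_expansion) (use finite_E y r in auto)
      also have "(\<Sum>z\<in>E. \<bar>?g z\<bar>) = 1" using y finite_E by (simp add: indicator_def)
      also have "transition_const E w * 1 * r\<^sup>2 \<le> transition_const E w * r"
        using r by (simp add: transition_const_def power2_eq_square mult_left_le mult_left_mono)
      finally have a: "\<bar>transition_op E w r ?g y - 1 - r * generator E w ?g y\<bar> \<le> transition_const E w * r" by simp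
      have "\<bar>generator E w ?g y\<bar> \<le> 2 * total_rate E w * 1"
        by (rule generator_bound) (use finite_E y in \<open>auto simp: indicator_def\<close>)
      then have "r * \<bar>generator E w ?g y\<bar> \<le> r * (2 * total_rate E w)" using r by (intro mult_left_mono) auto
      then have "\<bar>r * generator E w ?g y\<bar> \<le> r * (2 * total_rate E w)" using r by (simp add: abs_mult)
      then show ?thesis using a by (simp add: K_def jump_const_def algebra_simps)
    qed
    have "expectation (\<lambda>\<omega>. ?g (X t \<omega>) * (1 - ?g (X (t + r) \<omega>)))
        = expectation (\<lambda>\<omega>. ?g (X t \<omega>)) - expectation (\<lambda>\<omega>. ?g (X t \<omega>) * ?g (X (t + r) \<omega>))"
      by (subst Bochner_Integration.integral_diff[symmetric]) (use i1 i2 in \<open>auto simp: right_diff_distrib\<close>)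
    also have "\<dots> = expectation (\<lambda>\<omega>. ?g (X t \<omega>)) - expectation (\<lambda>\<omega>. ?g (X t \<omega>) * transition_op E w r ?g (X t \<omega>))"
      using conditioning[OF t r(1) Zp Zb, of y ?g] by simp
    also have "\<dots> = expectation (\<lambda>\<omega>. ?g (X t \<omega>) * (1 - transition_op E w r ?g (X t \<omega>)))"
      by (subst Bochner_Integration.integral_diff[symmetric]) (use i1 i3 in \<open>auto simp: right_diff_distrib\<close>)
    also have "\<dots> \<le> expectation (\<lambda>\<omega>. ?g (X t \<omega>) * (K * r))"
    proof (rule integral_mono)
      show "integrable M (\<lambda>\<omega>. ?g (X t \<omega>) * (1 - transition_op E w r ?g (X t \<omega>)))"
        using Bochner_Integration.integrable_diff[OF i1 i3] by (simp add: right_diff_distrib)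
      show "integrable M (\<lambda>\<omega>. ?g (X t \<omega>) * (K * r))" using i1 by simp
      show "?g (X t \<omega>) * (1 - transition_op E w r ?g (X t \<omega>)) \<le> ?g (X t \<omega>) * (K * r)" for \<omega>
        using sg by (auto simp: indicator_def)
    qed
    finally show "expectation (\<lambda>\<omega>. ?g (X t \<omega>) * (1 - ?g (X (t + r) \<omega>))) \<le> expectation (\<lambda>\<omega>. ?g (X t \<omega>) * (K * r))" .
  qed
  also have "\<dots> = expectation (\<lambda>\<omega>. \<Sum>y\<in>E. indicat_real {y} (X t \<omega>) * (K * r))"
    by (rule Bochner_Integration.integral_sum[symmetric])
       (use integrable_bounded_times[OF ZM Zb t, of _ "\<lambda>_. K * r"] in simp)
  also have "\<dots> = expectation (\<lambda>\<omega>. K * r)"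
  proof (rule Bochner_Integration.integral_cong[OF refl])
    show "\<omega> \<in> space M \<Longrightarrow> (\<Sum>y\<in>E. indicat_real {y} (X t \<omega>) * (K * r)) = K * r" for \<omega>
      by (rule sum_at_position[OF _ t])
  qed
  also have "\<dots> = K * r" by (simp add: prob_space)
  finally show "expectation (\<lambda>\<omega>. if X (t + r) \<omega> = X t \<omega> then 0 else 1) \<le> jump_const E w * r"
    by (simp add: K_def)
qed

text \<open>
  \<open>N\<close> is the time in \<open>{t<..t + s}\<close> that the process spends away from its position at time \<open>t\<close>; its
  expectation is of second order in \<open>s\<close>.
\<close>

lemma expected_time_away:
  assumes t: "0 \<le> t" and s: "0 \<le> s" "s \<le> 1"
  defines "N \<equiv> (\<lambda>\<omega>. LBINT u:{t<..t + s}. (if X u \<omega> = X t \<omega> then 0 else 1))"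
  shows "integrable M N" and "expectation N \<le> jump_const E w * s\<^sup>2"
    and "\<And>\<omega>. \<omega> \<in> space M \<Longrightarrow> set_integrable lborel {t<..t + s} (\<lambda>u. if X u \<omega> = X t \<omega> then 0 else 1 :: real)"
proof -
  define K where "K = jump_const E w"
  have K0: "0 \<le> K" by (simp add: K_def jump_const_nonneg)
  define j where "j = (\<lambda>(\<omega>, u). indicat_real {t<..t + s} u * (if X u \<omega> = X t \<omega> then 0 else 1))"
  have jm: "j \<in> borel_measurable (M \<Otimes>\<^sub>M lborel)"
  proof -
    have [measurable]: "X t \<in> measurable M (count_space E)" using X_measurable[OF t] .
    have [measurable]: "f \<in> borel_measurable (count_space E)" for f :: "'a \<Rightarrow> real" by simp
    have [measurable]: "(\<lambda>p. indicat_real {0..} (snd p) * indicator {y} (X (snd p) (fst p))) \<in> borel_measurable (M \<Otimes>\<^sub>M lborel)" for y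
      using path_measurable[of "indicator {y}"] by (simp add: case_prod_beta)
    have "(\<lambda>p. indicat_real {t<..t + s} (snd p) * (\<Sum>y\<in>E. indicator {y} (X t (fst p)) *
        (1 - indicator {0..} (snd p) * indicator {y} (X (snd p) (fst p))))) \<in> borel_measurable (M \<Otimes>\<^sub>M lborel)"
      by measurable
    moreover have "j p = indicat_real {t<..t + s} (snd p) * (\<Sum>y\<in>E. indicator {y} (X t (fst p)) *
        (1 - indicator {0..} (snd p) * indicator {y} (X (snd p) (fst p))))" if "p \<in> space (M \<Otimes>\<^sub>M (lborel :: real measure))" for p
    proof -
      obtain \<omega> u where p: "p = (\<omega>, u)" by (cases p)
      then have \<omega>: "\<omega> \<in> space M" using that by (simp add: space_pair_measure)
      show ?thesis
      proof (cases "u \<in> {t<..t + s}")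
        case False
        then show ?thesis by (simp add: j_def p)
      next
        case True
        then have "0 \<le> u" using t by auto
        then show ?thesis
          using sum_at_position[OF \<omega> t, of "\<lambda>y. 1 - indicator {0..} u * indicat_real {y} (X u \<omega>)"]
          by (simp add: j_def p)
      qed
    qed
    ultimately show ?thesis by (subst measurable_cong) auto
  qed
  have jb: "0 \<le> j p" "j p \<le> 1" for p by (auto simp: j_def case_prod_beta indicator_def)
  have N_eq: "N \<omega> = (LINT u|lborel. j (\<omega>, u))" for \<omega>
    by (simp add: N_def j_def set_lebesgue_integral_def)
  have j_int: "integrable lborel (\<lambda>u. j (\<omega>, u))" if "\<omega> \<in> space M" for \<omega>
  proof -
    have "(\<lambda>u. j (\<omega>, u)) \<in> borel_measurable lborel" by (rule measurable_Pair2[OF jm that])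
    then have "set_integrable lborel {t<..t + s} (\<lambda>u. j (\<omega>, u))"
      by (intro set_integrable_bounded_Icc[where B = 1 and a = t and b = "t + s"]) (use jb in auto)
    then show ?thesis unfolding set_integrable_def by (simp add: j_def) (simp add: mult.assoc[symmetric] indicator_inter_arith[symmetric])
  qed
  show "set_integrable lborel {t<..t + s} (\<lambda>u. if X u \<omega> = X t \<omega> then 0 else 1 :: real)" if "\<omega> \<in> space M" for \<omega>
    using j_int[OF that] by (simp add: set_integrable_def j_def)
  have Nm: "N \<in> borel_measurable M"
    unfolding N_eq[abs_def] by (rule lborel.borel_measurable_lebesgue_integral) (use jm in simp)
  have N0: "0 \<le> N \<omega>" for \<omega> unfolding N_eq by (intro integral_nonneg_AE) (use jb in auto)
  have nnN: "ennreal (N \<omega>) = (\<integral>\<^sup>+u. ennreal (j (\<omega>, u)) \<partial>lborel)" if "\<omega> \<in> space M" for \<omega>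
    unfolding N_eq by (rule nn_integral_eq_integral[symmetric]) (use j_int[OF that] jb in auto)
  have "(\<integral>\<^sup>+\<omega>. ennreal (N \<omega>) \<partial>M) = (\<integral>\<^sup>+\<omega>. (\<integral>\<^sup>+u. ennreal (j (\<omega>, u)) \<partial>lborel) \<partial>M)"
    by (rule nn_integral_cong) (rule nnN)
  also have "\<dots> = (\<integral>\<^sup>+u. (\<integral>\<^sup>+\<omega>. ennreal (j (\<omega>, u)) \<partial>M) \<partial>lborel)"
  proof -
    interpret pair_sigma_finite M lborel ..
    show ?thesis by (rule Fubini'[symmetric]) (use jm in simp)
  qed
  also have "\<dots> \<le> (\<integral>\<^sup>+u. ennreal (K * s) * indicator {t<..t + s} u \<partial>lborel)"
  proof (rule nn_integral_mono)
    fix u :: real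
    show "(\<integral>\<^sup>+\<omega>. ennreal (j (\<omega>, u)) \<partial>M) \<le> ennreal (K * s) * indicator {t<..t + s} u"
    proof (cases "u \<in> {t<..t + s}")
      case False
      then show ?thesis by (simp add: j_def)
    next
      case True
      then have r: "0 \<le> u - t" "u - t \<le> 1" "u - t \<le> s" using s by auto
      have "(\<integral>\<^sup>+\<omega>. ennreal (j (\<omega>, u)) \<partial>M) = (\<integral>\<^sup>+\<omega>. ennreal (if X (t + (u - t)) \<omega> = X t \<omega> then 0 else 1) \<partial>M)"
        using True by (intro nn_integral_cong) (simp add: j_def)
      also have "\<dots> = ennreal (expectation (\<lambda>\<omega>. if X (t + (u - t)) \<omega> = X t \<omega> then 0 else 1))"
        by (rule nn_integral_eq_integral[OF jump_probability(1)[OF t r(1,2)]]) auto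
      also have "\<dots> \<le> ennreal (K * s)"
        using jump_probability(2)[OF t r(1,2)] mult_left_mono[OF r(3) K0]
        by (intro ennreal_leI) (simp add: K_def)
      finally show ?thesis using True by simp
    qed
  qed
  also have "\<dots> = ennreal (K * s\<^sup>2)"
    using s K0 by (simp add: nn_integral_cmult ennreal_mult[symmetric] power2_eq_square mult.assoc)
  finally have le: "(\<integral>\<^sup>+\<omega>. ennreal (N \<omega>) \<partial>M) \<le> ennreal (K * s\<^sup>2)" .
  show "integrable M N"
    by (rule integrableI_nonneg) (use Nm N0 le in \<open>auto simp: le_less_trans[OF le] \<close>)
  then have "ennreal (expectation N) \<le> ennreal (K * s\<^sup>2)"
    using le N0 by (subst (asm) nn_integral_eq_integral) auto
  then show "expectation N \<le> jump_const E w * s\<^sup>2"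
    using K0 by (simp add: K_def ennreal_le_iff)
qed

end

text \<open>
  The process is killed at rate \<open>c y\<close> while it is at \<open>y\<close>.
\<close>

locale killed_process = jump_process M E w X x0 for M :: "'b measure" and E :: "'a set" and w X x0 +
  fixes c :: "'a \<Rightarrow> real"
  assumes c_nonneg: "\<And>y. y \<in> E \<Longrightarrow> 0 \<le> c y"
begin

definition cmax :: real where "cmax = (\<Sum>y\<in>E. c y)"

lemma c_le: "y \<in> E \<Longrightarrow> c y \<le> cmax"
  unfolding cmax_def using finite_E c_nonneg by (intro member_le_sum) auto

lemma cmax_nonneg: "0 \<le> cmax" unfolding cmax_def by (intro sum_nonneg c_nonneg)

definition rate_path :: "'b \<Rightarrow> real \<Rightarrow> real" where
  "rate_path \<omega> s = indicator {0..} s * c (X s \<omega>)"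

text \<open>
  The accumulated killing rate; for \<open>c = indicator A\<close> this is the local time of \<open>A\<close>.
\<close>

definition killing :: "real \<Rightarrow> 'b \<Rightarrow> real" where
  "killing t \<omega> = (LBINT s:{0..t}. c (X s \<omega>))"

lemma bounded_rate: "\<omega> \<in> space M \<Longrightarrow> bounded_rate (rate_path \<omega>) cmax"
  unfolding bounded_rate_def rate_path_def
  using path_measurable_fixed[of \<omega> c] c_nonneg c_le X_in cmax_nonneg
  by (auto simp: indicator_def)

lemma killing_eq: "killing t \<omega> = bounded_rate.accum (rate_path \<omega>) t" if "\<omega> \<in> space M"
proof -
  interpret bounded_rate "rate_path \<omega>" cmax by (rule bounded_rate[OF that])
  show ?thesis unfolding killing_def accum_def
    by (rule set_lebesgue_integral_cong) (auto simp: rate_path_def)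
qed

lemma killing_nonneg: "\<omega> \<in> space M \<Longrightarrow> 0 \<le> t \<Longrightarrow> 0 \<le> killing t \<omega>"
  using bounded_rate.accum_nonneg[OF bounded_rate] killing_eq by simp

lemma killing_mono: "\<omega> \<in> space M \<Longrightarrow> 0 \<le> t \<Longrightarrow> t \<le> t' \<Longrightarrow> killing t \<omega> \<le> killing t' \<omega>"
  using bounded_rate.accum_mono[OF bounded_rate] killing_eq by simp

lemma killing_0: "killing 0 \<omega> = 0"
  unfolding killing_def by (rule set_integral_Icc_trivial)

lemma killing_measurable_past:
  assumes t: "0 \<le> t"
  shows "killing t \<in> borel_measurable (past t)"
proof -
  have "(\<lambda>(\<omega>, s). indicator {0..t} s * c (X s \<omega>)) \<in> borel_measurable (past t \<Otimes>\<^sub>M lborel)"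
    by (rule path_measurable_Icc[OF t space_past]) (rule X_measurable_past)
  from lborel.borel_measurable_lebesgue_integral[OF this]
  show ?thesis by (simp add: killing_def[abs_def] set_lebesgue_integral_def)
qed

lemma killing_measurable_pair:
  "(\<lambda>(\<omega>, t). killing t \<omega>) \<in> borel_measurable (M \<Otimes>\<^sub>M lborel)"
proof -
  define G where "G = (\<lambda>(\<omega>, s). indicator {0..} s * c (X s \<omega>))"
  have [measurable]: "G \<in> borel_measurable (M \<Otimes>\<^sub>M lborel)"
    unfolding G_def by (rule path_measurable)
  have "(\<lambda>p. indicator {0..} (snd (fst p) - snd p) * G (fst (fst p), snd p)) 
      \<in> borel_measurable ((M \<Otimes>\<^sub>M lborel) \<Otimes>\<^sub>M lborel)"
    by measurable
  then have "(\<lambda>(p, s). indicator {0..snd p} s * c (X s (fst p))) \<in> borel_measurable ((M \<Otimes>\<^sub>M lborel) \<Otimes>\<^sub>M lborel)"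
    by (rule measurable_cong[THEN iffD1, rotated]) (auto simp: indicator_def G_def)
  from lborel.borel_measurable_lebesgue_integral[OF this]
  show ?thesis by (simp add: killing_def[abs_def] set_lebesgue_integral_def case_prod_beta)
qed

text \<open>
  The probability of surviving up to time \<open>t\<close>, given the path.
\<close>

definition survival :: "real \<Rightarrow> 'b \<Rightarrow> real" where "survival t \<omega> = exp (- killing t \<omega>)"

lemma survival_bounds:
  "\<omega> \<in> space M \<Longrightarrow> 0 \<le> t \<Longrightarrow> 0 \<le> survival t \<omega> \<and> survival t \<omega> \<le> 1 \<and> \<bar>survival t \<omega>\<bar> \<le> 1"
  using killing_nonneg by (simp add: survival_def)

lemma survival_past: "0 \<le> t \<Longrightarrow> survival t \<in> borel_measurable (past t)"
  using killing_measurable_past[of t] unfolding survival_def[abs_def] by measurable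

lemma survival_measurable: "0 \<le> t \<Longrightarrow> survival t \<in> borel_measurable M"
  using measurable_from_subalg[OF subalgebra_past survival_past] .

text \<open>
  The semigroup of the killed process, started from \<open>x0\<close>.
\<close>

definition \<phi> :: "('a \<Rightarrow> real) \<Rightarrow> real \<Rightarrow> real" where
  "\<phi> g t = expectation (\<lambda>\<omega>. survival t \<omega> * g (X t \<omega>))"

lemma integrable_\<phi>: "0 \<le> t \<Longrightarrow> integrable M (\<lambda>\<omega>. survival t \<omega> * g (X t \<omega>))"
  by (rule integrable_bounded_times[where B = 1]) (auto simp: survival_measurable survival_bounds)

lemma \<phi>_cong: "0 \<le> t \<Longrightarrow> (\<And>y. y \<in> E \<Longrightarrow> f y = g y) \<Longrightarrow> \<phi> f t = \<phi> g t"
  unfolding \<phi>_def using X_in by (intro Bochner_Integration.integral_cong) auto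

text \<open>
  To first order the survival probability decays at the rate at the position at time \<open>t\<close>; the error
  is controlled by the time spent away from this position.
\<close>

lemma survival_increment:
  assumes \<omega>: "\<omega> \<in> space M" and t: "0 \<le> t" and s: "0 \<le> s" "s \<le> 1"
  defines "N \<equiv> LBINT u:{t<..t + s}. (if X u \<omega> = X t \<omega> then 0 else 1)"
  shows "\<bar>survival (t + s) \<omega> - survival t \<omega> + s * (survival t \<omega> * c (X t \<omega>))\<bar> \<le> cmax\<^sup>2 * s\<^sup>2 + cmax * N"
proof -
  interpret bounded_rate "rate_path \<omega>" cmax by (rule bounded_rate[OF \<omega>])
  define I where "I = (LBINT u:{t<..t + s}. rate_path \<omega> u)"
  define Z where "Z = survival t \<omega>"
  have Z: "0 \<le> Z" "Z \<le> 1" using survival_bounds[OF \<omega> t] by (auto simp: Z_def)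
  have I: "0 \<le> I" "I \<le> cmax * s" using increment_bounds[OF t s(1)] by (auto simp: I_def)
  have "survival (t + s) \<omega> = Z * exp (- I)"
    using accum_add[OF t s(1)] by (simp add: Z_def survival_def killing_eq[OF \<omega>] I_def exp_add[symmetric])
  then have eq: "survival (t + s) \<omega> - Z + s * (Z * c (X t \<omega>)) = Z * ((exp (- I) - 1 + I) - (I - s * c (X t \<omega>)))"
    by (simp add: algebra_simps)
  note x = exp_minus_bounds[of I]
  have "I * (1 - exp (- I)) \<le> I * I" using x I by (intro mult_left_mono) auto
  then have "exp (- I) - 1 + I \<le> I * I" using x(2) by (simp add: algebra_simps)
  also have "\<dots> \<le> (cmax * s) * (cmax * s)" using I by (intro mult_mono) auto
  finally have A: "\<bar>exp (- I) - 1 + I\<bar> \<le> cmax\<^sup>2 * s\<^sup>2" using x(1) by (simp add: power2_eq_square mult_ac)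
  have q_int: "set_integrable lborel {t<..t + s} (rate_path \<omega>)"
    by (rule set_integrable_bounded_Icc[where a = t and b = "t + s" and B = cmax]) (auto simp: q_nonneg q_le)
  have k_int: "set_integrable lborel {t<..t + s} (\<lambda>u. c (X t \<omega>))"
    by (rule set_integrable_bounded_Icc[where a = t and b = "t + s" and B = "\<bar>c (X t \<omega>)\<bar>"]) auto
  have n_int: "set_integrable lborel {t<..t + s} (\<lambda>u. cmax * (if X u \<omega> = X t \<omega> then 0 else 1))"
    by (intro set_integrable_mult_right expected_time_away(3) t s \<omega>)
  have "I - s * c (X t \<omega>) = (LBINT u:{t<..t + s}. rate_path \<omega> u - c (X t \<omega>))"
    using s by (subst set_integral_diff) (use q_int k_int in \<open>auto simp: I_def set_lebesgue_integral_def\<close>)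
  also have "\<bar>\<dots>\<bar> \<le> (LBINT u:{t<..t + s}. \<bar>rate_path \<omega> u - c (X t \<omega>)\<bar>)"
    using set_integral_norm_bound[OF set_integral_diff(1)[OF q_int k_int]] by simp
  also have "\<dots> \<le> (LBINT u:{t<..t + s}. cmax * (if X u \<omega> = X t \<omega> then 0 else 1))"
  proof (intro set_integral_mono set_integrable_abs set_integral_diff(1) q_int k_int n_int)
    fix u assume "u \<in> {t<..t + s}"
    then have "0 \<le> u" using t by auto
    then show "\<bar>rate_path \<omega> u - c (X t \<omega>)\<bar> \<le> cmax * (if X u \<omega> = X t \<omega> then 0 else 1)"
      using X_in[OF \<omega> \<open>0 \<le> u\<close>] X_in[OF \<omega> t] c_nonneg c_le by (auto simp: rate_path_def abs_le_iff) (smt (verit))+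
  qed
  also have "\<dots> = cmax * N" by (simp add: N_def)
  finally have B: "\<bar>I - s * c (X t \<omega>)\<bar> \<le> cmax * N" .
  have "\<bar>survival (t + s) \<omega> - Z + s * (Z * c (X t \<omega>))\<bar> = Z * \<bar>(exp (- I) - 1 + I) - (I - s * c (X t \<omega>))\<bar>"
    unfolding eq using Z by (simp add: abs_mult)
  also have "\<dots> \<le> 1 * \<bar>(exp (- I) - 1 + I) - (I - s * c (X t \<omega>))\<bar>" using Z by (intro mult_right_mono) auto
  also have "\<dots> \<le> \<bar>exp (- I) - 1 + I\<bar> + \<bar>I - s * c (X t \<omega>)\<bar>"
    unfolding mult_1 by (rule abs_triangle_ineq4)
  also have "\<dots> \<le> cmax\<^sup>2 * s\<^sup>2 + cmax * N" by (rule add_mono[OF A B])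
  finally show ?thesis by (simp add: Z_def)
qed

text \<open>
  The generator of the killed process.
\<close>

definition killed_generator :: "('a \<Rightarrow> real) \<Rightarrow> 'a \<Rightarrow> real" where
  "killed_generator g y = generator E w g y - c y * g y"

text \<open>
  Kolmogorov's forward equation with a quadratic error. The increment of \<open>survival * g\<close> splits into
  a part \<open>U\<close> due to the motion, to which the Markov property at time \<open>t\<close> applies, and a part \<open>W\<close> due to
  killing, which is estimated path by path.
\<close>

lemma \<phi>_increment:
  "\<exists>K. \<forall>t s. 0 \<le> t \<longrightarrow> 0 \<le> s \<longrightarrow> s \<le> 1 \<longrightarrow>
     \<bar>\<phi> g (t + s) - \<phi> g t - s * \<phi> (killed_generator g) t\<bar> \<le> K * s\<^sup>2"
proof (intro exI allI impI)
  fix t s :: real assume t: "0 \<le> t" and s: "0 \<le> s" "s \<le> 1"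
  define G where "G = (\<Sum>v\<in>E. \<bar>g v\<bar>)"
  have G0: "0 \<le> G" unfolding G_def by (intro sum_nonneg) auto
  have G: "\<bar>g (X u \<omega>)\<bar> \<le> G" if "\<omega> \<in> space M" "0 \<le> u" for u \<omega>
    unfolding G_def by (rule abs_le_sum[OF that])
  define K1 where "K1 = transition_const E w * G"
  define K2 where "K2 = jump_const E w"
  define N where "N \<omega> = (LBINT u:{t<..t + s}. (if X u \<omega> = X t \<omega> then 0 else 1 :: real))" for \<omega>
  define J where "J \<omega> = (if X (t + s) \<omega> = X t \<omega> then 0 else 1 :: real)" for \<omega>
  let ?Z = "survival t" and ?Z' = "survival (t + s)" and ?g = "\<lambda>\<omega>. g (X t \<omega>)" and ?g' = "\<lambda>\<omega>. g (X (t + s) \<omega>)"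
  have ts: "0 \<le> t + s" using t s by simp
  have i1: "integrable M (\<lambda>\<omega>. ?Z \<omega> * h (X u \<omega>))" if "0 \<le> u" for h u
    by (rule integrable_bounded_times[where B = 1]) (use that t in \<open>auto simp: survival_measurable survival_bounds\<close>)
  have i2: "integrable M (\<lambda>\<omega>. ?Z' \<omega> * ?g' \<omega>)" by (rule integrable_\<phi>[OF ts])
  define U where "U \<omega> = ?Z \<omega> * (transition_op E w s g (X t \<omega>) - g (X t \<omega>) - s * generator E w g (X t \<omega>))" for \<omega>
  define W where "W \<omega> = (?Z' \<omega> - ?Z \<omega>) * ?g' \<omega> + s * (?Z \<omega> * (c (X t \<omega>) * ?g \<omega>))" for \<omega>
  have iU: "integrable M U" unfolding U_def
    by (rule i1[OF t, of "\<lambda>y. transition_op E w s g y - g y - s * generator E w g y"])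
  have iW: "integrable M W"
    unfolding W_def left_diff_distrib
    by (intro Bochner_Integration.integrable_add Bochner_Integration.integrable_diff i2 i1[OF ts]
        integrable_mult_right i1[OF t, of "\<lambda>y. c y * g y"])
  have iN: "integrable M N" and eN: "expectation N \<le> K2 * s\<^sup>2"
    using expected_time_away(1,2)[OF t s] by (auto simp: N_def[abs_def] K2_def)
  have iJ: "integrable M J" and eJ: "expectation J \<le> K2 * s"
    using jump_probability[OF t s] by (auto simp: J_def[abs_def] K2_def)
  have cond: "expectation (\<lambda>\<omega>. ?Z \<omega> * ?g' \<omega>) = expectation (\<lambda>\<omega>. ?Z \<omega> * transition_op E w s g (X t \<omega>))"
    by (rule conditioning[OF t s(1) survival_past[OF t], where B = 1]) (use survival_bounds t in auto)
  have "expectation U = expectation (\<lambda>\<omega>. ?Z \<omega> * transition_op E w s g (X t \<omega>)) - expectation (\<lambda>\<omega>. ?Z \<omega> * ?g \<omega>)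
      - s * expectation (\<lambda>\<omega>. ?Z \<omega> * generator E w g (X t \<omega>))"
  proof -
    have "expectation U = expectation (\<lambda>\<omega>. ?Z \<omega> * transition_op E w s g (X t \<omega>) - ?Z \<omega> * ?g \<omega> - s * (?Z \<omega> * generator E w g (X t \<omega>)))"
      by (rule Bochner_Integration.integral_cong) (auto simp: U_def algebra_simps)
    then show ?thesis using i1[OF t] by simp
  qed
  moreover have "expectation W = expectation (\<lambda>\<omega>. ?Z' \<omega> * ?g' \<omega>) - expectation (\<lambda>\<omega>. ?Z \<omega> * ?g' \<omega>)
      + s * expectation (\<lambda>\<omega>. ?Z \<omega> * (c (X t \<omega>) * ?g \<omega>))"
    using i1[OF ts, of g] i2 i1[OF t, of "\<lambda>y. c y * g y"] by (simp add: W_def[abs_def] left_diff_distrib)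
  moreover have "\<phi> (killed_generator g) t = expectation (\<lambda>\<omega>. ?Z \<omega> * generator E w g (X t \<omega>))
      - expectation (\<lambda>\<omega>. ?Z \<omega> * (c (X t \<omega>) * ?g \<omega>))"
    using i1[OF t, of "generator E w g"] i1[OF t, of "\<lambda>y. c y * g y"]
    by (simp add: \<phi>_def killed_generator_def right_diff_distrib)
  ultimately have eq: "\<phi> g (t + s) - \<phi> g t - s * \<phi> (killed_generator g) t = expectation U + expectation W"
    unfolding \<phi>_def[of g] cond by (simp only: right_diff_distrib)
  have U_le: "\<bar>U \<omega>\<bar> \<le> K1 * s\<^sup>2" if \<omega>: "\<omega> \<in> space M" for \<omega>
  proof -
    have "\<bar>U \<omega>\<bar> \<le> 1 * (K1 * s\<^sup>2)"
      unfolding U_def abs_mult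
      by (intro mult_mono) (use survival_bounds[OF \<omega> t] transition_op_expansion[OF finite_E X_in[OF \<omega> t] s, of w g] in \<open>auto simp: K1_def G_def\<close>)
    then show ?thesis by simp
  qed
  have "\<bar>expectation U\<bar> \<le> expectation (\<lambda>\<omega>. \<bar>U \<omega>\<bar>)" by (rule integral_abs_bound)
  also have "\<dots> \<le> expectation (\<lambda>\<omega>. K1 * s\<^sup>2)" using iU U_le by (intro integral_mono) auto
  finally have EU: "\<bar>expectation U\<bar> \<le> K1 * s\<^sup>2" by (simp add: prob_space)
  have W_le: "\<bar>W \<omega>\<bar> \<le> (cmax\<^sup>2 * s\<^sup>2 + cmax * N \<omega>) * G + s * (cmax * (2 * G)) * J \<omega>" if \<omega>: "\<omega> \<in> space M" for \<omega>
  proof -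
    have Z: "0 \<le> ?Z \<omega>" "?Z \<omega> \<le> 1" using survival_bounds[OF \<omega> t] by auto
    have c: "0 \<le> c (X t \<omega>)" "c (X t \<omega>) \<le> cmax" using c_nonneg c_le X_in[OF \<omega> t] by auto
    have inc: "\<bar>?Z' \<omega> - ?Z \<omega> + s * (?Z \<omega> * c (X t \<omega>))\<bar> \<le> cmax\<^sup>2 * s\<^sup>2 + cmax * N \<omega>"
      using survival_increment[OF \<omega> t s] by (simp add: N_def)
    then have a: "\<bar>(?Z' \<omega> - ?Z \<omega> + s * (?Z \<omega> * c (X t \<omega>))) * ?g' \<omega>\<bar> \<le> (cmax\<^sup>2 * s\<^sup>2 + cmax * N \<omega>) * G"
      unfolding abs_mult using G[OF \<omega> ts] by (intro mult_mono) auto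
    have gg: "\<bar>?g \<omega> - ?g' \<omega>\<bar> \<le> 2 * G * J \<omega>"
      using G[OF \<omega> ts] G[OF \<omega> t] by (auto simp: J_def)
    have "\<bar>?Z \<omega> * c (X t \<omega>)\<bar> \<le> 1 * cmax" unfolding abs_mult using Z c by (intro mult_mono) auto
    then have "\<bar>s * (?Z \<omega> * c (X t \<omega>) * (?g \<omega> - ?g' \<omega>))\<bar> \<le> s * (cmax * (2 * G * J \<omega>))"
      using gg s cmax_nonneg by (simp only: abs_mult abs_of_nonneg) (intro mult_left_mono mult_mono, auto simp: abs_mult)
    moreover have "W \<omega> = (?Z' \<omega> - ?Z \<omega> + s * (?Z \<omega> * c (X t \<omega>))) * ?g' \<omega> + s * (?Z \<omega> * c (X t \<omega>) * (?g \<omega> - ?g' \<omega>))"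
      by (simp add: W_def algebra_simps)
    ultimately show ?thesis using a by (simp add: mult_ac)
  qed
  have "\<bar>expectation W\<bar> \<le> expectation (\<lambda>\<omega>. \<bar>W \<omega>\<bar>)" by (rule integral_abs_bound)
  also have "\<dots> \<le> expectation (\<lambda>\<omega>. (cmax\<^sup>2 * s\<^sup>2 + cmax * N \<omega>) * G + s * (cmax * (2 * G)) * J \<omega>)"
    using iW W_le iN iJ by (intro integral_mono) auto
  also have "\<dots> = (cmax\<^sup>2 * s\<^sup>2 + cmax * expectation N) * G + s * (cmax * (2 * G)) * expectation J"
    using iN iJ by (simp add: prob_space)
  also have "\<dots> \<le> (cmax\<^sup>2 * s\<^sup>2 + cmax * (K2 * s\<^sup>2)) * G + s * (cmax * (2 * G)) * (K2 * s)"
    using eN eJ G0 cmax_nonneg s by (intro add_mono mult_right_mono mult_left_mono) auto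
  also have "\<dots> = (cmax\<^sup>2 * G + cmax * K2 * G + 2 * cmax * G * K2) * s\<^sup>2" by (simp add: power2_eq_square algebra_simps)
  finally have "\<bar>\<phi> g (t + s) - \<phi> g t - s * \<phi> (killed_generator g) t\<bar> \<le> (K1 + (cmax\<^sup>2 * G + cmax * K2 * G + 2 * cmax * G * K2)) * s\<^sup>2"
    unfolding eq using EU by (simp add: distrib_right)
  then show "\<bar>\<phi> g (t + s) - \<phi> g t - s * \<phi> (killed_generator g) t\<bar>
      \<le> (transition_const E w * (\<Sum>v\<in>E. \<bar>g v\<bar>) + (cmax\<^sup>2 * (\<Sum>v\<in>E. \<bar>g v\<bar>) + cmax * jump_const E w * (\<Sum>v\<in>E. \<bar>g v\<bar>)
       + 2 * cmax * (\<Sum>v\<in>E. \<bar>g v\<bar>) * (jump_const E w))) * s\<^sup>2"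
    by (simp add: K1_def K2_def G_def)
qed

lemma \<phi>_bounded: "0 \<le> t \<Longrightarrow> \<bar>\<phi> g t\<bar> \<le> (\<Sum>v\<in>E. \<bar>g v\<bar>) * \<phi> (\<lambda>_. 1) t"
proof -
  assume t: "0 \<le> t"
  have "\<bar>\<phi> g t\<bar> \<le> expectation (\<lambda>\<omega>. \<bar>survival t \<omega> * g (X t \<omega>)\<bar>)" unfolding \<phi>_def by (rule integral_abs_bound)
  also have "\<dots> \<le> expectation (\<lambda>\<omega>. (\<Sum>v\<in>E. \<bar>g v\<bar>) * (survival t \<omega> * 1))"
  proof (rule integral_mono)
    fix \<omega> assume \<omega>: "\<omega> \<in> space M"
    show "\<bar>survival t \<omega> * g (X t \<omega>)\<bar> \<le> (\<Sum>v\<in>E. \<bar>g v\<bar>) * (survival t \<omega> * 1)"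
      using abs_le_sum[OF \<omega> t, of g] survival_bounds[OF \<omega> t]
      by (simp add: abs_mult mult_right_mono mult.commute[of "survival t \<omega>"])
  qed (use integrable_\<phi>[OF t, of g] integrable_\<phi>[OF t, of "\<lambda>_. 1"] in auto)
  also have "\<dots> = (\<Sum>v\<in>E. \<bar>g v\<bar>) * \<phi> (\<lambda>_. 1) t" by (simp add: \<phi>_def)
  finally show ?thesis .
qed

lemma \<phi>_one: 
  shows "0 \<le> t \<Longrightarrow> 0 \<le> \<phi> (\<lambda>_. 1) t" and "0 \<le> t \<Longrightarrow> t \<le> t' \<Longrightarrow> \<phi> (\<lambda>_. 1) t' \<le> \<phi> (\<lambda>_. 1) t"
    and "0 \<le> t \<Longrightarrow> \<phi> (\<lambda>_. 1) t \<le> 1"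
proof -
  show "0 \<le> t \<Longrightarrow> 0 \<le> \<phi> (\<lambda>_. 1) t"
    unfolding \<phi>_def by (intro integral_nonneg_AE AE_I2) (use survival_bounds in auto)
  show "0 \<le> t \<Longrightarrow> t \<le> t' \<Longrightarrow> \<phi> (\<lambda>_. 1) t' \<le> \<phi> (\<lambda>_. 1) t"
    unfolding \<phi>_def by (intro integral_mono integrable_\<phi>) (auto simp: survival_def killing_mono)
  have "0 \<le> t \<Longrightarrow> \<phi> (\<lambda>_. 1) t \<le> expectation (\<lambda>\<omega>. 1)"
    unfolding \<phi>_def by (intro integral_mono integrable_\<phi>) (auto simp: survival_bounds)
  then show "0 \<le> t \<Longrightarrow> \<phi> (\<lambda>_. 1) t \<le> 1" by (simp add: prob_space)
qed

lemma \<phi>_derivative: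
  assumes t: "0 \<le> t"
  shows "(\<phi> g has_real_derivative \<phi> (killed_generator g) t) (at t within {0..})"
proof -
  let ?h = "killed_generator g"
  obtain K where K: "\<And>t s. 0 \<le> t \<Longrightarrow> 0 \<le> s \<Longrightarrow> s \<le> 1 \<Longrightarrow> \<bar>\<phi> g (t + s) - \<phi> g t - s * \<phi> ?h t\<bar> \<le> K * s\<^sup>2"
    using \<phi>_increment[of g] by blast
  obtain K' where K': "\<And>t s. 0 \<le> t \<Longrightarrow> 0 \<le> s \<Longrightarrow> s \<le> 1 \<Longrightarrow>
      \<bar>\<phi> ?h (t + s) - \<phi> ?h t - s * \<phi> (killed_generator ?h) t\<bar> \<le> K' * s\<^sup>2"
    using \<phi>_increment[of ?h] by blast
  define L where "L = (\<Sum>v\<in>E. \<bar>killed_generator ?h v\<bar>)"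
  have K'0: "0 \<le> K'" using K'[of 0 1] by auto
  have "\<bar>\<phi> ?h (t + s) - \<phi> ?h t\<bar> \<le> (K' + L) * s" if "0 \<le> t" "0 \<le> s" "s \<le> 1" for t s
  proof -
    have "\<bar>\<phi> (killed_generator ?h) t\<bar> \<le> L * \<phi> (\<lambda>_. 1) t" unfolding L_def by (rule \<phi>_bounded[OF that(1)])
    also have "\<dots> \<le> L * 1" using \<phi>_one(3)[OF that(1)] by (intro mult_left_mono) (auto simp: L_def sum_nonneg)
    finally have "\<bar>s * \<phi> (killed_generator ?h) t\<bar> \<le> s * L" using that by (simp add: abs_mult mult_left_mono)
    moreover have "K' * s\<^sup>2 \<le> K' * s" using that K'0 by (simp add: power2_eq_square mult_left_le mult_left_mono)
    ultimately show ?thesis using K'[OF that] by (simp add: algebra_simps)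
  qed
  from has_derivative_of_quadratic_increments[OF K this t] show ?thesis .
qed

lemma \<phi>_0: "\<phi> g 0 = g x0"
proof -
  have "\<phi> g 0 = expectation (\<lambda>\<omega>. g (X 0 \<omega>))" by (simp add: \<phi>_def survival_def killing_0)
  also have "\<dots> = expectation (\<lambda>\<omega>. g x0)"
  proof (rule integral_cong_AE)
    show "(\<lambda>\<omega>. g (X 0 \<omega>)) \<in> borel_measurable M"
      using measurable_compose[OF X_measurable[of 0], of g] by simp
  qed (use X_0 in auto)
  finally show ?thesis by (simp add: prob_space)
qed

lemma \<phi>_continuous: "continuous_on {0..} (\<phi> g)"
  using \<phi>_derivative by (meson DERIV_continuous atLeast_iff continuous_on_eq_continuous_within)

lemma \<phi>_uminus: "\<phi> (\<lambda>y. - g y) t = - \<phi> g t" by (simp add: \<phi>_def)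

lemma \<phi>_nonneg: "0 \<le> t \<Longrightarrow> (\<And>y. y \<in> E \<Longrightarrow> 0 \<le> h y) \<Longrightarrow> 0 \<le> \<phi> h t"
  using X_in survival_bounds unfolding \<phi>_def by (auto intro!: integral_nonneg_AE AE_I2)

lemma \<phi>_integral:
  assumes T: "0 \<le> T" and g: "\<And>y. y \<in> E \<Longrightarrow> killed_generator g y = - h y"
    and h: "\<And>y. y \<in> E \<Longrightarrow> 0 \<le> h y"
  shows "(\<integral>\<^sup>+t. ennreal (\<phi> h t) * indicator {0..T} t \<partial>lborel) = ennreal (g x0 - \<phi> g T)"
proof -
  have "(\<phi> h has_integral (- \<phi> g T - (- \<phi> g 0))) {0..T}"
  proof (rule fundamental_theorem_of_calculus[OF T])
    fix t assume "t \<in> {0..T}"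
    then have t: "0 \<le> t" by simp
    have eq: "- \<phi> (killed_generator g) t = \<phi> h t"
      using \<phi>_cong[OF t g] \<phi>_uminus[of h t] by simp
    have "((\<lambda>t. - \<phi> g t) has_real_derivative - \<phi> (killed_generator g) t) (at t within {0..})"
      by (rule DERIV_minus[OF \<phi>_derivative[OF t]])
    then have "((\<lambda>t. - \<phi> g t) has_real_derivative \<phi> h t) (at t within {0..T})"
      unfolding eq by (rule DERIV_subset) auto
    then show "((\<lambda>t. - \<phi> g t) has_vector_derivative \<phi> h t) (at t within {0..T})"
      by (simp add: has_real_derivative_iff_has_vector_derivative)
  qed
  then have "(\<phi> h has_integral (g x0 - \<phi> g T)) {0..T}" by (simp add: \<phi>_0)
  then show ?thesis by (intro nn_integral_has_integral_lebesgue' \<phi>_nonneg h) auto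
qed

text \<open>
  Killing is certain as soon as the equation for the mean lifetime has a solution \<open>g1\<close>: since
  \<open>\<phi> (\<lambda>_. 1)\<close> is nonincreasing with integral bounded uniformly in the horizon \<open>T\<close>, it is at most of order
  \<open>1 / T\<close>. No sign of \<open>g1\<close> is needed.
\<close>

lemma \<phi>_vanishes:
  assumes g1: "\<And>y. y \<in> E \<Longrightarrow> killed_generator g1 y = - 1"
  shows "(\<phi> g \<longlongrightarrow> 0) at_top"
proof -
  define G where "G = (\<Sum>v\<in>E. \<bar>g1 v\<bar>)"
  have bound: "\<phi> (\<lambda>_. 1) T \<le> 2 * G / T" if T: "0 < T" for T
  proof -
    have T0: "0 \<le> T" using that by simp
    have "ennreal (T * \<phi> (\<lambda>_. 1) T) = (\<integral>\<^sup>+t. ennreal (\<phi> (\<lambda>_. 1) T) * indicator {0..T} t \<partial>lborel)"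
      using T \<phi>_one(1)[OF T0] by (subst nn_integral_cmult_indicator) (auto simp: ennreal_mult mult.commute)
    also have "\<dots> \<le> (\<integral>\<^sup>+t. ennreal (\<phi> (\<lambda>_. 1) t) * indicator {0..T} t \<partial>lborel)"
      using \<phi>_one(2) by (intro nn_integral_mono) (auto simp: indicator_def intro!: ennreal_leI)
    also have "\<dots> = ennreal (g1 x0 - \<phi> g1 T)" by (rule \<phi>_integral[OF T0]) (use g1 in auto)
    also have "\<dots> \<le> ennreal (2 * G)"
    proof (rule ennreal_leI)
      have "\<bar>g1 x0\<bar> \<le> G" unfolding G_def using x0 finite_E by (auto intro!: member_le_sum[where f = "\<lambda>v. \<bar>g1 v\<bar>"])
      moreover have "\<bar>\<phi> g1 T\<bar> \<le> G * 1"
        using \<phi>_one(3)[OF T0]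
        by (intro order_trans[OF \<phi>_bounded[OF T0, of g1]]) (auto simp: G_def sum_nonneg mult_left_le)
      ultimately show "g1 x0 - \<phi> g1 T \<le> 2 * G" by linarith
    qed
    finally have "T * \<phi> (\<lambda>_. 1) T \<le> 2 * G"
      by (subst (asm) ennreal_le_iff) (auto simp: G_def sum_nonneg)
    then show ?thesis using T by (simp add: field_simps)
  qed
  show ?thesis
  proof (rule Lim_null_comparison)
    show "((\<lambda>T. (\<Sum>v\<in>E. \<bar>g v\<bar>) * (2 * G / T)) \<longlongrightarrow> 0) at_top"
      by (intro tendsto_mult_right_zero tendsto_divide_0[OF tendsto_const] filterlim_at_top_imp_at_infinity filterlim_ident)
    show "\<forall>\<^sub>F T in at_top. norm (\<phi> g T) \<le> (\<Sum>v\<in>E. \<bar>g v\<bar>) * (2 * G / T)"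
      using eventually_gt_at_top[of 0]
    proof eventually_elim
      case (elim T)
      have "\<bar>\<phi> g T\<bar> \<le> (\<Sum>v\<in>E. \<bar>g v\<bar>) * \<phi> (\<lambda>_. 1) T" by (rule \<phi>_bounded) (use elim in simp)
      also have "\<dots> \<le> (\<Sum>v\<in>E. \<bar>g v\<bar>) * (2 * G / T)"
        by (intro mult_left_mono bound[OF elim] sum_nonneg) auto
      finally show ?case by simp
    qed
  qed
qed

text \<open>
  The expected integral of \<open>h\<close> along the path of the killed process is the value at \<open>x0\<close> of the
  solution \<open>g\<close> of \<open>- killed_generator g = h\<close>.
\<close>

lemma \<phi>_total_integral:
  assumes g1: "\<And>y. y \<in> E \<Longrightarrow> killed_generator g1 y = - 1"
    and g: "\<And>y. y \<in> E \<Longrightarrow> killed_generator g y = - h y"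
    and h: "\<And>y. y \<in> E \<Longrightarrow> 0 \<le> h y"
  shows "(\<integral>\<^sup>+t. ennreal (\<phi> h t) * indicator {0..} t \<partial>lborel) = ennreal (g x0)" and "0 \<le> g x0"
proof -
  have lim0: "(\<lambda>n. \<phi> g (real n)) \<longlonglongrightarrow> 0"
    by (rule filterlim_compose[OF \<phi>_vanishes[OF g1] filterlim_real_sequentially])
  have m: "(\<lambda>t. indicator {0..} t * \<phi> h t) \<in> borel_measurable borel"
    using borel_measurable_continuous_on_indicator[OF _ \<phi>_continuous[of h]] by simp
  have "(\<lambda>n. ennreal (g x0 - \<phi> g (real n))) \<longlonglongrightarrow> ennreal (g x0 - 0)"
    by (intro tendsto_intros lim0 tendsto_ennrealI)
  moreover have "(\<lambda>n. \<integral>\<^sup>+t. ennreal (\<phi> h t) * indicator {0..real n} t \<partial>lborel)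
      \<longlonglongrightarrow> (\<integral>\<^sup>+t. ennreal (\<phi> h t) * indicator {0..} t \<partial>lborel)"
  proof (rule nn_integral_LIMSEQ)
    show "incseq (\<lambda>n t. ennreal (\<phi> h t) * indicator {0..real n} t)"
      by (auto simp: incseq_def le_fun_def indicator_def)
    show "(\<lambda>t. ennreal (\<phi> h t) * indicator {0..real n} t) \<in> borel_measurable lborel" for n
    proof -
      have "(\<lambda>t. ennreal (indicator {0..} t * \<phi> h t) * indicator {0..real n} t) \<in> borel_measurable lborel"
        using m by measurable
      then show ?thesis by (rule measurable_cong[THEN iffD1, rotated]) (auto simp: indicator_def)
    qed
    fix t :: real
    have "eventually (\<lambda>n. real n \<ge> t) sequentially"
      by (rule filterlim_at_top[THEN iffD1, OF filterlim_real_sequentially, rule_format])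
    then have "eventually (\<lambda>n. ennreal (\<phi> h t) * indicator {0..real n} t = ennreal (\<phi> h t) * indicator {0..} t) sequentially"
      by eventually_elim (auto simp: indicator_def)
    then show "(\<lambda>n. ennreal (\<phi> h t) * indicator {0..real n} t) \<longlonglongrightarrow> ennreal (\<phi> h t) * indicator {0..} t"
      by (rule tendsto_eventually)
  qed
  ultimately show "(\<integral>\<^sup>+t. ennreal (\<phi> h t) * indicator {0..} t \<partial>lborel) = ennreal (g x0)"
    using \<phi>_integral[OF _ g h] by (simp add: LIMSEQ_unique)
  have "\<phi> g T \<le> g x0" if T: "0 < T" for T
  proof -
    have "\<phi> g T \<le> \<phi> g 0"
    proof (rule DERIV_nonpos_imp_decreasing_open[OF less_imp_le[OF T]])
      fix t assume "0 < t" "t < T"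
      then have t: "0 \<le> t" by simp
      have "at t within {0..} = at t" using \<open>0 < t\<close> by (intro at_within_interior) auto
      moreover have "\<phi> (killed_generator g) t = - \<phi> h t"
        using \<phi>_cong[OF t g] \<phi>_uminus[of h t] by simp
      ultimately show "\<exists>y. (\<phi> g has_real_derivative y) (at t) \<and> y \<le> 0"
        using \<phi>_derivative[OF t, of g] \<phi>_nonneg[OF t h] by auto
    qed (auto intro: continuous_on_subset[OF \<phi>_continuous])
    then show ?thesis by (simp add: \<phi>_0)
  qed
  then show "0 \<le> g x0"
    by (intro tendsto_upperbound[OF \<phi>_vanishes[OF g1, of g]]) (auto intro: eventually_mono[OF eventually_gt_at_top[of 0]])
qed

end

section \<open>Killing times\<close>

lemma sets_exponential [measurable_cong]: "sets (exponential l) = sets borel"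
  by (simp add: exponential_def)

lemma space_exponential: "space (exponential l) = UNIV"
  by (simp add: exponential_def)

lemma prob_space_exponential: "0 < l \<Longrightarrow> prob_space (exponential l)"
  unfolding exponential_def by (rule prob_space_exponential_density)

lemma emeasure_exponential:
  assumes l: "0 < l" and x: "0 \<le> x"
  shows "emeasure (exponential l) {b. x < b} = ennreal (exp (- (l * x)))"
    and "emeasure (exponential l) {..x} = ennreal (1 - exp (- (l * x)))"
proof -
  interpret prob_space "exponential l" by (rule prob_space_exponential[OF l])
  have D: "distributed (exponential l) lborel (\<lambda>x. x) (exponential_density l)"
    unfolding distributed_def
    by (auto simp: exponential_def distr_id2 intro!: distr_cong distr_id2)
  have "measure (exponential l) {b. x < b} = exp (- (l * x))"
    using exponential_distributedD_gt[OF D x l] by (simp add: space_exponential mult.commute)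
  then show "emeasure (exponential l) {b. x < b} = ennreal (exp (- (l * x)))"
    by (simp add: emeasure_eq_measure)
  have "measure (exponential l) {b. b \<le> x} = 1 - exp (- (l * x))"
    using exponential_distributedD_le[OF D x l] by (simp add: space_exponential mult.commute)
  then show "emeasure (exponential l) {..x} = ennreal (1 - exp (- (l * x)))"
    by (simp add: emeasure_eq_measure atMost_def)
qed

context bounded_rate
begin

text \<open>
  The first time at which the accumulated rate reaches \<open>a\<close>. For a rate that is the indicator of
  visits to a set it is the killing time.
\<close>

definition hit :: "real \<Rightarrow> ennreal" where
  "hit a = (INF t\<in>{t. 0 \<le> t \<and> a \<le> accum t}. ennreal t)"

lemma less_hit_iff:
  assumes t: "0 \<le> t"
  shows "ennreal t < hit a \<longleftrightarrow> accum t < a"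
proof
  assume less: "ennreal t < hit a"
  show "accum t < a"
  proof (rule ccontr)
    assume "\<not> accum t < a"
    then have "hit a \<le> ennreal t" unfolding hit_def using t by (intro INF_lower) auto
    then show False using less by simp
  qed
next
  assume less: "accum t < a"
  \<comment> \<open>\<open>B + 1\<close> instead of \<open>B\<close> avoids a division by \<open>0\<close>.\<close>
  define \<delta> where "\<delta> = (a - accum t) / (B + 1)"
  have \<delta>: "0 < \<delta>" using less B_nonneg by (simp add: \<delta>_def)
  have "ennreal (t + \<delta>) \<le> hit a"
    unfolding hit_def
  proof (rule INF_greatest)
    fix u assume "u \<in> {t. 0 \<le> t \<and> a \<le> accum t}"
    then have u: "0 \<le> u" "a \<le> accum u" by auto
    have tu: "t \<le> u" using accum_mono[of u t] u less by (cases "t \<le> u") auto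
    have "accum u \<le> accum t + B * (u - t)" by (rule accum_lipschitz[OF t tu])
    also have "\<dots> \<le> accum t + (B + 1) * (u - t)" using tu by (simp add: mult_right_mono)
    finally have "\<delta> \<le> u - t" using u B_nonneg by (simp add: \<delta>_def pos_divide_le_eq mult.commute)
    then show "ennreal (t + \<delta>) \<le> ennreal u" by (intro ennreal_leI) simp
  qed
  moreover have "ennreal t < ennreal (t + \<delta>)" using t \<delta> by (intro ennreal_lessI) auto
  ultimately show "ennreal t < hit a" by (rule less_le_trans[rotated])
qed

lemma hit_less_iff: 
  assumes "bounded_rate q' B'"
  shows "hit a < bounded_rate.hit q' b \<longleftrightarrow> (\<exists>t\<ge>0. a \<le> accum t \<and> bounded_rate.accum q' t < b)"
proof -
  interpret q': bounded_rate q' B' by fact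
  show ?thesis
  proof
    assume "hit a < q'.hit b"
    then obtain t where "0 \<le> t" "a \<le> accum t" "ennreal t < q'.hit b"
      unfolding hit_def by (auto simp: INF_less_iff)
    then show "\<exists>t\<ge>0. a \<le> accum t \<and> q'.accum t < b" using q'.less_hit_iff by auto
  next
    assume "\<exists>t\<ge>0. a \<le> accum t \<and> q'.accum t < b"
    then obtain t where t: "0 \<le> t" "a \<le> accum t" "q'.accum t < b" by auto
    have "hit a \<le> ennreal t" unfolding hit_def using t by (intro INF_lower) auto
    also have "\<dots> < q'.hit b" using q'.less_hit_iff t by simp
    finally show "hit a < q'.hit b" .
  qed
qed

text \<open>
  The times before \<open>hit a\<close> form an interval \<open>{0..<k}\<close> or all of \<open>{0..}\<close>, which is exhausted by an
  increasing sequence of its points.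
\<close>

lemma cofinal_sequence:
  assumes "0 < a"
  obtains t where "incseq t" "\<And>n::nat. 0 \<le> t n \<and> accum (t n) < a"
    "\<And>x. 0 \<le> x \<Longrightarrow> accum x < a \<Longrightarrow> \<exists>n. x \<le> t n"
proof (cases "hit a")
  case top
  then have J: "accum t < a" if "0 \<le> t" for t using less_hit_iff[OF that, of a] by simp
  show ?thesis
  proof (rule that[of real])
    show "incseq real" by (auto simp: incseq_def)
    show "0 \<le> real n \<and> accum (real n) < a" for n using J by simp
    show "\<exists>n. x \<le> real n" for x by (rule real_arch_simple)
  qed
next
  case (real k)
  have J: "accum t < a \<longleftrightarrow> t < k" if "0 \<le> t" for t
    using less_hit_iff[OF that, of a] real that by (simp add: ennreal_less_iff)
  have k: "0 < k" using J[of 0] assms by (simp add: accum_0)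
  show ?thesis
  proof (rule that[of "\<lambda>n. k - k / real (Suc n)"])
    show "incseq (\<lambda>n. k - k / real (Suc n))"
      using k by (auto simp: incseq_def intro!: divide_left_mono)
    show "0 \<le> k - k / real (Suc n) \<and> accum (k - k / real (Suc n)) < a" for n
    proof -
      have "0 \<le> k - k / real (Suc n)" "k - k / real (Suc n) < k" using k by (auto simp: field_simps)
      then show ?thesis using J by simp
    qed
    fix x assume "0 \<le> x" "accum x < a"
    then have "0 < k - x" using J by simp
    then obtain n where "k / (k - x) < real n" using reals_Archimedean2 by blast
    then have "k < real n * (k - x)" using \<open>0 < k - x\<close> by (simp add: pos_divide_less_eq)
    also have "\<dots> \<le> real (Suc n) * (k - x)" using \<open>0 < k - x\<close> by (intro mult_right_mono) auto
    finally have "k / real (Suc n) < k - x" by (simp add: pos_divide_less_eq mult.commute)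
    then show "\<exists>n. x \<le> k - k / real (Suc n)" by (intro exI[of _ n]) simp
  qed
qed

lemma hit_layer_cake: "hit a = (\<integral>\<^sup>+t. indicator {0..} t * indicator {b. accum t < b} a \<partial>lborel)"
proof -
  let ?J = "{t. 0 \<le> t \<and> accum t < a}"
  have m: "?J \<in> sets lborel"
  proof -
    have "?J = {t \<in> space borel. 0 \<le> t \<and> accum t < a}" by simp
    also have "\<dots> \<in> sets borel" by measurable
    finally show ?thesis by simp
  qed
  have "(\<integral>\<^sup>+t. indicator {0..} t * indicator {b. accum t < b} a \<partial>lborel) = (\<integral>\<^sup>+t. indicator ?J t \<partial>lborel)"
    by (intro nn_integral_cong) (auto simp: indicator_def)
  also have "\<dots> = emeasure lborel ?J" using m by simp
  also have "\<dots> = hit a"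
  proof (cases "hit a")
    case top
    then have "?J = {0..}" using less_hit_iff[of _ a] by auto
    moreover have "emeasure lborel {0::real..} = top"
    proof (rule ccontr)
      assume "emeasure lborel {0::real..} \<noteq> top"
      then obtain r where r: "0 \<le> r" "emeasure lborel {0::real..} = ennreal r" by (cases "emeasure lborel {0::real..}") auto
      have "emeasure lborel {0..r + 1} \<le> emeasure lborel {0::real..}" by (intro emeasure_mono) auto
      then show False using r by (simp add: ennreal_le_iff)
    qed
    ultimately show ?thesis using top by simp
  next
    case (real k)
    have "?J = {0..<k}" using less_hit_iff[of _ a] real by (auto simp: ennreal_less_iff)
    then show ?thesis using real by simp
  qed
  finally show ?thesis ..
qed

lemma nn_integral_exp_accum:
  assumes t: "0 \<le> t"
  shows "(\<integral>\<^sup>+s. ennreal (q s * exp (- accum s)) * indicator {0..t} s \<partial>lborel) = ennreal (1 - exp (- accum t))"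
proof -
  let ?g = "\<lambda>s. q s * exp (- accum s)"
  have g: "set_integrable lborel {0..t} ?g" by (rule set_integrable_rate(2)[where a = 0 and b = t]) auto
  have "(\<integral>\<^sup>+s. ennreal (?g s) * indicator {0..t} s \<partial>lborel) = (\<integral>\<^sup>+s. ennreal (indicator {0..t} s *\<^sub>R ?g s) \<partial>lborel)"
    by (intro nn_integral_cong) (auto simp: indicator_def)
  also have "\<dots> = ennreal (LBINT s:{0..t}. ?g s)"
    unfolding set_lebesgue_integral_def
    by (rule nn_integral_eq_integral) (use g q_nonneg in \<open>auto simp: set_integrable_def\<close>)
  finally show ?thesis by (simp add: exp_accum[OF t])
qed

lemma bounded_rate_scale: "0 \<le> k \<Longrightarrow> bounded_rate (\<lambda>s. k * q s) (k * B)"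
  by unfold_locales (auto intro: mult_left_mono q_le mult_nonneg_nonneg q_nonneg)

lemma accum_scale: "0 \<le> k \<Longrightarrow> bounded_rate.accum (\<lambda>s. k * q s) t = k * accum t"
  by (simp add: bounded_rate.accum_def[OF bounded_rate_scale] accum_def)

text \<open>
  For fixed paths, the probability that the exponential clock \<open>a\<close> of rate \<open>k\<close> rings, in the time scale of
  \<open>accum\<close>, before the level \<open>b\<close> is reached in the time scale of the second rate. The event is an increasing
  union of the events \<open>a \<le> accum t\<close>, so no change of variables is needed.
\<close>

lemma emeasure_hit_before:
  assumes q': "bounded_rate q' B'" and k: "0 < k"
  shows "emeasure (exponential k) {a. hit a < bounded_rate.hit q' b}
     = (\<integral>\<^sup>+t. ennreal (k * q t * exp (- (k * accum t))) * indicator {0..} t * indicator {b. bounded_rate.accum q' t < b} b \<partial>lborel)"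
    (is "?l = integral\<^sup>N lborel ?f")
proof -
  interpret q': bounded_rate q' B' by fact
  have set_eq: "{a. hit a < q'.hit b} = {a. \<exists>t\<ge>0. a \<le> accum t \<and> q'.accum t < b}"
    using hit_less_iff[OF q'] by auto
  show ?thesis
  proof (cases "0 < b")
    case False
    have empty: "\<not> q'.accum t < b" if "0 \<le> t" for t using q'.accum_nonneg[OF that] False by simp
    then have "{a. hit a < q'.hit b} = {}" unfolding set_eq by auto
    moreover have "integral\<^sup>N lborel ?f = (\<integral>\<^sup>+(t::real). 0 \<partial>lborel)"
      by (intro nn_integral_cong) (use empty in \<open>auto simp: indicator_def\<close>)
    ultimately show ?thesis by simp
  next
    case True
    obtain t where t: "incseq t" "\<And>n::nat. 0 \<le> t n \<and> q'.accum (t n) < b"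
      "\<And>x. 0 \<le> x \<Longrightarrow> q'.accum x < b \<Longrightarrow> \<exists>n. x \<le> t n"
      using q'.cofinal_sequence[OF True] by blast
    define g where "g s = ennreal (k * q s * exp (- (k * accum s)))" for s
    have [measurable]: "g \<in> borel_measurable borel" unfolding g_def by measurable
    have mono: "accum (t m) \<le> accum (t n)" if "m \<le> n" for m n
      using t(1,2) that by (intro accum_mono) (auto simp: incseq_def)
    have "{a. hit a < q'.hit b} = (\<Union>n. {..accum (t n)})"
    proof (intro set_eqI iffI)
      fix a assume "a \<in> {a. hit a < q'.hit b}"
      then obtain s where s: "0 \<le> s" "a \<le> accum s" "q'.accum s < b" unfolding set_eq by auto
      then obtain n where "s \<le> t n" using t(3) by blast
      then show "a \<in> (\<Union>n. {..accum (t n)})" using s accum_mono[of s "t n"] by (auto intro!: exI[of _ n])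
    next
      fix a assume "a \<in> (\<Union>n. {..accum (t n)})"
      then show "a \<in> {a. hit a < q'.hit b}" unfolding set_eq using t(2) by auto
    qed
    then have "?l = (SUP n. emeasure (exponential k) {..accum (t n)})"
      using mono by (subst SUP_emeasure_incseq) (auto simp: incseq_def sets_exponential)
    also have "\<dots> = (SUP n. \<integral>\<^sup>+s. g s * indicator {0..t n} s \<partial>lborel)"
    proof (intro SUP_cong refl)
      fix n
      have k0: "0 \<le> k" using k by simp
      have "(\<integral>\<^sup>+s. g s * indicator {0..t n} s \<partial>lborel) = ennreal (1 - exp (- (k * accum (t n))))"
        using bounded_rate.nn_integral_exp_accum[OF bounded_rate_scale[OF k0], of "t n"] t(2)
        by (simp add: accum_scale[OF k0] g_def)
      then show "emeasure (exponential k) {..accum (t n)} = (\<integral>\<^sup>+s. g s * indicator {0..t n} s \<partial>lborel)"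
        using emeasure_exponential(2)[OF k accum_nonneg] t(2) by simp
    qed
    also have "\<dots> = (\<integral>\<^sup>+s. (SUP n. g s * indicator {0..t n} s) \<partial>lborel)"
    proof (rule nn_integral_monotone_convergence_SUP[symmetric])
      show "incseq (\<lambda>n s. g s * indicator {0..t n} s)"
        using t(1) by (auto simp: incseq_def le_fun_def indicator_def intro: order_trans)
    qed measurable
    also have "\<dots> = integral\<^sup>N lborel ?f"
    proof (rule nn_integral_cong)
      fix s
      show "(SUP n. g s * indicator {0..t n} s) = ?f s"
      proof (cases "0 \<le> s \<and> q'.accum s < b")
        case True
        then obtain n where n: "s \<le> t n" using t(3) by blast
        have "(SUP n. g s * indicator {0..t n} s) = g s"
          by (intro antisym SUP_least SUP_upper2[of n]) (use True n in \<open>auto simp: indicator_def\<close>)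
        then show ?thesis using True by (simp add: g_def)
      next
        case False
        have "\<not> (0 \<le> s \<and> s \<le> t n)" for n
        proof
          assume s: "0 \<le> s \<and> s \<le> t n"
          then have "q'.accum s \<le> q'.accum (t n)" by (intro q'.accum_mono) auto
          then show False using False s t(2)[of n] by auto
        qed
        then have "indicator {0..t n} s = (0 :: ennreal)" for n by simp
        then have "(SUP n. g s * indicator {0..t n} s) = 0" by simp
        then show ?thesis using False by (auto simp: indicator_def)
      qed
    qed
    finally show ?thesis .
  qed
qed

end

context jump_process
begin

lemma occupation: "killed_process M E w X x0 (indicator A)"
  by unfold_locales simp

text \<open>
  The indicator of the times spent in \<open>A\<close>, extended by \<open>0\<close> to negative times.
\<close>

definition visits :: "'a set \<Rightarrow> 'b \<Rightarrow> real \<Rightarrow> real" where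
  "visits A \<omega> s = indicator {0..} s * indicator A (X s \<omega>)"

lemma bounded_rate_visits:
  assumes "\<omega> \<in> space M"
  shows "bounded_rate (visits A \<omega>) 1"
  unfolding bounded_rate_def visits_def using path_measurable_fixed[OF assms, of "indicator A"]
  by (auto simp: indicator_def)

lemma local_time_eq:
  assumes "\<omega> \<in> space M"
  shows "local_time X A t \<omega> = bounded_rate.accum (visits A \<omega>) t"
proof -
  interpret bounded_rate "visits A \<omega>" 1 by (rule bounded_rate_visits[OF assms])
  show ?thesis unfolding local_time_def accum_def
    by (rule set_lebesgue_integral_cong) (auto simp: visits_def)
qed

lemma killing_time_eq:
  assumes "\<omega> \<in> space M"
  shows "killing_time X A \<omega> a = bounded_rate.hit (visits A \<omega>) a"
proof -
  interpret bounded_rate "visits A \<omega>" 1 by (rule bounded_rate_visits[OF assms])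
  show ?thesis unfolding killing_time_def hit_def local_time_eq[OF assms] ..
qed

lemma local_time_measurable: "0 \<le> t \<Longrightarrow> local_time X A t \<in> borel_measurable M"
proof -
  assume t: "0 \<le> t"
  interpret A: killed_process M E w X x0 "indicator A" by (rule occupation)
  have "A.killing t \<in> borel_measurable M"
    by (rule measurable_from_subalg[OF subalgebra_past[OF t] A.killing_measurable_past[OF t]])
  then show ?thesis by (simp add: A.killing_def[abs_def] local_time_def[abs_def])
qed

lemma killing_time_measurable:
  "(\<lambda>(\<omega>, a). killing_time X A \<omega> a) \<in> borel_measurable (M \<Otimes>\<^sub>M borel)"
proof (rule borel_measurableI_less)
  fix y :: ennreal
  \<comment> \<open>Since the local time is monotone, rational times suffice in the infimum.\<close>
  define Q where "Q = {q \<in> \<rat>. 0 \<le> q \<and> ennreal q < y}"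
  have "{p \<in> space (M \<Otimes>\<^sub>M (borel :: real measure)). (case p of (\<omega>, a) \<Rightarrow> killing_time X A \<omega> a) < y}
     = (\<Union>q\<in>Q. {p \<in> space (M \<Otimes>\<^sub>M borel). snd p \<le> local_time X A q (fst p)})" (is "?L = ?R")
  proof (intro equalityI subsetI)
    fix p assume p: "p \<in> ?L"
    obtain \<omega> a where pe: "p = (\<omega>, a)" by (cases p)
    have \<omega>: "\<omega> \<in> space M" using p pe by (auto simp: space_pair_measure)
    interpret bounded_rate "visits A \<omega>" 1 by (rule bounded_rate_visits[OF \<omega>])
    obtain t where t: "0 \<le> t" "a \<le> local_time X A t \<omega>" "ennreal t < y"
      using p unfolding pe killing_time_def by (auto simp: INF_less_iff)
    obtain q where q: "q \<in> \<rat>" "t \<le> q" "ennreal q < y"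
    proof (cases y)
      case top
      obtain q where "q \<in> \<rat>" "t < q" using Rats_dense_in_real[of t "t + 1"] by auto
      then show ?thesis using top by (intro that[of q]) auto
    next
      case (real r)
      then have "t < r" using t by (simp add: ennreal_less_iff)
      then obtain q where "q \<in> \<rat>" "t < q" "q < r" using Rats_dense_in_real by blast
      then show ?thesis using real t by (intro that[of q]) (auto simp: ennreal_less_iff)
    qed
    have "a \<le> local_time X A q \<omega>"
      using t q accum_mono[of t q] by (simp add: local_time_eq[OF \<omega>])
    then show "p \<in> ?R" using p q t pe by (auto simp: Q_def)
  next
    fix p assume p: "p \<in> ?R"
    obtain \<omega> a where pe: "p = (\<omega>, a)" by (cases p)
    obtain q where q: "q \<in> Q" "a \<le> local_time X A q \<omega>" using p pe by auto
    have "killing_time X A \<omega> a \<le> ennreal q"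
      unfolding killing_time_def using q by (intro INF_lower) (auto simp: Q_def)
    also have "\<dots> < y" using q by (simp add: Q_def)
    finally show "p \<in> ?L" using p pe by auto
  qed
  also have "\<dots> \<in> sets (M \<Otimes>\<^sub>M borel)"
  proof (rule sets.countable_UN'')
    show "countable Q" unfolding Q_def by (rule countable_subset[OF _ countable_rat]) auto
    fix q assume "q \<in> Q"
    then have [measurable]: "local_time X A q \<in> borel_measurable M" by (intro local_time_measurable) (simp add: Q_def)
    show "{p \<in> space (M \<Otimes>\<^sub>M borel). snd p \<le> local_time X A q (fst p)} \<in> sets (M \<Otimes>\<^sub>M borel)"
      by measurable
  qed
  finally show "{p \<in> space (M \<Otimes>\<^sub>M (borel :: real measure)). (case p of (\<omega>, a) \<Rightarrow> killing_time X A \<omega> a) < y} \<in> sets (M \<Otimes>\<^sub>M borel)" .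
qed

lemma killing_time_measurable':
  "(\<lambda>p. killing_time X A (fst p) (snd p)) \<in> borel_measurable (M \<Otimes>\<^sub>M exponential l)"
proof -
  have "sets (M \<Otimes>\<^sub>M exponential l) = sets (M \<Otimes>\<^sub>M borel)"
    by (intro sets_pair_measure_cong sets_exponential refl)
  from measurable_cong_sets[OF this refl, of borel] show ?thesis
    using killing_time_measurable[of A] by (simp add: case_prod_beta')
qed

end

context killed_process
begin

lemma survival_measurable_pair: "(\<lambda>p. survival (snd p) (fst p)) \<in> borel_measurable (M \<Otimes>\<^sub>M lborel)"
  using killing_measurable_pair unfolding survival_def by (simp add: case_prod_beta)

lemma nn_integral_\<phi>:
  assumes h: "\<And>y. y \<in> E \<Longrightarrow> 0 \<le> h y"
  shows "(\<integral>\<^sup>+\<omega>. (\<integral>\<^sup>+t. ennreal (survival t \<omega> * h (X t \<omega>)) * indicator {0..} t \<partial>lborel) \<partial>M)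
       = (\<integral>\<^sup>+t. ennreal (\<phi> h t) * indicator {0..} t \<partial>lborel)"
proof -
  interpret pair_sigma_finite M lborel ..
  have [measurable]: "(\<lambda>p. indicator {0..} (snd p) * h (X (snd p) (fst p))) \<in> borel_measurable (M \<Otimes>\<^sub>M lborel)"
    using path_measurable[of h] by (simp add: case_prod_beta)
  note survival_measurable_pair [measurable]
  have "(\<lambda>p. ennreal (survival (snd p) (fst p) * (indicator {0..} (snd p) * h (X (snd p) (fst p))))) \<in> borel_measurable (M \<Otimes>\<^sub>M lborel)"
    by measurable
  then have m: "(\<lambda>(\<omega>, t). ennreal (survival t \<omega> * h (X t \<omega>)) * indicator {0..} t) \<in> borel_measurable (M \<Otimes>\<^sub>M lborel)"
    by (rule measurable_cong[THEN iffD1, rotated]) (auto simp: indicator_def)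
  have "(\<integral>\<^sup>+\<omega>. (\<integral>\<^sup>+t. ennreal (survival t \<omega> * h (X t \<omega>)) * indicator {0..} t \<partial>lborel) \<partial>M)
      = (\<integral>\<^sup>+t. (\<integral>\<^sup>+\<omega>. ennreal (survival t \<omega> * h (X t \<omega>)) * indicator {0..} t \<partial>M) \<partial>lborel)"
    by (rule Fubini'[symmetric, OF m])
  also have "\<dots> = (\<integral>\<^sup>+t. ennreal (\<phi> h t) * indicator {0..} t \<partial>lborel)"
  proof (rule nn_integral_cong)
    fix t :: real
    show "(\<integral>\<^sup>+\<omega>. ennreal (survival t \<omega> * h (X t \<omega>)) * indicator {0..} t \<partial>M) = ennreal (\<phi> h t) * indicator {0..} t"
    proof (cases "0 \<le> t")
      case True
      have "(\<integral>\<^sup>+\<omega>. ennreal (survival t \<omega> * h (X t \<omega>)) \<partial>M) = ennreal (\<phi> h t)"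
        unfolding \<phi>_def
        by (rule nn_integral_eq_integral[OF integrable_\<phi>[OF True]]) (use survival_bounds True h X_in in auto)
      then show ?thesis using True by simp
    qed simp
  qed
  finally show ?thesis .
qed

end

context jump_process
begin

text \<open>
  By Tonelli the mean killing time is the integral over time of the expected survival probability for
  the killing rate \<open>l\<close> on \<open>S\<close>.
\<close>

lemma mean_killing_time_solution:
  assumes l: "0 < l"
    and g: "\<And>y. y \<in> E \<Longrightarrow> generator E w g y - l * indicator S y * g y = - 1"
  shows "(\<integral>\<^sup>+(\<omega>, b). killing_time X S \<omega> b \<partial>(M \<Otimes>\<^sub>M exponential l)) = ennreal (g x0)" and "0 \<le> g x0"
proof -
  interpret K: killed_process M E w X x0 "\<lambda>y. l * indicator S y"
    by unfold_locales (use l in simp)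
  have g': "y \<in> E \<Longrightarrow> K.killed_generator g y = - 1" for y
    using g by (simp add: K.killed_generator_def)
  interpret L: prob_space "exponential l" by (rule prob_space_exponential[OF l])
  have "(\<integral>\<^sup>+(\<omega>, b). killing_time X S \<omega> b \<partial>(M \<Otimes>\<^sub>M exponential l))
      = (\<integral>\<^sup>+\<omega>. (\<integral>\<^sup>+b. killing_time X S \<omega> b \<partial>exponential l) \<partial>M)"
    using L.nn_integral_fst[of "\<lambda>p. killing_time X S (fst p) (snd p)" M] killing_time_measurable'
    by (simp add: case_prod_beta')
  also have "\<dots> = (\<integral>\<^sup>+\<omega>. (\<integral>\<^sup>+t. ennreal (K.survival t \<omega> * 1) * indicator {0..} t \<partial>lborel) \<partial>M)"
  proof (rule nn_integral_cong)
    fix \<omega> assume \<omega>: "\<omega> \<in> space M"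
    interpret bounded_rate "visits S \<omega>" 1 by (rule bounded_rate_visits[OF \<omega>])
    interpret P: pair_sigma_finite "exponential l" lborel ..
    have m: "(\<lambda>(b, t). indicator {0..} t * indicator {b. accum t < b} b :: ennreal) \<in> borel_measurable (exponential l \<Otimes>\<^sub>M lborel)"
    proof -
      have "(\<lambda>p. if 0 \<le> snd p \<and> accum (snd p) < fst p then 1 else 0 :: ennreal) \<in> borel_measurable (exponential l \<Otimes>\<^sub>M lborel)"
        by measurable
      then show ?thesis by (rule measurable_cong[THEN iffD1, rotated]) (auto simp: indicator_def)
    qed
    have "(\<integral>\<^sup>+b. killing_time X S \<omega> b \<partial>exponential l)
        = (\<integral>\<^sup>+b. (\<integral>\<^sup>+t. indicator {0..} t * indicator {b. accum t < b} b \<partial>lborel) \<partial>exponential l)"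
      by (simp add: killing_time_eq[OF \<omega>] hit_layer_cake)
    also have "\<dots> = (\<integral>\<^sup>+t. (\<integral>\<^sup>+b. indicator {0..} t * indicator {b. accum t < b} b \<partial>exponential l) \<partial>lborel)"
      by (rule P.Fubini'[symmetric, OF m])
    also have "\<dots> = (\<integral>\<^sup>+t. ennreal (K.survival t \<omega> * 1) * indicator {0..} t \<partial>lborel)"
    proof (rule nn_integral_cong)
      fix t :: real
      show "(\<integral>\<^sup>+b. indicator {0..} t * indicator {b. accum t < b} b \<partial>exponential l) = ennreal (K.survival t \<omega> * 1) * indicator {0..} t"
      proof (cases "0 \<le> t")
        case True
        have "K.killing t \<omega> = l * accum t"
          using local_time_eq[OF \<omega>, of S t] by (simp add: K.killing_def local_time_def)
        moreover have "(\<integral>\<^sup>+b. indicator {b. accum t < b} b \<partial>exponential l) = emeasure (exponential l) {b. accum t < b}"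
          by (rule nn_integral_indicator) (simp add: sets_exponential)
        ultimately show ?thesis
          using True emeasure_exponential(1)[OF l accum_nonneg[OF True]] by (simp add: K.survival_def)
      qed simp
    qed
    finally show "(\<integral>\<^sup>+b. killing_time X S \<omega> b \<partial>exponential l) = (\<integral>\<^sup>+t. ennreal (K.survival t \<omega> * 1) * indicator {0..} t \<partial>lborel)" .
  qed
  also have "\<dots> = (\<integral>\<^sup>+t. ennreal (K.\<phi> (\<lambda>_. 1) t) * indicator {0..} t \<partial>lborel)"
    by (rule K.nn_integral_\<phi>) simp
  also have "\<dots> = ennreal (g x0)"
    by (rule K.\<phi>_total_integral(1)[OF g' g']) auto
  finally show "(\<integral>\<^sup>+(\<omega>, b). killing_time X S \<omega> b \<partial>(M \<Otimes>\<^sub>M exponential l)) = ennreal (g x0)" .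
  show "0 \<le> g x0" by (rule K.\<phi>_total_integral(2)[OF g' g']) auto
qed

text \<open>
  The hitting probability is the integral over time of the density of being killed in \<open>R\<close>, for the
  process killed at rate \<open>k\<close> on \<open>R\<close> and \<open>l\<close> on \<open>S\<close>; the two rates add up on the overlap.
\<close>

lemma hitting_prob_solution:
  assumes l: "0 < l" and k: "0 < k"
    and g1: "\<And>y. y \<in> E \<Longrightarrow> generator E w g1 y - (k * indicator R y + l * indicator S y) * g1 y = - 1"
    and g: "\<And>y. y \<in> E \<Longrightarrow> generator E w g y - (k * indicator R y + l * indicator S y) * g y = - (k * indicator R y)"
  shows "measure (M \<Otimes>\<^sub>M (exponential k \<Otimes>\<^sub>M exponential l))
       {(\<omega>, a, b). \<omega> \<in> space M \<and> killing_time X R \<omega> a < killing_time X S \<omega> b} = g x0"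
    and "0 \<le> g x0" and "g x0 \<le> 1"
proof -
  interpret K: killed_process M E w X x0 "\<lambda>y. k * indicator R y + l * indicator S y"
    by unfold_locales (use l k in simp)
  have g1': "y \<in> E \<Longrightarrow> K.killed_generator g1 y = - 1" for y
    using g1 by (simp add: K.killed_generator_def)
  have g': "y \<in> E \<Longrightarrow> K.killed_generator g y = - (k * indicator R y)" for y
    using g by (simp add: K.killed_generator_def)
  interpret L: prob_space "exponential l" by (rule prob_space_exponential[OF l])
  interpret KK: prob_space "exponential k" by (rule prob_space_exponential[OF k])
  interpret KL: pair_prob_space "exponential k" "exponential l" ..
  interpret MKL: pair_prob_space M "exponential k \<Otimes>\<^sub>M exponential l" ..
  define A where "A = {(\<omega>, a, b). \<omega> \<in> space M \<and> killing_time X R \<omega> a < killing_time X S \<omega> b}"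
  have A: "A \<in> sets (M \<Otimes>\<^sub>M (exponential k \<Otimes>\<^sub>M exponential l))"
  proof -
    let ?N = "M \<Otimes>\<^sub>M (exponential k \<Otimes>\<^sub>M exponential l)"
    have 1: "(\<lambda>p. (fst p, fst (snd p))) \<in> measurable ?N (M \<Otimes>\<^sub>M exponential k)"
      and 2: "(\<lambda>p. (fst p, snd (snd p))) \<in> measurable ?N (M \<Otimes>\<^sub>M exponential l)" by measurable
    have R: "(\<lambda>p. killing_time X R (fst p) (fst (snd p))) \<in> borel_measurable ?N"
      using measurable_compose[OF 1 killing_time_measurable'[of R k]] by (simp only: fst_conv snd_conv)
    have S: "(\<lambda>p. killing_time X S (fst p) (snd (snd p))) \<in> borel_measurable ?N"
      using measurable_compose[OF 2 killing_time_measurable'[of S l]] by (simp only: fst_conv snd_conv)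
    have "A = {p \<in> space (M \<Otimes>\<^sub>M (exponential k \<Otimes>\<^sub>M exponential l)).
        killing_time X R (fst p) (fst (snd p)) < killing_time X S (fst p) (snd (snd p))}"
      by (auto simp: A_def space_pair_measure space_exponential)
    also have "\<dots> \<in> sets (M \<Otimes>\<^sub>M (exponential k \<Otimes>\<^sub>M exponential l))"
      by (rule borel_measurable_less[OF R S])
    finally show ?thesis .
  qed
  have "emeasure (M \<Otimes>\<^sub>M (exponential k \<Otimes>\<^sub>M exponential l)) A
      = (\<integral>\<^sup>+\<omega>. emeasure (exponential k \<Otimes>\<^sub>M exponential l) (Pair \<omega> -` A) \<partial>M)"
    by (rule KL.P.emeasure_pair_measure_alt[OF A])
  also have "\<dots> = (\<integral>\<^sup>+\<omega>. (\<integral>\<^sup>+t. ennreal (K.survival t \<omega> * (k * indicator R (X t \<omega>))) * indicator {0..} t \<partial>lborel) \<partial>M)"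
  proof (rule nn_integral_cong)
    fix \<omega> assume \<omega>: "\<omega> \<in> space M"
    interpret r: bounded_rate "visits R \<omega>" 1 by (rule bounded_rate_visits[OF \<omega>])
    interpret s: bounded_rate "visits S \<omega>" 1 by (rule bounded_rate_visits[OF \<omega>])
    interpret P: pair_sigma_finite "exponential l" lborel ..
    define f where "f t = ennreal (k * visits R \<omega> t * exp (- (k * r.accum t))) * indicator {0..} t" for t
    have [measurable]: "f \<in> borel_measurable borel" unfolding f_def by measurable
    have m: "(\<lambda>(b, t). f t * indicator {b. s.accum t < b} b) \<in> borel_measurable (exponential l \<Otimes>\<^sub>M lborel)"
    proof -
      have "(\<lambda>p. if s.accum (snd p) < fst p then f (snd p) else 0) \<in> borel_measurable (exponential l \<Otimes>\<^sub>M lborel)"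
        by measurable
      then show ?thesis by (rule measurable_cong[THEN iffD1, rotated]) (auto simp: indicator_def)
    qed
    have "emeasure (exponential k \<Otimes>\<^sub>M exponential l) (Pair \<omega> -` A)
        = (\<integral>\<^sup>+b. emeasure (exponential k) ((\<lambda>a. (a, b)) -` (Pair \<omega> -` A)) \<partial>exponential l)"
      by (rule KL.emeasure_pair_measure_alt2[OF sets_Pair1[OF A]])
    also have "\<dots> = (\<integral>\<^sup>+b. (\<integral>\<^sup>+t. f t * indicator {b. s.accum t < b} b \<partial>lborel) \<partial>exponential l)"
    proof (rule nn_integral_cong)
      fix b
      have "(\<lambda>a. (a, b)) -` (Pair \<omega> -` A) = {a. r.hit a < s.hit b}"
        using \<omega> by (auto simp: A_def killing_time_eq[OF \<omega>])
      then show "emeasure (exponential k) ((\<lambda>a. (a, b)) -` (Pair \<omega> -` A)) = (\<integral>\<^sup>+t. f t * indicator {b. s.accum t < b} b \<partial>lborel)"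
        using r.emeasure_hit_before[OF s.bounded_rate_axioms k, of b] by (simp add: f_def)
    qed
    also have "\<dots> = (\<integral>\<^sup>+t. (\<integral>\<^sup>+b. f t * indicator {b. s.accum t < b} b \<partial>exponential l) \<partial>lborel)"
      by (rule P.Fubini'[symmetric, OF m])
    also have "\<dots> = (\<integral>\<^sup>+t. ennreal (K.survival t \<omega> * (k * indicator R (X t \<omega>))) * indicator {0..} t \<partial>lborel)"
    proof (rule nn_integral_cong)
      fix t :: real
      show "(\<integral>\<^sup>+b. f t * indicator {b. s.accum t < b} b \<partial>exponential l) = ennreal (K.survival t \<omega> * (k * indicator R (X t \<omega>))) * indicator {0..} t"
      proof (cases "0 \<le> t")
        case True
        have int: "set_integrable lborel {0..t} (visits R \<omega>)" "set_integrable lborel {0..t} (visits S \<omega>)"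
          by (auto intro!: set_integrable_bounded_Icc[where a = 0 and b = t and B = 1] simp: r.q_nonneg s.q_nonneg r.q_le s.q_le)
        have "K.killing t \<omega> = (LBINT u:{0..t}. k * visits R \<omega> u + l * visits S \<omega> u)"
          unfolding K.killing_def by (rule set_lebesgue_integral_cong) (auto simp: visits_def)
        also have "\<dots> = k * r.accum t + l * s.accum t"
          using int by (subst set_integral_add) (auto simp: r.accum_def s.accum_def)
        finally have kill: "K.killing t \<omega> = k * r.accum t + l * s.accum t" .
        have "(\<integral>\<^sup>+b. f t * indicator {b. s.accum t < b} b \<partial>exponential l) = f t * emeasure (exponential l) {b. s.accum t < b}"
          by (rule nn_integral_cmult_indicator) (simp add: sets_exponential)
        also have "\<dots> = ennreal (k * visits R \<omega> t * exp (- (k * r.accum t))) * ennreal (exp (- (l * s.accum t)))"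
          using True emeasure_exponential(1)[OF l s.accum_nonneg[OF True]] by (simp add: f_def)
        also have "\<dots> = ennreal (k * visits R \<omega> t * exp (- (k * r.accum t)) * exp (- (l * s.accum t)))"
          by (rule ennreal_mult[symmetric]) (use k r.q_nonneg[of t] in auto)
        also have "k * visits R \<omega> t * exp (- (k * r.accum t)) * exp (- (l * s.accum t)) = K.survival t \<omega> * (k * indicator R (X t \<omega>))"
          using True unfolding K.survival_def kill minus_add_distrib exp_add visits_def by (simp add: mult_ac)
        finally show ?thesis using True by simp
      qed (simp add: f_def)
    qed
    finally show "emeasure (exponential k \<Otimes>\<^sub>M exponential l) (Pair \<omega> -` A)
      = (\<integral>\<^sup>+t. ennreal (K.survival t \<omega> * (k * indicator R (X t \<omega>))) * indicator {0..} t \<partial>lborel)" .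
  qed
  also have "\<dots> = (\<integral>\<^sup>+t. ennreal (K.\<phi> (\<lambda>y. k * indicator R y) t) * indicator {0..} t \<partial>lborel)"
    by (rule K.nn_integral_\<phi>) (use k in simp)
  also have "\<dots> = ennreal (g x0)"
    by (rule K.\<phi>_total_integral(1)[OF g1' g']) (use k in auto)
  finally have em: "emeasure (M \<Otimes>\<^sub>M (exponential k \<Otimes>\<^sub>M exponential l)) A = ennreal (g x0)" .
  show g0: "0 \<le> g x0" by (rule K.\<phi>_total_integral(2)[OF g1' g']) (use k in auto)
  show eq: "measure (M \<Otimes>\<^sub>M (exponential k \<Otimes>\<^sub>M exponential l))
       {(\<omega>, a, b). \<omega> \<in> space M \<and> killing_time X R \<omega> a < killing_time X S \<omega> b} = g x0"
    using em g0 unfolding A_def[symmetric] measure_def by simp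
  show "g x0 \<le> 1" using MKL.P.prob_le_1[of A] unfolding eq[unfolded A_def[symmetric]] .
qed

end

section \<open>Reversible chains\<close>

locale reversible_chain =
  fixes E :: "'a set" and w :: "'a \<Rightarrow> 'a \<Rightarrow> real" and \<mu> :: "'a pmf"
  assumes reversible: "reversible_dynamics E w \<mu>"
begin

abbreviation m :: "'a \<Rightarrow> real" where "m x \<equiv> pmf \<mu> x"

lemma finite_E: "finite E" and support: "set_pmf \<mu> \<subseteq> E"
  and rates_nonneg: "\<And>x y. x \<in> E \<Longrightarrow> y \<in> E \<Longrightarrow> x \<noteq> y \<Longrightarrow> 0 \<le> w x y"
  and irreducible: "irreducible_on E w"
  and balance: "\<And>x y. x \<in> E \<Longrightarrow> y \<in> E \<Longrightarrow> m x * w x y = m y * w y x"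
  using reversible unfolding reversible_dynamics_def by auto

lemma irreducible_induct:
  assumes "x \<in> E" "y \<in> E" "Q x"
    and step: "\<And>u v. u \<in> E \<Longrightarrow> v \<in> E \<Longrightarrow> u \<noteq> v \<Longrightarrow> 0 < w u v \<Longrightarrow> Q u \<Longrightarrow> Q v"
  shows "Q y"
proof -
  have "(x, y) \<in> {(u, v). u \<in> E \<and> v \<in> E \<and> u \<noteq> v \<and> 0 < w u v}\<^sup>*"
    using irreducible assms(1,2) unfolding irreducible_on_def by blast
  then show ?thesis
  proof (induction rule: rtrancl_induct)
    case base
    then show ?case by (rule assms(3))
  next
    case (step y z)
    then show ?case using assms(4) by auto
  qed
qed

lemma sum_m: "(\<Sum>x\<in>E. m x) = 1"
  using sum_pmf_eq_1[OF finite_E support] .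

text \<open>
  By detailed balance positivity of the measure propagates along jumps, hence everywhere.
\<close>

lemma m_pos: 
  assumes "y \<in> E"
  shows "0 < m y"
proof -
  obtain x where x: "x \<in> set_pmf \<mu>" using set_pmf_not_empty by fast
  then have "x \<in> E" using support by auto
  have "0 < m y"
  proof (rule irreducible_induct[OF \<open>x \<in> E\<close> assms])
    show "0 < m x" using x by (simp add: pmf_positive)
    fix u v assume "u \<in> E" "v \<in> E" "u \<noteq> v" "0 < w u v" "0 < m u"
    then have "0 < m v * w v u" using balance[of u v] mult_pos_pos[of "m u" "w u v"] by simp
    then show "0 < m v" by (simp add: zero_less_mult_iff)
  qed
  then show ?thesis .
qed

lemma expectation_eq: "measure_pmf.expectation \<mu> f = (\<Sum>x\<in>E. m x * f x)"
  using integral_measure_pmf[OF finite_E, of \<mu> f] support by auto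

lemma measure_eq: "A \<subseteq> E \<Longrightarrow> measure \<mu> A = (\<Sum>x\<in>A. m x)"
  using finite_subset[OF _ finite_E] by (simp add: measure_measure_pmf_finite)

lemma measure_pos: "A \<subseteq> E \<Longrightarrow> A \<noteq> {} \<Longrightarrow> 0 < measure \<mu> A"
  using m_pos finite_subset[OF _ finite_E, of A] by (auto simp: measure_eq intro!: sum_pos)

lemma pmf_cond_eq:
  assumes "A \<subseteq> E" "A \<noteq> {}"
  shows "pmf (cond_pmf \<mu> A) x = (if x \<in> A then m x / measure \<mu> A else 0)"
proof -
  have "set_pmf \<mu> \<inter> A \<noteq> {}" using assms m_pos by (force simp: set_pmf_iff)
  then show ?thesis by (simp add: pmf_cond)
qed

lemma expectation_cond:
  assumes "A \<subseteq> E" "A \<noteq> {}"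
  shows "measure_pmf.expectation (cond_pmf \<mu> A) f = (\<Sum>x\<in>A. m x * f x) / measure \<mu> A"
proof -
  have "set_pmf \<mu> \<inter> A \<noteq> {}" using assms m_pos by (force simp: set_pmf_iff)
  then have "measure_pmf.expectation (cond_pmf \<mu> A) f = (\<Sum>x\<in>A. pmf (cond_pmf \<mu> A) x *\<^sub>R f x)"
    by (intro integral_measure_pmf) (use finite_subset[OF assms(1) finite_E] in auto)
  then show ?thesis using assms by (simp add: pmf_cond_eq sum_divide_distrib)
qed

abbreviation D :: "('a \<Rightarrow> real) \<Rightarrow> real" where "D f \<equiv> dirichlet_form E w \<mu> f"

text \<open>
  The bilinear form of which the Dirichlet form \<open>D\<close> is the diagonal.
\<close>

definition D2 :: "('a \<Rightarrow> real) \<Rightarrow> ('a \<Rightarrow> real) \<Rightarrow> real" where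
  "D2 f g = 1 / 2 * (\<Sum>x\<in>E. \<Sum>y\<in>E. m x * w x y * ((f x - f y) * (g x - g y)))"

lemma D2_self: "D2 f f = D f"
  by (simp add: D2_def dirichlet_form_def power2_eq_square)

lemma edge_nonneg: "x \<in> E \<Longrightarrow> y \<in> E \<Longrightarrow> 0 \<le> m x * w x y * (f x - f y)\<^sup>2"
  using rates_nonneg[of x y] by (cases "x = y") auto

lemma D_nonneg: "0 \<le> D f"
  unfolding dirichlet_form_def by (intro mult_nonneg_nonneg sum_nonneg edge_nonneg) auto

lemma generator_eq: "x \<in> E \<Longrightarrow> generator E w f x = (\<Sum>y\<in>E. w x y * (f y - f x))"
  unfolding generator_def using finite_E by (simp add: sum.remove)

lemma green: "(\<Sum>x\<in>E. m x * (g x * generator E w f x)) = - D2 f g"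
proof -
  have 1: "(\<Sum>x\<in>E. m x * (g x * generator E w f x)) = (\<Sum>x\<in>E. \<Sum>y\<in>E. m x * w x y * (g x * (f y - f x)))"
    by (intro sum.cong refl) (simp add: generator_eq sum_distrib_left mult_ac)
  have "(\<Sum>x\<in>E. \<Sum>y\<in>E. m x * w x y * (g x * (f y - f x))) = (\<Sum>y\<in>E. \<Sum>x\<in>E. m x * w x y * (g x * (f y - f x)))"
    by (rule sum.swap)
  also have "\<dots> = (\<Sum>x\<in>E. \<Sum>y\<in>E. m x * w x y * (g y * (f x - f y)))"
    by (intro sum.cong refl) (simp add: balance)
  finally have "2 * (\<Sum>x\<in>E. \<Sum>y\<in>E. m x * w x y * (g x * (f y - f x)))
      = (\<Sum>x\<in>E. \<Sum>y\<in>E. m x * w x y * (g x * (f y - f x))) + (\<Sum>x\<in>E. \<Sum>y\<in>E. m x * w x y * (g y * (f x - f y)))"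
    by simp
  also have "\<dots> = (\<Sum>x\<in>E. \<Sum>y\<in>E. - (m x * w x y * ((f x - f y) * (g x - g y))))"
    unfolding sum.distrib[symmetric] by (intro sum.cong refl) (simp add: algebra_simps)
  also have "\<dots> = - 2 * D2 f g" by (simp add: D2_def sum_negf)
  finally show ?thesis using 1 by simp
qed

lemma D2_const: "D2 f (\<lambda>_. a) = 0" by (simp add: D2_def)

lemma D2_commute: "D2 f g = D2 g f" by (simp add: D2_def mult.commute)

lemma D_add: "D (\<lambda>x. f x + g x) = D f + D g + 2 * D2 f g"
proof -
  have "D (\<lambda>x. f x + g x) = 1 / 2 * (\<Sum>x\<in>E. \<Sum>y\<in>E. m x * w x y * (f x - f y)\<^sup>2 + m x * w x y * (g x - g y)\<^sup>2
       + 2 * (m x * w x y * ((f x - f y) * (g x - g y))))"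
    unfolding dirichlet_form_def
    by (intro arg_cong2[where f = "(*)"] sum.cong refl) (simp add: power2_eq_square algebra_simps)
  then show ?thesis
    by (simp add: D2_def dirichlet_form_def sum.distrib sum_distrib_left[symmetric] distrib_left)
qed

lemma D_affine: "D (\<lambda>x. a * (f x - b)) = a\<^sup>2 * D f"
proof -
  have "m x * w x y * (a * (f x - b) - a * (f y - b))\<^sup>2 = a\<^sup>2 * (m x * w x y * (f x - f y)\<^sup>2)" for x y
    by (simp add: power2_eq_square algebra_simps)
  then have "D (\<lambda>x. a * (f x - b)) = 1 / 2 * (\<Sum>x\<in>E. \<Sum>y\<in>E. a\<^sup>2 * (m x * w x y * (f x - f y)\<^sup>2))"
    by (simp only: dirichlet_form_def)
  then show ?thesis by (simp add: dirichlet_form_def sum_distrib_left)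
qed

text \<open>
  Injectivity comes from Green's formula: a solution \<open>u\<close> of the homogeneous equation has
  \<open>D u + \<Sum> m c u\<^sup>2 = 0\<close>, so it is constant by irreducibility and vanishes where \<open>c\<close> is positive.
\<close>

lemma killed_equation_solvable:
  assumes c: "\<And>y. y \<in> E \<Longrightarrow> 0 \<le> c y" and z: "z \<in> E" "0 < c z"
  shows "\<exists>g. \<forall>y\<in>E. generator E w g y - c y * g y = h y"
proof -
  define a where "a x y = w x y - (if x = y then (\<Sum>v\<in>E. w x v) + c x else 0)" for x y
  have a: "(\<Sum>y\<in>E. a x y * u y) = generator E w u x - c x * u x" if "x \<in> E" for x u
  proof -
    have "(\<Sum>y\<in>E. a x y * u y) = (\<Sum>y\<in>E. w x y * u y) - (\<Sum>y\<in>E. if x = y then ((\<Sum>v\<in>E. w x v) + c x) * u x else 0)"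
      unfolding a_def left_diff_distrib sum_subtractf by (intro arg_cong2[where f = "(-)"] sum.cong) auto
    also have "\<dots> = (\<Sum>y\<in>E. w x y * u y) - ((\<Sum>v\<in>E. w x v) + c x) * u x"
      using finite_E that by simp
    also have "\<dots> = generator E w u x - c x * u x"
    proof -
      have "generator E w u x = (\<Sum>y\<in>E. w x y * u y) - (\<Sum>v\<in>E. w x v) * u x"
        unfolding generator_eq[OF that] by (simp only: right_diff_distrib sum_subtractf sum_distrib_right)
      then show ?thesis by (simp add: algebra_simps)
    qed
    finally show ?thesis .
  qed
  have "\<exists>u. \<forall>x\<in>E. (\<Sum>y\<in>E. a x y * u y) = h x"
  proof (rule injective_system_solvable[OF finite_E])
    fix u assume "\<And>x. x \<in> E \<Longrightarrow> (\<Sum>y\<in>E. a x y * u y) = 0"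
    then have u: "generator E w u x = c x * u x" if "x \<in> E" for x using a that by simp
    have "D u + (\<Sum>x\<in>E. m x * (c x * (u x)\<^sup>2)) = 0"
      using green[of u u] u by (simp add: D2_self power2_eq_square mult_ac)
    moreover have nn: "0 \<le> m x * (c x * (u x)\<^sup>2)" if "x \<in> E" for x using c that by simp
    moreover have "0 \<le> (\<Sum>x\<in>E. m x * (c x * (u x)\<^sup>2))" by (intro sum_nonneg nn)
    ultimately have D0: "D u = 0" and c0: "(\<Sum>x\<in>E. m x * (c x * (u x)\<^sup>2)) = 0"
      using D_nonneg[of u] by linarith+
    have "m z * (c z * (u z)\<^sup>2) = 0"
      using c0 nn z sum_nonneg_eq_0_iff[OF finite_E, of "\<lambda>x. m x * (c x * (u x)\<^sup>2)"] by auto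
    then have uz: "u z = 0" using m_pos[OF z(1)] z by auto
    show "\<forall>x\<in>E. u x = 0"
    proof
      fix x assume "x \<in> E"
      show "u x = 0"
      proof (rule irreducible_induct[where Q = "\<lambda>x. u x = 0", OF z(1) \<open>x \<in> E\<close> uz])
        fix v y assume vy: "v \<in> E" "y \<in> E" "v \<noteq> y" "0 < w v y" "u v = 0"
        have "(\<Sum>x\<in>E. \<Sum>y\<in>E. m x * w x y * (u x - u y)\<^sup>2) = 0" using D0 by (simp add: dirichlet_form_def)
        then have "(\<Sum>y\<in>E. m v * w v y * (u v - u y)\<^sup>2) = 0"
          by (rule sum_nonneg_0[OF finite_E _ _ vy(1), rotated]) (intro sum_nonneg edge_nonneg)
        then have "m v * w v y * (u v - u y)\<^sup>2 = 0"
          by (rule sum_nonneg_0[OF finite_E _ _ vy(2), rotated]) (intro edge_nonneg vy)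
        then show "u y = 0" using vy m_pos[of v] by auto
      qed
    qed
  qed
  then show ?thesis using a by auto
qed

text \<open>
  The mean with respect to the conditioned measure, and the variance multiplied by the measure of
  \<open>A\<close>, which is the form in which it is compared with the Dirichlet form of the whole space.
\<close>

definition avg :: "'a set \<Rightarrow> ('a \<Rightarrow> real) \<Rightarrow> real" where
  "avg A f = (\<Sum>x\<in>A. m x * f x) / measure \<mu> A"

definition var :: "'a set \<Rightarrow> ('a \<Rightarrow> real) \<Rightarrow> real" where
  "var A f = (\<Sum>x\<in>A. m x * (f x - avg A f)\<^sup>2)"

lemma var_nonneg: "0 \<le> var A f" unfolding var_def by (intro sum_nonneg) auto

lemma sum_square_decomposition:
  assumes "A \<subseteq> E" "A \<noteq> {}"
  shows "(\<Sum>x\<in>A. m x * (f x - c)\<^sup>2) = var A f + measure \<mu> A * (avg A f - c)\<^sup>2"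
proof -
  have pos: "0 < measure \<mu> A" by (rule measure_pos[OF assms])
  have 0: "(\<Sum>x\<in>A. m x * (f x - avg A f)) = 0"
  proof -
    have "(\<Sum>x\<in>A. m x * (f x - avg A f)) = (\<Sum>x\<in>A. m x * f x) - (\<Sum>x\<in>A. m x) * avg A f"
      by (simp only: right_diff_distrib sum_subtractf sum_distrib_right)
    then show ?thesis using pos by (simp add: avg_def measure_eq[OF assms(1)])
  qed
  have "m x * (f x - c)\<^sup>2 = m x * (f x - avg A f)\<^sup>2 + (m x * (avg A f - c)\<^sup>2 + 2 * (avg A f - c) * (m x * (f x - avg A f)))" for x
    by (simp add: power2_eq_square algebra_simps)
  then have "(\<Sum>x\<in>A. m x * (f x - c)\<^sup>2) = var A f + ((\<Sum>x\<in>A. m x) * (avg A f - c)\<^sup>2 + 2 * (avg A f - c) * (\<Sum>x\<in>A. m x * (f x - avg A f)))"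
    by (simp only: sum.distrib var_def sum_distrib_left[symmetric] sum_distrib_right[symmetric])
  then show ?thesis using 0 by (simp add: measure_eq[OF assms(1)])
qed

abbreviation Var :: "('a \<Rightarrow> real) \<Rightarrow> real" where "Var f \<equiv> measure_pmf.variance \<mu> f"

lemma variance_eq: "Var f = (\<Sum>x\<in>E. m x * (f x - measure_pmf.expectation \<mu> f)\<^sup>2)"
  by (simp add: expectation_eq)

lemma variance_le: "Var f \<le> (\<Sum>x\<in>E. m x * (f x - c)\<^sup>2)"
proof -
  have E: "E \<subseteq> E" "E \<noteq> {}" using irreducible by (auto simp: irreducible_on_def)
  have 1: "measure \<mu> E = 1" using measure_eq[of E] sum_m by simp
  have "Var f = var E f" by (simp add: variance_eq var_def avg_def 1 expectation_eq)
  then show ?thesis using sum_square_decomposition[OF E, of f c] 1 by simp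
qed

text \<open>
  The constant is the inverse gap, which is \<open>0\<close> when the gap is infinite. A finite constant requires
  the gap not to vanish.
\<close>

lemma poincare:
  assumes A: "A \<subseteq> E" "A \<noteq> {}" and gap: "0 < restricted_gap w \<mu> A"
  shows "var A f \<le> enn2real (1 / restricted_gap w \<mu> A) * D f"
proof -
  define r where "r = enn2real (1 / restricted_gap w \<mu> A)"
  have fin: "finite A" using A finite_E finite_subset by auto
  have pos: "0 < measure \<mu> A" by (rule measure_pos[OF A])
  have V: "measure_pmf.variance (cond_pmf \<mu> A) f = var A f / measure \<mu> A"
    by (simp add: expectation_cond[OF A] var_def avg_def)
  have dA: "dirichlet_form A w (cond_pmf \<mu> A) f \<le> D f / measure \<mu> A"
  proof -
    have "dirichlet_form A w (cond_pmf \<mu> A) f = 1 / 2 * (\<Sum>x\<in>A. \<Sum>y\<in>A. m x * w x y * (f x - f y)\<^sup>2) / measure \<mu> A"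
      unfolding dirichlet_form_def by (simp add: pmf_cond_eq[OF A] sum_divide_distrib mult.commute[of "measure \<mu> A" 2])
    also have "\<dots> \<le> 1 / 2 * (\<Sum>x\<in>E. \<Sum>y\<in>E. m x * w x y * (f x - f y)\<^sup>2) / measure \<mu> A"
    proof (intro divide_right_mono mult_left_mono)
      have "(\<Sum>x\<in>A. \<Sum>y\<in>A. m x * w x y * (f x - f y)\<^sup>2) \<le> (\<Sum>x\<in>A. \<Sum>y\<in>E. m x * w x y * (f x - f y)\<^sup>2)"
        by (intro sum_mono sum_mono2) (use A finite_E edge_nonneg in auto)
      also have "\<dots> \<le> (\<Sum>x\<in>E. \<Sum>y\<in>E. m x * w x y * (f x - f y)\<^sup>2)"
        by (intro sum_mono2) (use A finite_E edge_nonneg in \<open>auto intro!: sum_nonneg\<close>)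
      finally show "(\<Sum>x\<in>A. \<Sum>y\<in>A. m x * w x y * (f x - f y)\<^sup>2) \<le> (\<Sum>x\<in>E. \<Sum>y\<in>E. m x * w x y * (f x - f y)\<^sup>2)" .
    qed (use pos in auto)
    finally show ?thesis by (simp add: dirichlet_form_def)
  qed
  show ?thesis
  proof (cases "var A f = 0")
    case True
    then show ?thesis using D_nonneg by simp
  next
    case False
    then have v: "0 < var A f" using var_nonneg[of A f] by simp
    define q where "q = dirichlet_form A w (cond_pmf \<mu> A) f / (var A f / measure \<mu> A)"
    have le: "restricted_gap w \<mu> A \<le> ennreal q"
      unfolding restricted_gap_def spectral_gap_def q_def V[symmetric]
      by (rule INF_lower) (use v pos V in auto)
    then obtain g where g: "restricted_gap w \<mu> A = ennreal g" "0 < g"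
      using gap by (cases "restricted_gap w \<mu> A") (auto simp: top_unique)
    have "q > 0" using le gap by (metis ennreal_neg le_zero_eq less_irrefl linorder_not_less less_le)
    then have gq: "g \<le> q" using le g by (simp add: ennreal_le_iff)
    have r: "r = 1 / g"
      using g by (simp add: r_def divide_ennreal ennreal_1[symmetric] del: ennreal_1)
    have "q = measure \<mu> A * dirichlet_form A w (cond_pmf \<mu> A) f / var A f"
      using v pos by (simp add: q_def)
    also have "\<dots> \<le> D f / var A f"
      using dA v pos by (intro divide_right_mono) (auto simp: pos_le_divide_eq mult.commute)
    finally have "g \<le> D f / var A f" using gq by simp
    then have "g * var A f \<le> D f" using v by (simp add: pos_le_divide_eq)
    then show ?thesis using g(2) unfolding r_def[symmetric] r by (simp add: pos_le_divide_eq mult.commute)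
  qed
qed

end

section \<open>Soft capacity, spectral gap and mean killing time\<close>

text \<open>
  \<open>V\<close> stands for the hitting probability and \<open>T\<close> for the mean killing time, which are used only through
  the linear equations that they solve and through the bounds \<open>0 \<le> V \<le> 1\<close> and \<open>0 \<le> T\<close>.
\<close>

locale soft_killing = reversible_chain E w \<mu> for E :: "'a set" and w \<mu> +
  fixes R S :: "'a set" and \<kappa> l :: real and V T :: "'a \<Rightarrow> real"
  assumes E_eq: "E = R \<union> S" and R_diff: "R - S \<noteq> {}" and S_diff: "S - R \<noteq> {}"
    and \<kappa>_pos: "0 < \<kappa>" and l_pos: "0 < l"
    and V_eq: "\<And>y. y \<in> E \<Longrightarrow> generator E w V y - (\<kappa> * indicator R y + l * indicator S y) * V y = - (\<kappa> * indicator R y)"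
    and V_nonneg: "\<And>y. y \<in> E \<Longrightarrow> 0 \<le> V y" and V_le_1: "\<And>y. y \<in> E \<Longrightarrow> V y \<le> 1"
    and T_eq: "\<And>y. y \<in> E \<Longrightarrow> generator E w T y - l * indicator S y * T y = - 1"
    and T_nonneg: "\<And>y. y \<in> E \<Longrightarrow> 0 \<le> T y"
begin

lemma R_sub: "R \<subseteq> E" "R \<noteq> {}" and S_sub: "S \<subseteq> E" "S \<noteq> {}" using E_eq R_diff S_diff by auto

lemma finite_RS: "finite R" "finite S"
  using R_sub S_sub finite_E finite_subset by auto

lemma sum_cover: "(\<Sum>x\<in>E. h x) + (\<Sum>x\<in>R \<inter> S. h x) = (\<Sum>x\<in>R. h x) + (\<Sum>x\<in>S. h x :: real)"
  unfolding E_eq by (rule sum.union_inter[OF finite_RS])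

lemma sum_cover_le:
  assumes "\<And>x. x \<in> E \<Longrightarrow> 0 \<le> h x"
  shows "(\<Sum>x\<in>E. h x) \<le> (\<Sum>x\<in>R. h x) + (\<Sum>x\<in>S. h x :: real)"
  using sum_cover[of h] sum_nonneg[of "R \<inter> S" h] assms R_sub by fastforce

text \<open>
  Unnormalized integrals over \<open>R\<close> and \<open>S\<close>.
\<close>

definition sR :: "('a \<Rightarrow> real) \<Rightarrow> real" where "sR h = (\<Sum>x\<in>R. m x * h x)"
definition sS :: "('a \<Rightarrow> real) \<Rightarrow> real" where "sS h = (\<Sum>x\<in>S. m x * h x)"

abbreviation mR :: real where "mR \<equiv> measure \<mu> R"
abbreviation mS :: real where "mS \<equiv> measure \<mu> S"

lemma mR_pos: "0 < mR" and mS_pos: "0 < mS"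
  using measure_pos R_sub S_sub by auto

lemma measure_cover: "1 \<le> mR + mS"
  using sum_cover_le[of m] sum_m by (simp add: measure_eq R_sub S_sub)

lemma sum_indicator: "A \<subseteq> E \<Longrightarrow> (\<Sum>x\<in>E. m x * (indicator A x * h x)) = (\<Sum>x\<in>A. m x * h x)"
proof -
  assume A: "A \<subseteq> E"
  have "(\<Sum>x\<in>E. m x * (indicator A x * h x)) = (\<Sum>x\<in>E. if x \<in> A then m x * h x else 0)"
    by (intro sum.cong) (auto simp: indicator_def)
  then show ?thesis using A finite_E by (simp add: sum.inter_restrict[symmetric] Int_absorb1)
qed

text \<open>
  The two equations in weak form, tested against an arbitrary function \<open>u\<close>.
\<close>

lemma weak_V: "D2 V u + \<kappa> * sR (\<lambda>x. (V x - 1) * u x) + l * sS (\<lambda>x. V x * u x) = 0"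
proof -
  have "- D2 V u = (\<Sum>x\<in>E. m x * (u x * generator E w V x))" by (rule green[symmetric])
  also have "\<dots> = (\<Sum>x\<in>E. \<kappa> * (m x * (indicator R x * ((V x - 1) * u x))) + l * (m x * (indicator S x * (V x * u x))))"
  proof (rule sum.cong[OF refl])
    fix x assume "x \<in> E"
    then have g: "generator E w V x = (\<kappa> * indicator R x + l * indicator S x) * V x - \<kappa> * indicator R x"
      using V_eq[of x] by simp
    show "m x * (u x * generator E w V x) = \<kappa> * (m x * (indicator R x * ((V x - 1) * u x))) + l * (m x * (indicator S x * (V x * u x)))"
      unfolding g by (simp add: algebra_simps)
  qed
  also have "\<dots> = \<kappa> * sR (\<lambda>x. (V x - 1) * u x) + l * sS (\<lambda>x. V x * u x)"
    by (simp add: sum.distrib sum_distrib_left[symmetric] sum_indicator R_sub S_sub sR_def sS_def)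
  finally show ?thesis by simp
qed

lemma weak_T: "D2 T u + l * sS (\<lambda>x. T x * u x) = (\<Sum>x\<in>E. m x * u x)"
proof -
  have "- D2 T u = (\<Sum>x\<in>E. m x * (u x * generator E w T x))" by (rule green[symmetric])
  also have "\<dots> = (\<Sum>x\<in>E. l * (m x * (indicator S x * (T x * u x))) - m x * u x)"
  proof (rule sum.cong[OF refl])
    fix x assume "x \<in> E"
    then have g: "generator E w T x = l * indicator S x * T x - 1"
      using T_eq[of x] by simp
    show "m x * (u x * generator E w T x) = l * (m x * (indicator S x * (T x * u x))) - m x * u x"
      unfolding g by (simp add: algebra_simps)
  qed
  also have "\<dots> = l * sS (\<lambda>x. T x * u x) - (\<Sum>x\<in>E. m x * u x)"
    by (simp add: sum_subtractf sum_distrib_left[symmetric] sum_indicator S_sub sS_def)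
  finally show ?thesis by simp
qed

text \<open>
  The functional that is minimized by \<open>V\<close>, with minimum the soft capacity \<open>C\<close>.
\<close>

definition energy :: "('a \<Rightarrow> real) \<Rightarrow> real" where
  "energy f = D f + \<kappa> * sR (\<lambda>x. (f x - 1)\<^sup>2) + l * sS (\<lambda>x. (f x)\<^sup>2)"

definition C :: real where "C = energy V"

lemma s_nonneg: "(\<And>x. x \<in> E \<Longrightarrow> 0 \<le> h x) \<Longrightarrow> 0 \<le> sR h" "(\<And>x. x \<in> E \<Longrightarrow> 0 \<le> h x) \<Longrightarrow> 0 \<le> sS h"
  unfolding sR_def sS_def using E_eq by (auto intro!: sum_nonneg)

lemma s_linear: "sR (\<lambda>x. f x + g x) = sR f + sR g" "sS (\<lambda>x. f x + g x) = sS f + sS g"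
  "sR (\<lambda>x. f x - g x) = sR f - sR g" "sS (\<lambda>x. f x - g x) = sS f - sS g"
  "sR (\<lambda>x. a * f x) = a * sR f" "sS (\<lambda>x. a * f x) = a * sS f"
  "sR (\<lambda>x. a) = a * mR" "sS (\<lambda>x. a) = a * mS"
  by (simp_all add: sR_def sS_def sum.distrib distrib_left right_diff_distrib sum_subtractf sum_distrib_left mult_ac
      measure_eq R_sub S_sub)

lemma energy_minimal: "C \<le> energy f"
proof -
  define u where "u x = f x - V x" for x
  have f: "f = (\<lambda>x. V x + u x)" by (auto simp: u_def)
  have R: "sR (\<lambda>x. (V x + u x - 1)\<^sup>2) = sR (\<lambda>x. (V x - 1)\<^sup>2) + (sR (\<lambda>x. (u x)\<^sup>2) + 2 * sR (\<lambda>x. (V x - 1) * u x))"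
    unfolding s_linear(1)[symmetric] s_linear(5)[symmetric] by (rule arg_cong[where f = sR]) (auto simp: power2_eq_square algebra_simps)
  have S: "sS (\<lambda>x. (V x + u x)\<^sup>2) = sS (\<lambda>x. (V x)\<^sup>2) + (sS (\<lambda>x. (u x)\<^sup>2) + 2 * sS (\<lambda>x. V x * u x))"
    unfolding s_linear(2)[symmetric] s_linear(6)[symmetric] by (rule arg_cong[where f = sS]) (auto simp: power2_eq_square algebra_simps)
  have "energy f = C + (D u + \<kappa> * sR (\<lambda>x. (u x)\<^sup>2) + l * sS (\<lambda>x. (u x)\<^sup>2))
     + 2 * (D2 V u + \<kappa> * sR (\<lambda>x. (V x - 1) * u x) + l * sS (\<lambda>x. V x * u x))"
    unfolding C_def energy_def f D_add R S by (simp add: algebra_simps)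
  moreover have "0 \<le> D u" "0 \<le> \<kappa> * sR (\<lambda>x. (u x)\<^sup>2)" "0 \<le> l * sS (\<lambda>x. (u x)\<^sup>2)"
    using D_nonneg \<kappa>_pos l_pos by (auto intro!: mult_nonneg_nonneg s_nonneg)
  ultimately show ?thesis using weak_V[of u] by simp
qed

text \<open>
  The capacity is also the flux entering through \<open>R\<close>, and the flux leaving through \<open>S\<close>.
\<close>

lemma C_flux_R: "C = \<kappa> * sR (\<lambda>x. 1 - V x)"
proof -
  have "sR (\<lambda>x. (V x - 1)\<^sup>2) = sR (\<lambda>x. 1 - V x) + sR (\<lambda>x. (V x - 1) * V x)"
    unfolding s_linear(1)[symmetric] by (rule arg_cong[where f = sR]) (auto simp: power2_eq_square algebra_simps)
  then show ?thesis using weak_V[of V] by (simp add: C_def energy_def D2_self power2_eq_square algebra_simps)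
qed

lemma C_flux_S: "C = l * sS V"
proof -
  have "\<kappa> * sR (\<lambda>x. (V x - 1) * 1) + l * sS (\<lambda>x. V x * 1) = 0" using weak_V[of "\<lambda>_. 1"] by (simp add: D2_const)
  moreover have "sR (\<lambda>x. (V x - 1) * 1) = - sR (\<lambda>x. 1 - V x)" using s_linear(3)[of V "\<lambda>_. 1"] s_linear(3)[of "\<lambda>_. 1" V] by simp
  ultimately show ?thesis using C_flux_R by simp
qed

lemma soft_capacity_eq:
  assumes "\<And>y. y \<in> E \<Longrightarrow> hitting_prob P X \<kappa> l R S y = V y"
  shows "soft_capacity E w \<mu> P X \<kappa> l R S = C"
proof -
  have h: "hitting_prob P X \<kappa> l R S y = V y" if "y \<in> R \<or> y \<in> S" for y using assms that E_eq by auto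
  have "dirichlet_form E w \<mu> (hitting_prob P X \<kappa> l R S) = D V"
    unfolding dirichlet_form_def using assms by simp
  then show ?thesis
    using mR_pos mS_pos
    by (simp add: soft_capacity_def Let_def C_def energy_def sR_def sS_def expectation_cond[OF R_sub] expectation_cond[OF S_sub] h)
qed

text \<open>
  Duality between \<open>V\<close> and \<open>T\<close>: testing the equation of each against the other and using the symmetry of
  the Dirichlet form. Divided by \<open>C\<close> it says that \<open>T\<close> has mean \<open>\<Sum> m V / C\<close> under the law proportional to
  \<open>m (1 - V)\<close> on \<open>R\<close>.
\<close>

lemma duality: "\<kappa> * sR (\<lambda>x. (1 - V x) * T x) = (\<Sum>x\<in>E. m x * V x)"
proof -
  have "sR (\<lambda>x. (1 - V x) * T x) = - sR (\<lambda>x. (V x - 1) * T x)"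
    using s_linear(5)[of "-1" "\<lambda>x. (V x - 1) * T x"] by (simp add: algebra_simps)
  moreover have "sS (\<lambda>x. V x * T x) = sS (\<lambda>x. T x * V x)" by (simp add: mult.commute)
  ultimately show ?thesis using weak_V[of T] weak_T[of V] D2_commute[of V T] by simp
qed

lemma C_nonneg: "0 \<le> C" unfolding C_flux_S using l_pos V_nonneg by (intro mult_nonneg_nonneg s_nonneg) auto

text \<open>
  If \<open>C\<close> vanished then \<open>V = 1\<close> on \<open>R\<close>, and \<open>V = 0\<close> everywhere by duality.
\<close>

lemma C_pos: "0 < C"
proof (rule ccontr)
  assume "\<not> 0 < C"
  then have "sR (\<lambda>x. 1 - V x) = 0" using C_nonneg C_flux_R \<kappa>_pos by auto
  then have "m x * (1 - V x) = 0" if "x \<in> R" for x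
    unfolding sR_def using that R_sub finite_subset[OF R_sub(1) finite_E] V_le_1
    by (subst (asm) sum_nonneg_eq_0_iff) auto
  then have 1: "V x = 1" if "x \<in> R" for x using that m_pos R_sub by force
  then have "sR (\<lambda>x. (1 - V x) * T x) = 0" by (simp add: sR_def)
  then have 0: "(\<Sum>x\<in>E. m x * V x) = 0" using duality by simp
  obtain x where x: "x \<in> R" using R_sub by auto
  then have "m x * V x = 0"
    using 0 sum_nonneg_eq_0_iff[OF finite_E, of "\<lambda>x. m x * V x"] V_nonneg R_sub by auto
  then show False using 1[OF x] m_pos[of x] x R_sub by auto
qed

text \<open>
  A function \<open>f\<close> supported in \<open>R - S\<close> and divided by its mean \<open>a\<close> over \<open>R\<close> is a test function for the capacity; the
  Poincare inequality in \<open>R\<close> bounds both the killing term and the difference between \<open>\<mu>(f\<^sup>2)\<close> and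
  \<open>mR * a\<^sup>2\<close>. The form of the bound avoids a hypothesis that the quotient times \<open>r\<close> be small.
\<close>

lemma capacity_le_exit_rate:
  assumes r: "\<And>f. var R f \<le> r * D f" "0 \<le> r"
  shows "ennreal (C / (C * r + mR * (1 + \<kappa> * r))) \<le> exit_rate E w \<mu> (R - S)"
  unfolding exit_rate_def
proof (rule INF_greatest)
  fix f :: "'a \<Rightarrow> real" assume "f \<in> {f. (\<exists>x\<in>E. f x \<noteq> 0) \<and> (\<forall>x\<in>E - (R - S). f x = 0)}"
  then have f: "\<exists>x\<in>E. f x \<noteq> 0" "\<And>x. x \<in> S \<Longrightarrow> f x = 0" using E_eq by auto
  define n where "n = (\<Sum>x\<in>E. m x * (f x)\<^sup>2)"
  have n: "0 < n"
    unfolding n_def using f(1) m_pos by (auto intro!: sum_pos2[OF finite_E])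
  define a where "a = avg R f"
  have nR: "n = sR (\<lambda>x. (f x)\<^sup>2)"
  proof -
    have "n = (\<Sum>x\<in>R. m x * (f x)\<^sup>2)"
      unfolding n_def by (rule sum.mono_neutral_right[OF finite_E R_sub(1)]) (use f(2) E_eq in auto)
    then show ?thesis by (simp add: sR_def)
  qed
  have dec: "n = var R f + mR * a\<^sup>2"
    using sum_square_decomposition[OF R_sub, of f 0] by (simp add: nR sR_def a_def)
  have cap: "C * a\<^sup>2 \<le> D f * (1 + \<kappa> * r)"
  proof (cases "a = 0")
    case True
    then show ?thesis using D_nonneg r(2) \<kappa>_pos by simp
  next
    case False
    define g where "g x = (1 / a) * (f x - 0)" for x
    have Dg: "D g = (1 / a)\<^sup>2 * D f" unfolding g_def by (rule D_affine)
    have "sS (\<lambda>x. (g x)\<^sup>2) = 0" unfolding sS_def g_def using f(2) by simp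
    moreover have "sR (\<lambda>x. (g x - 1)\<^sup>2) = (1 / a)\<^sup>2 * var R f"
    proof -
      have "(g x - 1)\<^sup>2 = (1 / a)\<^sup>2 * (f x - a)\<^sup>2" for x
        unfolding power_mult_distrib[symmetric] using False by (simp add: g_def diff_divide_distrib)
      then show ?thesis unfolding sR_def var_def a_def[symmetric] by (simp add: sum_distrib_left mult_ac)
    qed
    ultimately have "C \<le> (1 / a)\<^sup>2 * (D f + \<kappa> * var R f)"
      using energy_minimal[of g] by (simp add: energy_def Dg algebra_simps)
    also have "\<dots> \<le> (1 / a)\<^sup>2 * (D f + \<kappa> * (r * D f))"
      using r(1)[of f] \<kappa>_pos by (intro mult_left_mono add_left_mono) auto
    finally have "a\<^sup>2 * C \<le> a\<^sup>2 * ((1 / a)\<^sup>2 * (D f + \<kappa> * (r * D f)))" by (intro mult_left_mono) auto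
    also have "\<dots> = D f + \<kappa> * (r * D f)" using False by (simp add: power_divide)
    finally show ?thesis by (simp add: algebra_simps)
  qed
  have "C * n = C * var R f + mR * (C * a\<^sup>2)" by (simp add: dec algebra_simps)
  also have "\<dots> \<le> C * (r * D f) + mR * (D f * (1 + \<kappa> * r))"
    using r(1)[of f] cap C_pos mR_pos by (intro add_mono mult_left_mono) auto
  also have "\<dots> = D f * (C * r + mR * (1 + \<kappa> * r))" by (simp add: algebra_simps)
  finally have "C * n \<le> D f * (C * r + mR * (1 + \<kappa> * r))" .
  moreover have "0 < C * r + mR * (1 + \<kappa> * r)"
    using C_pos mR_pos \<kappa>_pos r(2) by (intro add_nonneg_pos mult_pos_pos mult_nonneg_nonneg add_pos_nonneg) auto
  ultimately have "C / (C * r + mR * (1 + \<kappa> * r)) \<le> D f / n"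
    using n by (simp only: pos_divide_le_eq pos_le_divide_eq times_divide_eq_left)
  then show "ennreal (C / (C * r + mR * (1 + \<kappa> * r))) \<le> ennreal (D f / measure_pmf.expectation \<mu> (\<lambda>x. (f x)\<^sup>2))"
    unfolding expectation_eq n_def[symmetric] by (rule ennreal_leI)
qed

text \<open>
  A function is nearly constant on \<open>R\<close> and on \<open>S\<close> by the Poincare inequalities, and the difference \<open>a - b\<close> of its two
  means is controlled by the capacity through the test function \<open>(f - b) / (a - b)\<close>. The overlap of
  \<open>R\<close> and \<open>S\<close> only helps, since \<open>mR + mS\<close> is at least \<open>1\<close>.
\<close>

lemma variance_le_capacity:
  assumes r: "\<And>f. var R f \<le> r * D f" "0 \<le> r" and s: "\<And>f. var S f \<le> s * D f" "0 \<le> s"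
  shows "Var f \<le> (r + s + (1 + \<kappa> * r + l * s) * (mR * mS / C)) * D f"
proof -
  define a where "a = avg R f"
  define b where "b = avg S f"
  \<comment> \<open>The value of \<open>c\<close> that minimizes \<open>mR * (a - c)\<^sup>2 + mS * (b - c)\<^sup>2\<close>.\<close>
  define c where "c = (mR * a + mS * b) / (mR + mS)"
  note one = measure_cover
  have "Var f \<le> (\<Sum>x\<in>E. m x * (f x - c)\<^sup>2)" by (rule variance_le)
  also have "\<dots> \<le> (\<Sum>x\<in>R. m x * (f x - c)\<^sup>2) + (\<Sum>x\<in>S. m x * (f x - c)\<^sup>2)"
    by (rule sum_cover_le) simp
  also have "\<dots> = var R f + var S f + (mR * (a - c)\<^sup>2 + mS * (b - c)\<^sup>2)"
    by (simp add: sum_square_decomposition[OF R_sub] sum_square_decomposition[OF S_sub] a_def b_def)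
  also have "mR * (a - c)\<^sup>2 + mS * (b - c)\<^sup>2 = mR * mS * (a - b)\<^sup>2 / (mR + mS)"
  proof -
    have "a - c = mS * (a - b) / (mR + mS)" "b - c = mR * (b - a) / (mR + mS)"
      using one unfolding c_def by (simp_all add: field_simps)
    then have "mR * (a - c)\<^sup>2 + mS * (b - c)\<^sup>2 = (mR * (mS * (a - b))\<^sup>2 + mS * (mR * (b - a))\<^sup>2) / (mR + mS)\<^sup>2"
      by (simp add: power_divide add_divide_distrib)
    also have "mR * (mS * (a - b))\<^sup>2 + mS * (mR * (b - a))\<^sup>2 = mR * mS * (a - b)\<^sup>2 * (mR + mS)"
      by (simp add: power2_eq_square algebra_simps)
    finally show ?thesis using one by (simp add: power2_eq_square)
  qed
  also have "mR * mS * (a - b)\<^sup>2 / (mR + mS) \<le> mR * mS * (a - b)\<^sup>2"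
    using one mR_pos mS_pos mult_left_mono[OF one, of "mR * mS * (a - b)\<^sup>2"] by (simp add: pos_divide_le_eq)
  also have "mR * mS * (a - b)\<^sup>2 \<le> mR * mS / C * ((1 + \<kappa> * r + l * s) * D f)"
  proof -
    have "C * (a - b)\<^sup>2 \<le> (1 + \<kappa> * r + l * s) * D f"
    proof (cases "a = b")
      case True
      then show ?thesis using D_nonneg r(2) s(2) \<kappa>_pos l_pos by simp
    next
      case False
      define d where "d = a - b"
      have d: "d \<noteq> 0" using False by (simp add: d_def)
      define g where "g x = (1 / d) * (f x - b)" for x
      have Dg: "D g = (1 / d)\<^sup>2 * D f" unfolding g_def by (rule D_affine)
      have "sS (\<lambda>x. (g x)\<^sup>2) = (1 / d)\<^sup>2 * var S f"
        unfolding sS_def var_def b_def[symmetric] g_def power_mult_distrib by (simp add: sum_distrib_left mult_ac)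
      moreover have "sR (\<lambda>x. (g x - 1)\<^sup>2) = (1 / d)\<^sup>2 * var R f"
      proof -
        have "(g x - 1)\<^sup>2 = (1 / d)\<^sup>2 * (f x - a)\<^sup>2" for x
          unfolding power_mult_distrib[symmetric] g_def using d
          by (intro arg_cong[where f = "\<lambda>x. x\<^sup>2"]) (simp add: field_simps d_def)
        then show ?thesis unfolding sR_def var_def a_def[symmetric] by (simp add: sum_distrib_left mult_ac)
      qed
      ultimately have "C \<le> (1 / d)\<^sup>2 * (D f + \<kappa> * var R f + l * var S f)"
        using energy_minimal[of g] by (simp add: energy_def Dg algebra_simps)
      also have "\<dots> \<le> (1 / d)\<^sup>2 * (D f + \<kappa> * (r * D f) + l * (s * D f))"
        using r(1)[of f] s(1)[of f] \<kappa>_pos l_pos by (intro mult_left_mono add_mono) auto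
      finally have "d\<^sup>2 * C \<le> d\<^sup>2 * ((1 / d)\<^sup>2 * (D f + \<kappa> * (r * D f) + l * (s * D f)))" by (intro mult_left_mono) auto
      also have "\<dots> = D f + \<kappa> * (r * D f) + l * (s * D f)" using d by (simp add: power_divide)
      finally show ?thesis unfolding d_def[symmetric] by (simp add: algebra_simps)
    qed
    then have "mR * mS / C * (C * (a - b)\<^sup>2) \<le> mR * mS / C * ((1 + \<kappa> * r + l * s) * D f)"
      using C_pos mR_pos mS_pos by (intro mult_left_mono) auto
    then show ?thesis using C_pos by simp
  qed
  finally have "Var f \<le> r * D f + s * D f + mR * mS / C * ((1 + \<kappa> * r + l * s) * D f)"
    using r(1)[of f] s(1)[of f] by linarith
  moreover have "r * d + s * d + a * (k * d) = (r + s + k * a) * d" for a k d :: real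
    by (simp add: algebra_simps)
  ultimately show ?thesis by (simp only:)
qed

text \<open>
  The relative error with which \<open>V\<close> is the indicator function of \<open>R\<close>: it is the \<open>m\<close>-integral of \<open>1 - V\<close> over
  \<open>R\<close> plus that of \<open>V\<close> over \<open>S\<close>, divided by \<open>mR\<close>.
\<close>

definition \<eta> :: real where "\<eta> = C / (\<kappa> * mR) + C / (l * mR)"

lemma \<eta>_nonneg: "0 \<le> \<eta>" unfolding \<eta>_def using C_pos \<kappa>_pos l_pos mR_pos by simp

lemma sR_V: "sR V = mR - C / \<kappa>"
  using C_flux_R s_linear(3)[of "\<lambda>_. 1" V] s_linear(7)[of 1] \<kappa>_pos by (simp add: field_simps)

lemma sS_V: "sS V = C / l"
  using C_flux_S l_pos by simp

lemma \<eta>_mR: "\<eta> * mR = C / \<kappa> + C / l"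
  using mR_pos \<kappa>_pos l_pos by (simp add: \<eta>_def field_simps)

text \<open>
  On the overlap \<open>V\<close> cannot be close to both \<open>1\<close> and \<open>0\<close>.
\<close>

lemma overlap_le: "measure \<mu> (R \<inter> S) \<le> \<eta> * mR"
proof -
  have sub: "R \<inter> S \<subseteq> E" using R_sub by auto
  have "measure \<mu> (R \<inter> S) = (\<Sum>x\<in>R \<inter> S. m x * (1 - V x)) + (\<Sum>x\<in>R \<inter> S. m x * V x)"
    by (simp add: measure_eq[OF sub] sum.distrib[symmetric] algebra_simps)
  also have "\<dots> \<le> sR (\<lambda>x. 1 - V x) + sS V"
    unfolding sR_def sS_def using R_sub S_sub V_nonneg V_le_1 finite_RS by (intro add_mono sum_mono2) auto
  also have "\<dots> = \<eta> * mR"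
    using C_flux_R \<kappa>_pos by (simp add: \<eta>_mR sS_V)
  finally show ?thesis .
qed

lemma EV_bounds: "mR * (1 - \<eta>) \<le> (\<Sum>x\<in>E. m x * V x)" "(\<Sum>x\<in>E. m x * V x) \<le> mR * (1 + \<eta>)"
proof -
  have nn: "0 \<le> m x * V x" if "x \<in> E" for x using V_nonneg that by simp
  have Ck: "0 \<le> C / l" "0 \<le> C / \<kappa>" using C_pos l_pos \<kappa>_pos by auto
  have "mR * (1 - \<eta>) = mR - (C / \<kappa> + C / l)" using \<eta>_mR by (simp add: algebra_simps)
  also have "\<dots> \<le> sR V" using Ck by (simp add: sR_V)
  also have "\<dots> \<le> (\<Sum>x\<in>E. m x * V x)" unfolding sR_def by (intro sum_mono2 finite_E R_sub nn) auto
  finally show "mR * (1 - \<eta>) \<le> (\<Sum>x\<in>E. m x * V x)" .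
  have "(\<Sum>x\<in>E. m x * V x) + (\<Sum>x\<in>R \<inter> S. m x * V x) = sR V + sS V"
    unfolding sR_def sS_def by (rule sum_cover)
  moreover have "0 \<le> (\<Sum>x\<in>R \<inter> S. m x * V x)" using R_sub nn by (intro sum_nonneg) auto
  ultimately have "(\<Sum>x\<in>E. m x * V x) \<le> mR - C / \<kappa> + C / l" by (simp add: sR_V sS_V)
  also have "\<dots> \<le> mR + (C / \<kappa> + C / l)" using Ck by simp
  also have "\<dots> = mR * (1 + \<eta>)" using \<eta>_mR by (simp add: algebra_simps)
  finally show "(\<Sum>x\<in>E. m x * V x) \<le> mR * (1 + \<eta>)" .
qed

text \<open>
  The variance of \<open>V\<close> is nearly \<open>mR - mR\<^sup>2\<close>, and \<open>1 - mR\<close> is nearly \<open>mS\<close>, which is at least \<open>1 / 2\<close>. The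
  constant \<open>16\<close> is not optimized.
\<close>

lemma variance_V_ge:
  assumes "\<eta> \<le> 1" "mR \<le> mS"
  shows "mR * mS * (1 - 16 * \<eta>) \<le> Var V"
proof -
  let ?e = "\<Sum>x\<in>E. m x * V x"
  have "Var V = (\<Sum>x\<in>E. m x * (V x)\<^sup>2) - ?e\<^sup>2"
  proof -
    have "Var V = (\<Sum>x\<in>E. m x * (V x)\<^sup>2 - 2 * ?e * (m x * V x) + m x * ?e\<^sup>2)"
      unfolding variance_eq expectation_eq by (intro sum.cong refl) (simp add: power2_eq_square algebra_simps)
    also have "\<dots> = (\<Sum>x\<in>E. m x * (V x)\<^sup>2) - 2 * ?e * ?e + ?e\<^sup>2"
      by (simp only: sum.distrib sum_subtractf sum_distrib_left[symmetric] sum_distrib_right[symmetric] sum_m mult_1)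
    finally show ?thesis by (simp add: power2_eq_square)
  qed
  moreover have "mR * (1 - \<eta>)\<^sup>2 \<le> (\<Sum>x\<in>E. m x * (V x)\<^sup>2)"
  proof -
    have "1 - \<eta> \<le> avg R V"
    proof -
      have "mR * (1 - \<eta>) = mR - (C / \<kappa> + C / l)" using \<eta>_mR by (simp add: algebra_simps)
      also have "\<dots> \<le> sR V" using C_pos l_pos by (simp add: sR_V)
      finally show ?thesis using mR_pos by (simp add: avg_def sR_def pos_le_divide_eq mult.commute)
    qed
    then have "(1 - \<eta>)\<^sup>2 \<le> (avg R V)\<^sup>2" using assms by (intro power_mono) auto
    then have "mR * (1 - \<eta>)\<^sup>2 \<le> mR * (avg R V)\<^sup>2" using mR_pos by simp
    also have "\<dots> \<le> (\<Sum>x\<in>R. m x * (V x)\<^sup>2)"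
      using sum_square_decomposition[OF R_sub, of V 0] var_nonneg[of R V] by simp
    also have "\<dots> \<le> (\<Sum>x\<in>E. m x * (V x)\<^sup>2)" using R_sub finite_E by (intro sum_mono2) auto
    finally show ?thesis .
  qed
  moreover have "?e\<^sup>2 \<le> (mR * (1 + \<eta>))\<^sup>2"
    using EV_bounds(2) V_nonneg by (intro power_mono sum_nonneg) auto
  ultimately have 1: "mR * ((1 - \<eta>)\<^sup>2 - mR * (1 + \<eta>)\<^sup>2) \<le> Var V"
    by (simp add: power2_eq_square algebra_simps)
  have tot: "mR + mS = 1 + measure \<mu> (R \<inter> S)"
    using sum_cover[of m] sum_m R_sub S_sub by (subst (1 2 3) measure_eq) auto
  have mR1: "mR \<le> 1" by simp
  have mS2: "1 \<le> 2 * mS" using tot assms by (smt (verit) measure_nonneg)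
  have mRe: "mR \<le> 1 - mS + \<eta>"
    using tot overlap_le mult_left_mono[OF mR1 \<eta>_nonneg] by simp
  have e4: "(1 + \<eta>)\<^sup>2 \<le> 4" using power_mono[of "1 + \<eta>" 2 2] assms \<eta>_nonneg by simp
  have "mR * (1 + \<eta>)\<^sup>2 \<le> (1 - mS + \<eta>) * (1 + \<eta>)\<^sup>2" using mRe by (intro mult_right_mono) auto
  moreover have "\<eta> * (1 + \<eta>)\<^sup>2 \<le> \<eta> * 4" using e4 \<eta>_nonneg by (intro mult_left_mono) auto
  moreover have "mS * (1 + \<eta>)\<^sup>2 \<ge> mS * 1" using \<eta>_nonneg mS_pos by (intro mult_left_mono one_le_power) auto
  moreover have "(1 - \<eta>)\<^sup>2 - (1 + \<eta>)\<^sup>2 = - 4 * \<eta>" by (simp add: power2_eq_square algebra_simps)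
  ultimately have "mS - 8 * \<eta> \<le> (1 - \<eta>)\<^sup>2 - mR * (1 + \<eta>)\<^sup>2" by (simp add: algebra_simps)
  moreover have "mS * (1 - 16 * \<eta>) \<le> mS - 8 * \<eta>"
    using mult_left_mono[OF mS2, of "8 * \<eta>"] \<eta>_nonneg by (simp add: algebra_simps)
  ultimately have "mS * (1 - 16 * \<eta>) \<le> (1 - \<eta>)\<^sup>2 - mR * (1 + \<eta>)\<^sup>2" by simp
  then have "mR * (mS * (1 - 16 * \<eta>)) \<le> mR * ((1 - \<eta>)\<^sup>2 - mR * (1 + \<eta>)\<^sup>2)" using mR_pos by (intro mult_left_mono) auto
  then show ?thesis using 1 by (simp add: mult.assoc)
qed

lemma D_V_le: "D V \<le> C"
  unfolding C_def energy_def using \<kappa>_pos l_pos by (auto intro!: add_nonneg_nonneg mult_nonneg_nonneg s_nonneg)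

text \<open>
  The duality relation gives the mean of \<open>T\<close> under the law proportional to \<open>m (1 - V)\<close> on \<open>R\<close>. Replacing
  this law by the conditioned measure costs a covariance, which Cauchy-Schwarz and the Poincare inequality in
  \<open>R\<close> bound by the Dirichlet forms of \<open>V\<close> and \<open>T\<close>. It is essential that \<open>D T\<close> is at most \<open>mR * t\<close>: the
  integral of \<open>T\<close> over \<open>S\<close> equals \<open>1 / l\<close> and is compensated by the killing term.
\<close>

lemma mean_time_bound:
  assumes r: "\<And>f. var R f \<le> r * D f" "0 \<le> r"
  defines "s \<equiv> C * avg R T / mR"
  shows "\<bar>s - (\<Sum>x\<in>E. m x * V x) / mR\<bar> \<le> \<kappa> * r * sqrt s"
proof -
  define t where "t = avg R T"
  define e where "e = (\<Sum>x\<in>E. m x * V x)"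
  have t0: "0 \<le> t" unfolding t_def avg_def using R_sub T_nonneg by (intro divide_nonneg_nonneg sum_nonneg) auto
  have sRT: "sR T = mR * t" using mR_pos by (simp add: t_def avg_def sR_def)
  have sST: "l * sS T = 1"
    using weak_T[of "\<lambda>_. 1"] sum_m by (simp add: D2_const)
  have DT: "D T \<le> mR * t"
  proof -
    have "D T = (\<Sum>x\<in>E. m x * T x) - l * sS (\<lambda>x. (T x)\<^sup>2)"
      using weak_T[of T] by (simp add: D2_self power2_eq_square)
    also have "(\<Sum>x\<in>E. m x * T x) \<le> sR T + sS T"
      unfolding sR_def sS_def using T_nonneg by (intro sum_cover_le) simp
    also have "sS T \<le> l * sS (\<lambda>x. (T x)\<^sup>2)"
    proof -
      have "mS * (avg S T)\<^sup>2 \<le> sS (\<lambda>x. (T x)\<^sup>2)"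
        using sum_square_decomposition[OF S_sub, of T 0] var_nonneg[of S T] by (simp add: sS_def)
      moreover have "(sS T)\<^sup>2 \<le> mS * (avg S T)\<^sup>2"
      proof -
        have "sS T = mS * avg S T" using mS_pos by (simp add: avg_def sS_def)
        then have "(sS T)\<^sup>2 = mS * (mS * (avg S T)\<^sup>2)" by (simp add: power2_eq_square)
        also have "\<dots> \<le> mS * (1 * (avg S T)\<^sup>2)" using mS_pos by (intro mult_left_mono mult_right_mono) auto
        finally show ?thesis by simp
      qed
      ultimately have "l * (sS T)\<^sup>2 \<le> l * sS (\<lambda>x. (T x)\<^sup>2)" using l_pos by simp
      moreover have "l * (sS T)\<^sup>2 = sS T" using sST by (simp add: power2_eq_square mult.assoc[symmetric])
      ultimately show ?thesis by simp
    qed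
    finally show ?thesis by (simp add: sRT)
  qed
  define cov where "cov = sR (\<lambda>x. (V x - avg R V) * (T x - t))"
  have "cov\<^sup>2 \<le> var R V * var R T"
  proof -
    have "cov = (\<Sum>x\<in>R. (sqrt (m x) * (V x - avg R V)) * (sqrt (m x) * (T x - t)))"
      unfolding cov_def sR_def
    proof (intro sum.cong refl)
      fix x
      have "(sqrt (m x) * a) * (sqrt (m x) * b) = (sqrt (m x) * sqrt (m x)) * (a * b)" for a b
        by (simp only: mult_ac)
      then show "m x * ((V x - avg R V) * (T x - t)) = (sqrt (m x) * (V x - avg R V)) * (sqrt (m x) * (T x - t))"
        by simp
    qed
    also have "\<dots>\<^sup>2 \<le> (\<Sum>x\<in>R. (sqrt (m x) * (V x - avg R V))\<^sup>2) * (\<Sum>x\<in>R. (sqrt (m x) * (T x - t))\<^sup>2)"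
      by (rule Cauchy_Schwarz_ineq_sum)
    also have "\<dots> = var R V * var R T" by (simp add: power_mult_distrib var_def t_def)
    finally show ?thesis .
  qed
  also have "\<dots> \<le> (r * C) * (r * (mR * t))"
  proof (intro mult_mono var_nonneg)
    show "var R V \<le> r * C" using r(1)[of V] mult_left_mono[OF D_V_le r(2)] by linarith
    show "var R T \<le> r * (mR * t)" using r(1)[of T] mult_left_mono[OF DT r(2)] by linarith
  qed (use r(2) C_pos in auto)
  finally have cov: "\<bar>cov\<bar> \<le> sqrt ((r * C) * (r * (mR * t)))"
    using real_sqrt_le_mono by fastforce
  have s_eq: "s = C * t / mR" by (simp add: s_def t_def)
  have sq: "sqrt ((r * C) * (r * (mR * t))) = r * (mR * sqrt s)"
  proof -
    have "(r * C) * (r * (mR * t)) = (r * mR)\<^sup>2 * s" using mR_pos by (simp add: s_eq power2_eq_square)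
    then show ?thesis using r(2) mR_pos by (simp add: real_sqrt_mult)
  qed
  have "cov = sR (\<lambda>x. (1 - avg R V) * (T x - t)) - sR (\<lambda>x. (1 - V x) * T x) + t * sR (\<lambda>x. 1 - V x)"
    unfolding cov_def s_linear(3)[symmetric] s_linear(5)[symmetric] s_linear(1)[symmetric]
    by (rule arg_cong[where f = sR]) (auto simp: algebra_simps)
  moreover have "sR (\<lambda>x. (1 - avg R V) * (T x - t)) = 0"
    unfolding s_linear(5) s_linear(3) using sRT by (simp add: s_linear(7) mult.commute)
  ultimately have "cov = t * sR (\<lambda>x. 1 - V x) - sR (\<lambda>x. (1 - V x) * T x)" by simp
  then have "\<kappa> * cov = t * (\<kappa> * sR (\<lambda>x. 1 - V x)) - \<kappa> * sR (\<lambda>x. (1 - V x) * T x)"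
    by (simp only: right_diff_distrib mult.left_commute)
  then have "\<kappa> * cov = C * t - e"
    using duality C_flux_R by (simp add: e_def mult.commute)
  then have "\<bar>C * t - e\<bar> = \<kappa> * \<bar>cov\<bar>" using \<kappa>_pos abs_mult[of \<kappa> cov] by simp
  also have "\<dots> \<le> \<kappa> * (r * (mR * sqrt s))" using cov \<kappa>_pos unfolding sq by simp
  finally have "\<bar>C * t - e\<bar> / mR \<le> \<kappa> * (r * (mR * sqrt s)) / mR" using mR_pos by (intro divide_right_mono) auto
  moreover have "\<bar>C * t - e\<bar> / mR = \<bar>s - e / mR\<bar>" using mR_pos by (simp add: s_eq diff_divide_distrib[symmetric])
  ultimately show ?thesis using mR_pos by (simp add: e_def)
qed

end

context soft_killing
begin

text \<open>
  The upper bound on the gap uses \<open>V\<close> as a test function; the lower bound is the variance bound above.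
\<close>

lemma gap_between:
  assumes r: "\<And>f. var R f \<le> r * D f" "0 \<le> r" and s: "\<And>f. var S f \<le> s * D f" "0 \<le> s"
    and small: "16 * \<eta> < 1" and mRS: "mR \<le> mS"
  shows "\<exists>g>0. spectral_gap E w \<mu> = ennreal g \<and> 1 - 16 * \<eta> \<le> (1 / g) / (mR * mS / C)
           \<and> (1 / g) / (mR * mS / C) \<le> (r + s) * (2 * (C / mR)) + (1 + \<kappa> * r + l * s)"
proof -
  define M where "M = mR * mS / C"
  define K where "K = r + s + (1 + \<kappa> * r + l * s) * M"
  define W where "W = Var V"
  have M: "0 < M" using C_pos mR_pos mS_pos by (simp add: M_def)
  have K: "0 < K" unfolding K_def using r(2) s(2) M \<kappa>_pos l_pos
    by (intro add_nonneg_pos mult_pos_pos add_pos_nonneg) auto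
  have "mR * mS * (1 - 16 * \<eta>) \<le> W" unfolding W_def by (rule variance_V_ge) (use small \<eta>_nonneg mRS in auto)
  moreover have "0 < mR * mS * (1 - 16 * \<eta>)" using small mR_pos mS_pos by simp
  ultimately have W: "0 < W" "mR * mS * (1 - 16 * \<eta>) \<le> W" by auto
  have lower: "ennreal (1 / K) \<le> spectral_gap E w \<mu>"
    unfolding spectral_gap_def
  proof (rule INF_greatest, rule ennreal_leI)
    fix f :: "'a \<Rightarrow> real" assume "f \<in> {f. Var f \<noteq> 0}"
    then have ne: "Var f \<noteq> 0" by (rule CollectD)
    have "0 \<le> Var f" by (simp add: integral_nonneg_AE)
    then have v: "0 < Var f" by (rule le_neq_trans[OF _ not_sym[OF ne]])
    have "Var f \<le> K * D f"
      unfolding K_def M_def by (rule variance_le_capacity[OF r s])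
    then have "Var f / K \<le> D f" using K by (simp only: pos_divide_le_eq mult.commute)
    then have "Var f / K / Var f \<le> D f / Var f"
      using v by (intro divide_right_mono) auto
    moreover have "x / K / x = 1 / K" if "0 < x" for x :: real using that by simp
    ultimately show "1 / K \<le> D f / Var f" using v by (simp only:)
  qed
  have "spectral_gap E w \<mu> \<le> ennreal (D V / W)"
    unfolding spectral_gap_def W_def by (rule INF_lower) (use W in \<open>simp add: W_def\<close>)
  also have "\<dots> \<le> ennreal (C / W)" using D_V_le W by (intro ennreal_leI divide_right_mono) auto
  finally have upper: "spectral_gap E w \<mu> \<le> ennreal (C / W)" .
  then obtain g where g: "spectral_gap E w \<mu> = ennreal g" "0 \<le> g"
    by (cases "spectral_gap E w \<mu>") (auto simp: top_unique)
  have g1: "1 / K \<le> g" using lower g by (simp add: ennreal_le_iff)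
  have g2: "g \<le> C / W" using upper g C_pos W by (simp add: ennreal_le_iff)
  have g0: "0 < g" using less_le_trans[OF _ g1, of 0] K by simp
  have gK: "1 / g \<le> K" using g1 g0 K by (simp add: field_simps)
  have gW: "W / C \<le> 1 / g" using g2 g0 W C_pos by (simp add: field_simps)
  have mS2: "1 \<le> 2 * mS"
    using measure_cover mRS by simp
  have "1 - 16 * \<eta> = (mR * mS * (1 - 16 * \<eta>) / C) / M" using C_pos mR_pos mS_pos by (simp add: M_def)
  also have "\<dots> \<le> (W / C) / M" using W C_pos M by (intro divide_right_mono) auto
  also have "\<dots> \<le> (1 / g) / M" using gW M by (intro divide_right_mono) auto
  finally have A: "1 - 16 * \<eta> \<le> (1 / g) / M" .
  have "(1 / g) / M \<le> K / M" using gK M by (intro divide_right_mono) auto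
  also have "\<dots> = (r + s) * (1 / M) + (1 + \<kappa> * r + l * s)" using M by (simp add: K_def add_divide_distrib)
  also have "1 / M \<le> 2 * (C / mR)"
  proof -
    have "1 / M = C / mR * (1 / mS)" by (simp add: M_def)
    also have "\<dots> \<le> C / mR * 2" using mS2 mS_pos C_pos mR_pos by (intro mult_left_mono) (auto simp: pos_divide_le_eq)
    finally show ?thesis by (simp only: mult.commute)
  qed
  finally have B: "(1 / g) / M \<le> (r + s) * (2 * (C / mR)) + (1 + \<kappa> * r + l * s)"
    using r(2) s(2) by (simp add: mult_left_mono)
  show ?thesis using g g0 A B unfolding M_def by blast
qed

text \<open>
  Under smallness of \<open>a * r\<close> the capacity bound by the exit rate can be solved for \<open>C\<close>.
\<close>

lemma capacity_upper:
  assumes r: "\<And>f. var R f \<le> r * D f" "0 \<le> r"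
    and a: "exit_rate E w \<mu> (R - S) = ennreal a" "0 \<le> a" and ar: "a * r \<le> 1 / 2"
  shows "C / mR \<le> 2 * (a * (1 + \<kappa> * r))"
proof -
  define Q where "Q = C * r + mR * (1 + \<kappa> * r)"
  have Q: "0 < Q" unfolding Q_def
    using C_pos mR_pos \<kappa>_pos r(2) by (intro add_nonneg_pos mult_pos_pos mult_nonneg_nonneg add_pos_nonneg) auto
  have "C / Q \<le> a" using capacity_le_exit_rate[OF r] a by (simp add: Q_def ennreal_le_iff)
  then have "C \<le> a * Q" using Q by (simp add: pos_divide_le_eq)
  then have "C \<le> (a * r) * C + mR * (a * (1 + \<kappa> * r))" by (simp add: Q_def algebra_simps)
  also have "(a * r) * C \<le> (1 / 2) * C" using ar C_pos by (intro mult_right_mono) auto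
  finally have "C \<le> mR * (2 * (a * (1 + \<kappa> * r)))" by simp
  then show ?thesis using mR_pos by (simp add: pos_divide_le_eq mult.commute)
qed

lemma \<eta>_eq: "\<eta> = (C / mR) * (1 / \<kappa> + 1 / l)"
  using mR_pos \<kappa>_pos l_pos by (simp add: \<eta>_def field_simps)

end

lemma sqrt_perturbation:
  fixes s v \<eta> \<delta> :: real
  assumes "\<bar>s - v\<bar> \<le> \<delta> * sqrt s" "0 \<le> s" "\<bar>v - 1\<bar> \<le> \<eta>" "0 \<le> \<delta>" "\<delta> < 1"
  shows "(1 - \<eta> - \<delta>) / (1 + \<delta>) \<le> s" "s \<le> (1 + \<eta> + \<delta>) / (1 - \<delta>)"
proof -
  have "sqrt s \<le> 1 + s"
    using assms(2) by (intro real_le_lsqrt) (auto simp: power2_eq_square algebra_simps)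
  then have "\<delta> * sqrt s \<le> \<delta> * (1 + s)" using assms(4) by (rule mult_left_mono)
  then have 1: "\<bar>s - v\<bar> \<le> \<delta> * (1 + s)" using assms(1) by linarith
  have "1 - \<eta> - \<delta> \<le> s * (1 + \<delta>)" using 1 assms(3) by (simp add: algebra_simps abs_le_iff)
  then show "(1 - \<eta> - \<delta>) / (1 + \<delta>) \<le> s" using assms(4) by (simp add: pos_divide_le_eq)
  have "s * (1 - \<delta>) \<le> 1 + \<eta> + \<delta>" using 1 assms(3) by (simp add: algebra_simps abs_le_iff)
  then show "s \<le> (1 + \<eta> + \<delta>) / (1 - \<delta>)" using assms(5) by (simp add: pos_le_divide_eq)
qed

section \<open>Asymptotics\<close>

text \<open>
  Both ratios of the theorem, for a single value of the parameters, with explicit error terms in the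
  five quantities \<open>a * r\<close>, \<open>a * s\<close>, \<open>\<kappa> * r\<close>, \<open>l * s\<close> and \<open>a / \<kappa> + a / l\<close>. Here \<open>a\<close> is the exit rate of \<open>R - S\<close>, and \<open>r\<close>
  and \<open>s\<close> are the inverse gaps of \<open>R\<close> and \<open>S\<close>. The number \<open>e\<close> bounds the error \<open>\<eta>\<close>.
\<close>

lemma metastable_ratio_bounds:
  assumes E: "E = R \<union> S" and rev: "reversible_dynamics E w \<mu>" and mp: "markov_process E w P X"
    and RS: "R - S \<noteq> {}" "S - R \<noteq> {}" and pos: "0 < \<kappa>" "0 < l"
    and gaps: "0 < restricted_gap w \<mu> R" "0 < restricted_gap w \<mu> S"
    and exit: "exit_rate E w \<mu> (R - S) \<noteq> top"
    and mRS: "measure \<mu> R \<le> measure \<mu> S"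
  defines "a \<equiv> enn2real (exit_rate E w \<mu> (R - S))"
    and "r \<equiv> enn2real (1 / restricted_gap w \<mu> R)" and "s \<equiv> enn2real (1 / restricted_gap w \<mu> S)"
    and "C \<equiv> soft_capacity E w \<mu> P X \<kappa> l R S"
  defines "e \<equiv> 2 * (a / \<kappa> + a / l) * (1 + \<kappa> * r)"
  assumes small: "a * r \<le> 1 / 2" "16 * e < 1" "\<kappa> * r < 1"
  shows "ennreal (1 - 16 * e) \<le> (1 / spectral_gap E w \<mu>) / ennreal (measure \<mu> R * measure \<mu> S / C)"
    and "(1 / spectral_gap E w \<mu>) / ennreal (measure \<mu> R * measure \<mu> S / C)
          \<le> ennreal (4 * (a * r + a * s) * (1 + \<kappa> * r) + (1 + \<kappa> * r + l * s))"
    and "ennreal ((1 - e - \<kappa> * r) / (1 + \<kappa> * r)) \<le> mean_killing_time P X (cond_pmf \<mu> R) l S / ennreal (measure \<mu> R / C)"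
    and "mean_killing_time P X (cond_pmf \<mu> R) l S / ennreal (measure \<mu> R / C) \<le> ennreal ((1 + e + \<kappa> * r) / (1 - \<kappa> * r))"
proof -
  interpret reversible_chain E w \<mu> by unfold_locales (rule rev)
  have sub: "R \<subseteq> E" "R \<noteq> {}" "S \<subseteq> E" "S \<noteq> {}" using E RS by auto
  obtain z where z: "z \<in> S" "z \<in> E" using sub by auto
  let ?c = "\<lambda>y. \<kappa> * indicator R y + l * indicator S y"
  have c: "0 \<le> ?c y" "0 < ?c z" for y using pos z by (auto simp: add_nonneg_pos)
  have cS: "0 \<le> l * indicator S y" "0 < l * indicator S z" for y using pos z by auto
  obtain V where V: "\<And>y. y \<in> E \<Longrightarrow> generator E w V y - ?c y * V y = - (\<kappa> * indicator R y)"
    using killed_equation_solvable[of ?c z "\<lambda>y. - (\<kappa> * indicator R y)"] c z by blast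
  obtain g1 where g1: "\<And>y. y \<in> E \<Longrightarrow> generator E w g1 y - ?c y * g1 y = - 1"
    using killed_equation_solvable[of ?c z "\<lambda>_. - 1"] c z by blast
  obtain T where T: "\<And>y. y \<in> E \<Longrightarrow> generator E w T y - l * indicator S y * T y = - 1"
    using killed_equation_solvable[of "\<lambda>y. l * indicator S y" z "\<lambda>_. - 1"] cS z by blast
  have jp: "jump_process (P x) E w X x" if "x \<in> E" for x
    by (rule jump_process_of_markov_process[OF mp finite_E that])
  have hit: "hitting_prob P X \<kappa> l R S x = V x" "0 \<le> V x" "V x \<le> 1" if "x \<in> E" for x
    using jump_process.hitting_prob_solution[OF jp[OF that] pos(2,1) g1 V] by (auto simp: hitting_prob_def)
  have time: "(\<integral>\<^sup>+(\<omega>, b). killing_time X S \<omega> b \<partial>(P x \<Otimes>\<^sub>M exponential l)) = ennreal (T x)" "0 \<le> T x" if "x \<in> E" for x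
    using jump_process.mean_killing_time_solution[OF jp[OF that] pos(2) T] by auto
  interpret K: soft_killing E w \<mu> R S \<kappa> l V T
    by unfold_locales ((rule E RS pos V hit(2,3) T time(2); assumption?)+)
  have C: "C = K.C" unfolding C_def by (rule K.soft_capacity_eq) (rule hit(1))
  have C0: "0 < C" unfolding C by (rule K.C_pos)
  have a0: "0 \<le> a" "exit_rate E w \<mu> (R - S) = ennreal a"
    using exit by (auto simp: a_def less_top)
  have r: "\<And>f. var R f \<le> r * D f" "0 \<le> r" using poincare[OF sub(1,2) gaps(1)] by (auto simp: r_def)
  have s: "\<And>f. var S f \<le> s * D f" "0 \<le> s" using poincare[OF sub(3,4) gaps(2)] by (auto simp: s_def)
  have u: "C / measure \<mu> R \<le> 2 * (a * (1 + \<kappa> * r))"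
    unfolding C by (rule K.capacity_upper[OF r a0(2,1) small(1)])
  have \<eta>: "K.\<eta> \<le> e"
  proof -
    have "K.\<eta> \<le> 2 * (a * (1 + \<kappa> * r)) * (1 / \<kappa> + 1 / l)"
      unfolding K.\<eta>_eq using u pos by (intro mult_right_mono) (auto simp: C)
    also have "\<dots> = e" by (simp add: e_def algebra_simps add_divide_distrib)
    finally show ?thesis .
  qed
  have M0: "0 < measure \<mu> R * measure \<mu> S / C" using C0 K.mR_pos K.mS_pos by simp
  obtain g where g: "0 < g" "spectral_gap E w \<mu> = ennreal g"
    "1 - 16 * K.\<eta> \<le> (1 / g) / (measure \<mu> R * measure \<mu> S / C)"
    "(1 / g) / (measure \<mu> R * measure \<mu> S / C) \<le> (r + s) * (2 * (C / measure \<mu> R)) + (1 + \<kappa> * r + l * s)"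
    using K.gap_between[OF r s _ mRS] \<eta> small(2) unfolding C by auto
  have ratio: "(1 / spectral_gap E w \<mu>) / ennreal (measure \<mu> R * measure \<mu> S / C) = ennreal ((1 / g) / (measure \<mu> R * measure \<mu> S / C))"
  proof -
    have "1 / spectral_gap E w \<mu> = ennreal (1 / g)"
      using g(1,2) divide_ennreal[of 1 g] by simp
    then show ?thesis using divide_ennreal[OF _ M0, of "1 / g"] g(1) by simp
  qed
  show "ennreal (1 - 16 * e) \<le> (1 / spectral_gap E w \<mu>) / ennreal (measure \<mu> R * measure \<mu> S / C)"
    unfolding ratio using g(3) \<eta> by (intro ennreal_leI) linarith
  have "(r + s) * (2 * (C / measure \<mu> R)) \<le> (r + s) * (2 * (2 * (a * (1 + \<kappa> * r))))"
    using u r(2) s(2) by (intro mult_left_mono) auto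
  also have "\<dots> = 4 * (a * r + a * s) * (1 + \<kappa> * r)" by (simp add: algebra_simps)
  finally show "(1 / spectral_gap E w \<mu>) / ennreal (measure \<mu> R * measure \<mu> S / C)
          \<le> ennreal (4 * (a * r + a * s) * (1 + \<kappa> * r) + (1 + \<kappa> * r + l * s))"
    unfolding ratio using g(4) by (intro ennreal_leI) linarith
  define q where "q = C * avg R T / measure \<mu> R"
  have t0: "0 \<le> avg R T" unfolding avg_def using sub time(2) by (intro divide_nonneg_nonneg sum_nonneg) auto
  have mean: "mean_killing_time P X (cond_pmf \<mu> R) l S = ennreal (avg R T)"
  proof -
    have set_eq: "set_pmf (cond_pmf \<mu> R) \<subseteq> R"
      using pmf_cond_eq[OF sub(1,2)] by (auto simp: set_pmf_iff split: if_splits)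
    have fin: "finite (set_pmf (cond_pmf \<mu> R))"
      using finite_subset[OF set_eq] finite_subset[OF sub(1) finite_E] by simp
    have "mean_killing_time P X (cond_pmf \<mu> R) l S = (\<integral>\<^sup>+x. ennreal (T x) \<partial>measure_pmf (cond_pmf \<mu> R))"
      unfolding mean_killing_time_def
      by (rule nn_integral_cong_AE) (use time(1) set_eq sub(1) in \<open>auto simp: AE_measure_pmf_iff\<close>)
    also have "\<dots> = ennreal (measure_pmf.expectation (cond_pmf \<mu> R) T)"
      by (rule nn_integral_eq_integral[OF integrable_measure_pmf_finite[OF fin]])
         (use time(2) set_eq sub(1) in \<open>auto simp: AE_measure_pmf_iff\<close>)
    finally show ?thesis by (simp add: expectation_cond[OF sub(1,2)] avg_def)
  qed
  have mean_ratio: "mean_killing_time P X (cond_pmf \<mu> R) l S / ennreal (measure \<mu> R / C) = ennreal q"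
  proof -
    have "0 < measure \<mu> R / C" using C0 K.mR_pos by simp
    then have "ennreal (avg R T) / ennreal (measure \<mu> R / C) = ennreal (avg R T / (measure \<mu> R / C))"
      by (rule divide_ennreal[OF t0])
    then show ?thesis by (simp add: mean q_def mult.commute)
  qed
  have q0: "0 \<le> q" unfolding q_def using t0 C0 by simp
  let ?v = "(\<Sum>x\<in>E. m x * V x) / measure \<mu> R"
  have qv: "\<bar>q - ?v\<bar> \<le> \<kappa> * r * sqrt q"
    using K.mean_time_bound[OF r] by (simp add: q_def C)
  have v1: "\<bar>?v - 1\<bar> \<le> e"
  proof -
    have "1 - K.\<eta> \<le> ?v" "?v \<le> 1 + K.\<eta>"
      using K.EV_bounds K.mR_pos by (simp_all add: pos_le_divide_eq pos_divide_le_eq mult.commute)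
    then show ?thesis using \<eta> by linarith
  qed
  have kr: "0 \<le> \<kappa> * r" using pos r(2) by simp
  show "ennreal ((1 - e - \<kappa> * r) / (1 + \<kappa> * r)) \<le> mean_killing_time P X (cond_pmf \<mu> R) l S / ennreal (measure \<mu> R / C)"
    unfolding mean_ratio by (intro ennreal_leI sqrt_perturbation(1)[OF qv q0 v1 kr small(3)])
  show "mean_killing_time P X (cond_pmf \<mu> R) l S / ennreal (measure \<mu> R / C) \<le> ennreal ((1 + e + \<kappa> * r) / (1 - \<kappa> * r))"
    unfolding mean_ratio by (intro ennreal_leI sqrt_perturbation(2)[OF qv q0 v1 kr small(3)])
qed

lemma negligible_enn2real:
  assumes "f \<lless>[F] g"
  shows "((\<lambda>p. enn2real (f p / g p)) \<longlongrightarrow> 0) F"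
  using tendsto_enn2real[of "\<lambda>p. f p / g p" 0 F] assms by (simp add: asymp_negligible_def)

lemma enn2real_div: "enn2real (x / y) = enn2real x * enn2real (1 / y)"
  by (simp add: divide_ennreal_def enn2real_mult)

theorem theorem1:
  fixes F :: "'p filter"
    and E R S :: "'p \<Rightarrow> 'a set"
    and w :: "'p \<Rightarrow> 'a \<Rightarrow> 'a \<Rightarrow> real"
    and \<mu> :: "'p \<Rightarrow> 'a pmf"
    and P :: "'p \<Rightarrow> 'a \<Rightarrow> 'b measure"
    and X :: "'p \<Rightarrow> real \<Rightarrow> 'b \<Rightarrow> 'a"
    and \<kappa> l :: "'p \<Rightarrow> real"
  assumes "\<And>p. E p = R p \<union> S p"
    and "\<And>p. reversible_dynamics (E p) (w p) (\<mu> p)"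
    and "\<And>p. markov_process (E p) (w p) (P p) (X p)"
    and "\<forall>\<^sub>F p in F. irreducible_on (R p) (w p) \<and> irreducible_on (R p - S p) (w p) \<and>
           irreducible_on (S p) (w p) \<and> irreducible_on (S p - R p) (w p)"
    and "(\<lambda>p. exit_rate (E p) (w p) (\<mu> p) (R p - S p)) \<lless>[F] (\<lambda>p. restricted_gap (w p) (\<mu> p) (R p))"
    and "(\<lambda>p. exit_rate (E p) (w p) (\<mu> p) (S p - R p)) \<lless>[F] (\<lambda>p. restricted_gap (w p) (\<mu> p) (S p))"
    and "\<forall>\<^sub>F p in F. measure (\<mu> p) (S p) \<ge> measure (\<mu> p) (R p)"
    and "(\<lambda>p. exit_rate (E p) (w p) (\<mu> p) (R p - S p)) \<lless>[F] (\<lambda>p. restricted_gap (w p) (\<mu> p) (S p))"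
    and "\<And>p. \<kappa> p > 0"
    and "\<And>p. l p > 0"
    and "(\<lambda>p. exit_rate (E p) (w p) (\<mu> p) (R p - S p)) \<lless>[F] (\<lambda>p. ennreal (\<kappa> p))"
    and "(\<lambda>p. ennreal (\<kappa> p)) \<lless>[F] (\<lambda>p. restricted_gap (w p) (\<mu> p) (R p))"
    and "(\<lambda>p. max (exit_rate (E p) (w p) (\<mu> p) (R p - S p)) (exit_rate (E p) (w p) (\<mu> p) (S p - R p)))
           \<lless>[F] (\<lambda>p. ennreal (l p))"
    and "(\<lambda>p. ennreal (l p)) \<lless>[F] (\<lambda>p. restricted_gap (w p) (\<mu> p) (S p))"
  shows "(\<lambda>p. 1 / spectral_gap (E p) (w p) (\<mu> p)) \<simeq>[F]
           (\<lambda>p. ennreal (measure (\<mu> p) (R p) * measure (\<mu> p) (S p) /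
                  soft_capacity (E p) (w p) (\<mu> p) (P p) (X p) (\<kappa> p) (l p) (R p) (S p)))
       \<and> (\<lambda>p. mean_killing_time (P p) (X p) (cond_pmf (\<mu> p) (R p)) (l p) (S p)) \<simeq>[F]
           (\<lambda>p. ennreal (measure (\<mu> p) (R p) /
                  soft_capacity (E p) (w p) (\<mu> p) (P p) (X p) (\<kappa> p) (l p) (R p) (S p)))"
proof -
  \<comment> \<open>Exit rate of \<open>R - S\<close> and inverse gaps, as real numbers.\<close>
  define a where "a p = enn2real (exit_rate (E p) (w p) (\<mu> p) (R p - S p))" for p
  define r where "r p = enn2real (1 / restricted_gap (w p) (\<mu> p) (R p))" for p
  define s where "s p = enn2real (1 / restricted_gap (w p) (\<mu> p) (S p))" for p
  have ar: "((\<lambda>p. a p * r p) \<longlongrightarrow> 0) F"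
    using negligible_enn2real[OF assms(5)] unfolding a_def r_def enn2real_div[symmetric] .
  have as: "((\<lambda>p. a p * s p) \<longlongrightarrow> 0) F"
    using negligible_enn2real[OF assms(8)] unfolding a_def s_def enn2real_div[symmetric] .
  have kr: "((\<lambda>p. \<kappa> p * r p) \<longlongrightarrow> 0) F"
  proof -
    have "enn2real (ennreal (\<kappa> p) / restricted_gap (w p) (\<mu> p) (R p)) = \<kappa> p * r p" for p
      using assms(9)[of p] by (subst enn2real_div) (simp add: r_def)
    then show ?thesis using negligible_enn2real[OF assms(12)] by simp
  qed
  have ls: "((\<lambda>p. l p * s p) \<longlongrightarrow> 0) F"
  proof -
    have "enn2real (ennreal (l p) / restricted_gap (w p) (\<mu> p) (S p)) = l p * s p" for p
      using assms(10)[of p] by (subst enn2real_div) (simp add: s_def)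
    then show ?thesis using negligible_enn2real[OF assms(14)] by simp
  qed
  have inv: "enn2real (1 / ennreal x) = 1 / x" if "0 < x" for x
    using that divide_ennreal[of 1 x] by simp
  have ak: "((\<lambda>p. a p / \<kappa> p) \<longlongrightarrow> 0) F"
  proof -
    have "enn2real (exit_rate (E p) (w p) (\<mu> p) (R p - S p) / ennreal (\<kappa> p)) = a p / \<kappa> p" for p
      by (subst enn2real_div) (simp add: a_def inv assms(9))
    then show ?thesis using negligible_enn2real[OF assms(11)] by simp
  qed
  have al: "((\<lambda>p. a p / l p) \<longlongrightarrow> 0) F"
  proof -
    \<comment> \<open>The exit rate of \<open>R - S\<close> is bounded by the maximum in the hypothesis on \<open>l\<close>.\<close>
    have exit_l: "(\<lambda>p. exit_rate (E p) (w p) (\<mu> p) (R p - S p)) \<lless>[F] (\<lambda>p. ennreal (l p))"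
      unfolding asymp_negligible_def
      by (rule tendsto_sandwich[OF _ _ tendsto_const assms(13)[unfolded asymp_negligible_def]])
         (auto intro!: always_eventually divide_right_mono_ennreal)
    have "enn2real (exit_rate (E p) (w p) (\<mu> p) (R p - S p) / ennreal (l p)) = a p / l p" for p
      by (subst enn2real_div) (simp add: a_def inv assms(10))
    then show ?thesis using negligible_enn2real[OF exit_l] by simp
  qed
  define e where "e p = 2 * (a p / \<kappa> p + a p / l p) * (1 + \<kappa> p * r p)" for p
  have "((\<lambda>p. 2 * (a p / \<kappa> p + a p / l p) * (1 + \<kappa> p * r p)) \<longlongrightarrow> 2 * (0 + 0) * (1 + 0)) F"
    by (intro tendsto_intros ak al kr)
  then have e: "(e \<longlongrightarrow> 0) F" by (simp add: e_def[abs_def])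
  define C where "C p = soft_capacity (E p) (w p) (\<mu> p) (P p) (X p) (\<kappa> p) (l p) (R p) (S p)" for p
  define gap_ratio where "gap_ratio p =
    (1 / spectral_gap (E p) (w p) (\<mu> p)) / ennreal (measure (\<mu> p) (R p) * measure (\<mu> p) (S p) / C p)" for p
  define time_ratio where "time_ratio p =
    mean_killing_time (P p) (X p) (cond_pmf (\<mu> p) (R p)) (l p) (S p) / ennreal (measure (\<mu> p) (R p) / C p)" for p
  have "\<forall>\<^sub>F p in F. exit_rate (E p) (w p) (\<mu> p) (R p - S p) / ennreal (\<kappa> p) < 1"
    using assms(11) unfolding asymp_negligible_def by (rule order_tendstoD) simp
  moreover have "\<forall>\<^sub>F p in F. ennreal (\<kappa> p) / restricted_gap (w p) (\<mu> p) (R p) < 1"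
    using assms(12) unfolding asymp_negligible_def by (rule order_tendstoD) simp
  moreover have "\<forall>\<^sub>F p in F. ennreal (l p) / restricted_gap (w p) (\<mu> p) (S p) < 1"
    using assms(14) unfolding asymp_negligible_def by (rule order_tendstoD) simp
  moreover have "\<forall>\<^sub>F p in F. a p * r p < 1 / 2" using ar by (rule order_tendstoD) simp
  moreover have "\<forall>\<^sub>F p in F. e p < 1 / 16" using e by (rule order_tendstoD) simp
  moreover have "\<forall>\<^sub>F p in F. \<kappa> p * r p < 1" using kr by (rule order_tendstoD) simp
  ultimately have bounds: "\<forall>\<^sub>F p in F.
     ennreal (1 - 16 * e p) \<le> gap_ratio p \<and>
     gap_ratio p \<le> ennreal (4 * (a p * r p + a p * s p) * (1 + \<kappa> p * r p) + (1 + \<kappa> p * r p + l p * s p)) \<and>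
     ennreal ((1 - e p - \<kappa> p * r p) / (1 + \<kappa> p * r p)) \<le> time_ratio p \<and>
     time_ratio p \<le> ennreal ((1 + e p + \<kappa> p * r p) / (1 - \<kappa> p * r p))"
    using assms(4,7)
  proof eventually_elim
    case (elim p)
    \<comment> \<open>The gaps do not vanish, since a positive number divided by \<open>0\<close> is \<open>\<infinity>\<close>.\<close>
    have "restricted_gap (w p) (\<mu> p) (R p) \<noteq> 0"
      using elim(2) assms(9)[of p] by (auto simp: divide_ennreal_def ennreal_mult_top)
    moreover have "restricted_gap (w p) (\<mu> p) (S p) \<noteq> 0"
      using elim(3) assms(10)[of p] by (auto simp: divide_ennreal_def ennreal_mult_top)
    moreover have "exit_rate (E p) (w p) (\<mu> p) (R p - S p) \<noteq> top"
      using elim(1) assms(9)[of p] by (auto simp: ennreal_top_divide)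
    moreover have "R p - S p \<noteq> {}" "S p - R p \<noteq> {}" using elim(7) by (auto simp: irreducible_on_def)
    ultimately have "0 < restricted_gap (w p) (\<mu> p) (R p)" "0 < restricted_gap (w p) (\<mu> p) (S p)"
      "exit_rate (E p) (w p) (\<mu> p) (R p - S p) \<noteq> top" "R p - S p \<noteq> {}" "S p - R p \<noteq> {}"
      by (simp_all add: zero_less_iff_neq_zero)
    note b = metastable_ratio_bounds[OF assms(1,2,3) this(4,5) assms(9,10) this(1,2,3) elim(8)
        less_imp_le[OF elim(4)[unfolded a_def r_def]] _ elim(6)[unfolded r_def]]
    have e16: "16 * e p < 1" using elim(5) by simp
    show ?case
      unfolding gap_ratio_def time_ratio_def C_def e_def a_def r_def s_def by (intro conjI b e16[unfolded e_def a_def r_def])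
  qed
  have "((\<lambda>p. 1 - 16 * e p) \<longlongrightarrow> 1 - 16 * 0) F"
    by (intro tendsto_intros e)
  from tendsto_ennrealI[OF this] have lim1: "((\<lambda>p. ennreal (1 - 16 * e p)) \<longlongrightarrow> 1) F" by simp
  have "((\<lambda>p. 4 * (a p * r p + a p * s p) * (1 + \<kappa> p * r p) + (1 + \<kappa> p * r p + l p * s p))
      \<longlongrightarrow> 4 * (0 + 0) * (1 + 0) + (1 + 0 + 0)) F"
    by (intro tendsto_add tendsto_mult tendsto_const ar as kr ls)
  from tendsto_ennrealI[OF this]
  have lim2: "((\<lambda>p. ennreal (4 * (a p * r p + a p * s p) * (1 + \<kappa> p * r p) + (1 + \<kappa> p * r p + l p * s p))) \<longlongrightarrow> 1) F"
    by simp
  have "((\<lambda>p. (1 - e p - \<kappa> p * r p) / (1 + \<kappa> p * r p)) \<longlongrightarrow> (1 - 0 - 0) / (1 + 0)) F"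
    by (intro tendsto_divide tendsto_add tendsto_diff tendsto_const e kr) simp
  from tendsto_ennrealI[OF this]
  have lim3: "((\<lambda>p. ennreal ((1 - e p - \<kappa> p * r p) / (1 + \<kappa> p * r p))) \<longlongrightarrow> 1) F" by simp
  have "((\<lambda>p. (1 + e p + \<kappa> p * r p) / (1 - \<kappa> p * r p)) \<longlongrightarrow> (1 + 0 + 0) / (1 - 0)) F"
    by (intro tendsto_divide tendsto_add tendsto_diff tendsto_const e kr) simp
  from tendsto_ennrealI[OF this]
  have lim4: "((\<lambda>p. ennreal ((1 + e p + \<kappa> p * r p) / (1 - \<kappa> p * r p))) \<longlongrightarrow> 1) F" by simp
  note b = bounds[unfolded eventually_conj_iff]
  show ?thesis
    unfolding asymp_equal_def C_def[symmetric] gap_ratio_def[symmetric] time_ratio_def[symmetric]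
    using tendsto_sandwich[OF conjunct1[OF b] conjunct1[OF conjunct2[OF b]] lim1 lim2]
      tendsto_sandwich[OF conjunct1[OF conjunct2[OF conjunct2[OF b]]] conjunct2[OF conjunct2[OF conjunct2[OF b]]] lim3 lim4]
    by (rule conjI)
qed

end
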